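(* Let $(\overline{\overline{g}},\overline{\overline{q}})\in\mathcal{H}\times\mathcal{Q}$ be the unique minimizer over $\mathcal{H}\times\mathcal{Q}$ of $$J^+(g,q)=\tfrac12\|u_{g\,q}-z_d\|_{\mathcal{H}}^2+\tfrac{M_1}{2}\|g\|_{\mathcal{H}}^2+\tfrac M2\|q\|_{\mathcal{Q}}^2 .$$ For fixed $g\in\mathcal{H}$ let $\overline{q}\in\mathcal{Q}$ be the unique minimizer over $q\in\mathcal{Q}$ of $$J_1(q)=\tfrac12\|u_{g\,q}-z_d\|_{\mathcal{H}}^2+\tfrac{M_1}{2}\|g\|_{\mathcal{H}}^2+\tfrac M2\|q\|_{\mathcal{Q}}^2 .$$ Then, for every $g\in\mathcal{H}$, $$\|\overline{q}-\overline{\overline{q}}\|_{\mathcal{Q}}\le\frac{\|\gamma_0\|}{\lambda_0M}\,\|u_{\overline{\overline{g}}\,\overline{\overline{q}}}-u_{g\,\overline{q}}\|_{\mathcal{H}} .$$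
   Context: $\Omega\subset\mathbb{R}^n$ is a bounded domain with regular boundary $\Gamma=\Gamma_1\cup\Gamma_2$, $\Gamma_1,\Gamma_2$ disjoint with positive $(n-1)$-dimensional measure; $T>0$. Put $V=H^1(\Omega)$, $V_0=\{v\in V: v|_{\Gamma_1}=0\}$, $H=L^2(\Omega)$, $Q=L^2(\Gamma_2)$, $\mathcal{H}=L^2(0,T;H)$, $\mathcal{Q}=L^2(0,T;Q)$, and $a(u,v)=\int_\Omega\nabla u\cdot\nabla v\,dx$. $\gamma_0$ is the trace operator $V\to Q$, with $\|\gamma_0\|=\sup_{v\in V\setminus\{0\}}\|\gamma_0(v)\|_Q/\|v\|_V$, and $\lambda_0>0$ is the coerciveness constant of $a$ on $V_0$: $a(v,v)\ge\lambda_0\|v\|_V^2$ for all $v\in V_0$. Fixed data: $z_d\in\mathcal{H}$, $b\in H^{1/2}(\Gamma_1)$, $v_b\in V$ with $v_b=b$ on $\Gamma_1$, and constants $M,M_1>0$; data and domain are sufficiently smooth for the variational problem below to have a unique solution. For $g\in\mathcal{H}$ and $q\in\mathcal{Q}$, $u_{g\,q}$ is the unique function with $u_{g\,q}-v_b\in L^2(0,T;V_0)$, $\dot u_{g\,q}\in L^2(0,T;V_0')$, $u_{g\,q}(0)=v_b$ and, for a.e. $t\in(0,T)$, $\langle\dot u_{g\,q}(t),v\rangle+a(u_{g\,q}(t),v)=(g(t),v)_H-(q(t),v)_Q$ for all $v\in V_0$ (traces are understood in $(q(t),v)_Q$). The minimization problems for $J^+$ and for $J_1$ (for each fixed $g$)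 have unique solutions; $\overline{q}$ depends on $g$. *)

theory Defs
  imports "HOL-Analysis.Analysis"
begin

text \<open>
  Elements of \<open>L\<^sup>2\<close>, Sobolev and Bochner spaces are represented by functions; a space is the set of
  all representatives, and its norm is a seminorm whose null elements are the representatives of 0.
\<close>

section \<open>Hausdorff and surface measure\<close>

definition hausdorff_premeasure :: "nat \<Rightarrow> real \<Rightarrow> 'a::metric_space set \<Rightarrow> ennreal" where
  "hausdorff_premeasure k \<delta> A =
     (INF U \<in> {U :: nat \<Rightarrow> 'a set. A \<subseteq> (\<Union>i. U i) \<and> (\<forall>i. bounded (U i) \<and> diameter (U i) \<le> \<delta>)}.
        \<Sum>i. if U i = {} then 0
            else ennreal (unit_ball_vol (real k) * (diameter (U i) / 2) ^ k))"

definition hausdorff_outer :: "nat \<Rightarrow> 'a::metric_space set \<Rightarrow> ennreal" where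
  "hausdorff_outer k A = (SUP \<delta> \<in> {0<..}. hausdorff_premeasure k \<delta> A)"

text \<open>The measurable sets are those satisfying the Caratheodory criterion.\<close>

definition hausdorff_measure :: "nat \<Rightarrow> 'a::metric_space measure" where
  "hausdorff_measure k =
     measure_of UNIV (lambda_system UNIV (Pow UNIV) (hausdorff_outer k)) (hausdorff_outer k)"

lemma hausdorff_premeasure_subadditive:
  fixes A :: "nat \<Rightarrow> 'a::metric_space set"
  shows "hausdorff_premeasure k \<delta> (\<Union>i. A i) \<le> (\<Sum>i. hausdorff_premeasure k \<delta> (A i))"
proof (rule ennreal_le_epsilon)
  define w :: "'a set \<Rightarrow> ennreal" where
    "w S = (if S = {} then 0 else ennreal (unit_ball_vol (real k) * (diameter S / 2) ^ k))" for S
  let ?ok = "\<lambda>A U. A \<subseteq> (\<Union>i. U i) \<and> (\<forall>i::nat. bounded (U i) \<and> diameter (U i) \<le> \<delta>)"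
  have pre: "hausdorff_premeasure k \<delta> B = (INF U \<in> {U. ?ok B U}. \<Sum>i. w (U i))" for B
    by (simp add: hausdorff_premeasure_def w_def)
  fix e :: real
  assume fin: "(\<Sum>i. hausdorff_premeasure k \<delta> (A i)) < top" and e: "0 < e"
  have "\<exists>U. ?ok (A i) U \<and> (\<Sum>j. w (U j)) \<le> hausdorff_premeasure k \<delta> (A i) + e * (1/2)^Suc i" for i
  proof -
    have "hausdorff_premeasure k \<delta> (A i) < top"
      using fin ennreal_suminf_lessD by blast
    hence "hausdorff_premeasure k \<delta> (A i) < hausdorff_premeasure k \<delta> (A i) + e * (1/2)^Suc i"
      using e by (auto simp: ennreal_zero_less_mult_iff)
    thus ?thesis unfolding pre INF_less_iff by (force intro: less_imp_le)
  qed
  then obtain U where U: "\<And>i. ?ok (A i) (U i)"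
    and le: "\<And>i. (\<Sum>j. w (U i j)) \<le> hausdorff_premeasure k \<delta> (A i) + e * (1/2)^Suc i"
    by metis
  define V where "V n = case_prod U (prod_decode n)" for n
  have "(\<Union>i. A i) \<subseteq> (\<Union>n. V n)"
  proof
    fix x assume "x \<in> (\<Union>i. A i)"
    then obtain i j where "x \<in> U i j" using U by blast
    hence "x \<in> V (prod_encode (i, j))" by (simp add: V_def)
    thus "x \<in> (\<Union>n. V n)" by blast
  qed
  hence "?ok (\<Union>i. A i) V" using U by (auto simp: V_def split: prod.split)
  hence "hausdorff_premeasure k \<delta> (\<Union>i. A i) \<le> (\<Sum>n. w (V n))"
    unfolding pre by (intro INF_lower) auto
  also have "\<dots> = (\<Sum>i. \<Sum>j. w (U i j))"
    using suminf_ennreal_2dimen[of "\<lambda>i. \<Sum>j. w (U i j)" "\<lambda>p. w (case_prod U p)"]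
    by (simp add: V_def)
  also have "\<dots> \<le> (\<Sum>i. hausdorff_premeasure k \<delta> (A i) + e * (1/2)^Suc i)"
    using le by (intro suminf_le) auto
  also have "\<dots> = (\<Sum>i. hausdorff_premeasure k \<delta> (A i)) + (\<Sum>i. ennreal (e * (1/2)^Suc i))"
    by (subst suminf_add) auto
  also have "(\<Sum>i. ennreal (e * (1/2)^Suc i)) = ennreal e"
  proof (rule suminf_ennreal_eq)
    show "0 \<le> e * (1/2)^Suc i" for i using e by simp
    show "(\<lambda>i. e * (1/2)^Suc i) sums e" using sums_mult[OF power_half_series, of e] by simp
  qed
  finally show "hausdorff_premeasure k \<delta> (\<Union>i. A i)
      \<le> (\<Sum>i. hausdorff_premeasure k \<delta> (A i)) + ennreal e" .
qed

lemma outer_measure_space_hausdorff: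
  "outer_measure_space (Pow UNIV) (hausdorff_outer k :: 'a::metric_space set \<Rightarrow> ennreal)"
proof -
  have "hausdorff_premeasure k \<delta> ({}::'a set) \<le> 0" if "\<delta> > 0" for \<delta>
    unfolding hausdorff_premeasure_def
    by (rule INF_lower2[of "\<lambda>_. {}"]) (use that in auto)
  hence "hausdorff_outer k ({}::'a set) \<le> 0"
    unfolding hausdorff_outer_def by (intro SUP_least) auto
  hence "positive (Pow UNIV) (hausdorff_outer k :: 'a set \<Rightarrow> ennreal)"
    by (simp add: positive_def)
  moreover have "increasing (Pow UNIV) (hausdorff_outer k :: 'a set \<Rightarrow> ennreal)"
    unfolding increasing_def hausdorff_outer_def hausdorff_premeasure_def
    by (intro ballI impI SUP_mono' INF_superset_mono) auto
  moreover have "hausdorff_outer k (\<Union>i. A i) \<le> (\<Sum>i. hausdorff_outer k (A i))"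
    for A :: "nat \<Rightarrow> 'a set"
  proof -
    have "hausdorff_premeasure k \<delta> (\<Union>i. A i) \<le> (\<Sum>i. hausdorff_outer k (A i))" if "\<delta> > 0" for \<delta>
    proof (rule order_trans[OF hausdorff_premeasure_subadditive suminf_le])
      show "hausdorff_premeasure k \<delta> (A n) \<le> hausdorff_outer k (A n)" for n
        unfolding hausdorff_outer_def using that by (intro SUP_upper) auto
    qed auto
    thus ?thesis by (auto simp: hausdorff_outer_def[of k "\<Union>i. A i"] intro!: SUP_least)
  qed
  ultimately show ?thesis
    by (auto simp: outer_measure_space_def countably_subadditive_def)
qed

lemma
  shows space_hausdorff_measure: "space (hausdorff_measure k :: 'a::metric_space measure) = UNIV"
    and sets_hausdorff_measure: "sets (hausdorff_measure k :: 'a measure) =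
          lambda_system UNIV (Pow UNIV) (hausdorff_outer k)"
    and emeasure_hausdorff_measure: "A \<in> sets (hausdorff_measure k :: 'a measure) \<Longrightarrow>
          emeasure (hausdorff_measure k) A = hausdorff_outer k A"
proof -
  interpret sigma_algebra "UNIV :: 'a set" "Pow UNIV" by (rule sigma_algebra_Pow)
  have ms: "measure_space UNIV (lambda_system UNIV (Pow UNIV) (hausdorff_outer k))
              (hausdorff_outer k :: 'a set \<Rightarrow> ennreal)"
    by (rule caratheodory_lemma[OF outer_measure_space_hausdorff])
  hence sa: "sigma_algebra (UNIV :: 'a set) (lambda_system UNIV (Pow UNIV) (hausdorff_outer k))"
    by (simp add: measure_space_def)
  show "space (hausdorff_measure k :: 'a measure) = UNIV"
    by (simp add: hausdorff_measure_def space_measure_of_conv)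
  show sets: "sets (hausdorff_measure k :: 'a measure) =
      lambda_system UNIV (Pow UNIV) (hausdorff_outer k)"
    unfolding hausdorff_measure_def using sa by (rule sigma_algebra.sets_measure_of_eq)
  show "emeasure (hausdorff_measure k) A = hausdorff_outer k A"
    if "A \<in> sets (hausdorff_measure k :: 'a measure)"
    using that ms sets emeasure_measure_of_sigma[of UNIV _ "hausdorff_outer k" A]
    by (auto simp: hausdorff_measure_def measure_space_def)
qed

definition surface_measure :: "'a::euclidean_space set \<Rightarrow> 'a measure" where
  "surface_measure \<Gamma> = restrict_space (hausdorff_measure (DIM('a) - 1)) \<Gamma>"


section \<open>Bounded domains with regular boundary\<close>

text \<open>Near each boundary point the domain is the region above a Lipschitz graph in direction \<open>\<nu>\<close>.\<close>

definition lipschitz_boundary :: "'a::euclidean_space set \<Rightarrow> bool" where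
  "lipschitz_boundary \<Omega> \<longleftrightarrow>
     (\<forall>x \<in> frontier \<Omega>. \<exists>r>0. \<exists>\<nu> (\<phi> :: 'a \<Rightarrow> real) L. norm \<nu> = 1 \<and> L-lipschitz_on UNIV \<phi> \<and>
        (\<forall>y \<in> ball x r. y \<in> \<Omega> \<longleftrightarrow> \<phi> (y - (y \<bullet> \<nu>) *\<^sub>R \<nu>) < y \<bullet> \<nu>))"

definition bounded_regular_domain :: "'a::euclidean_space set \<Rightarrow> bool" where
  "bounded_regular_domain \<Omega> \<longleftrightarrow>
     open \<Omega> \<and> connected \<Omega> \<and> \<Omega> \<noteq> {} \<and> bounded \<Omega> \<and> lipschitz_boundary \<Omega>"


section \<open>Lebesgue and Sobolev spaces\<close>

definition L2_space :: "'a measure \<Rightarrow> ('a \<Rightarrow> 'b::euclidean_space) set" where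
  "L2_space M = {f \<in> borel_measurable M. integrable M (\<lambda>x. (norm (f x))\<^sup>2)}"

definition L2_inner :: "'a measure \<Rightarrow> ('a \<Rightarrow> 'b::euclidean_space) \<Rightarrow> ('a \<Rightarrow> 'b) \<Rightarrow> real" where
  "L2_inner M f g = (\<integral>x. f x \<bullet> g x \<partial>M)"

definition L2_norm :: "'a measure \<Rightarrow> ('a \<Rightarrow> 'b::euclidean_space) \<Rightarrow> real" where
  "L2_norm M f = sqrt (\<integral>x. (norm (f x))\<^sup>2 \<partial>M)"

primrec C_k :: "nat \<Rightarrow> ('a::euclidean_space \<Rightarrow> real) \<Rightarrow> bool" where
  "C_k 0 f \<longleftrightarrow> continuous_on UNIV f"
| "C_k (Suc k) f \<longleftrightarrow> (\<forall>x. f differentiable (at x)) \<and>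
     (\<forall>i\<in>Basis. C_k k (\<lambda>x. frechet_derivative f (at x) i))"

definition test_function :: "'a::euclidean_space set \<Rightarrow> ('a \<Rightarrow> real) \<Rightarrow> bool" where
  "test_function \<Omega> \<phi> \<longleftrightarrow> (\<forall>k. C_k k \<phi>) \<and> (\<exists>K. compact K \<and> K \<subseteq> \<Omega> \<and> (\<forall>x. x \<notin> K \<longrightarrow> \<phi> x = 0))"

definition is_weak_gradient ::
    "'a::euclidean_space set \<Rightarrow> ('a \<Rightarrow> real) \<Rightarrow> ('a \<Rightarrow> 'a) \<Rightarrow> bool" where
  "is_weak_gradient \<Omega> u G \<longleftrightarrow>
     (\<forall>\<phi>. test_function \<Omega> \<phi> \<longrightarrow> (\<forall>i\<in>Basis.
        (\<integral>x. u x * frechet_derivative \<phi> (at x) i \<partial>(lebesgue_on \<Omega>)) =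
        - (\<integral>x. (G x \<bullet> i) * \<phi> x \<partial>(lebesgue_on \<Omega>))))"

definition H1_space :: "'a::euclidean_space set \<Rightarrow> ('a \<Rightarrow> real) set" where
  "H1_space \<Omega> = {u \<in> L2_space (lebesgue_on \<Omega>).
     \<exists>G \<in> L2_space (lebesgue_on \<Omega>). is_weak_gradient \<Omega> u G}"

definition weak_gradient :: "'a::euclidean_space set \<Rightarrow> ('a \<Rightarrow> real) \<Rightarrow> ('a \<Rightarrow> 'a)" where
  "weak_gradient \<Omega> u = (SOME G. G \<in> L2_space (lebesgue_on \<Omega>) \<and> is_weak_gradient \<Omega> u G)"

definition energy_form :: "'a::euclidean_space set \<Rightarrow> ('a \<Rightarrow> real) \<Rightarrow> ('a \<Rightarrow> real) \<Rightarrow> real" where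
  "energy_form \<Omega> u v = L2_inner (lebesgue_on \<Omega>) (weak_gradient \<Omega> u) (weak_gradient \<Omega> v)"

definition H1_norm :: "'a::euclidean_space set \<Rightarrow> ('a \<Rightarrow> real) \<Rightarrow> real" where
  "H1_norm \<Omega> u = sqrt ((L2_norm (lebesgue_on \<Omega>) u)\<^sup>2 + (L2_norm (lebesgue_on \<Omega>) (weak_gradient \<Omega> u))\<^sup>2)"

text \<open>
  The trace operator is the bounded linear operator \<open>H\<^sup>1(\<Omega>) \<rightarrow> L\<^sup>2(\<partial>\<Omega>)\<close> that is restriction to the
  boundary on functions continuous up to the boundary; by density this determines it. The trace on a
  part of the boundary is obtained by viewing \<open>\<gamma> v\<close> as a function on that part.
\<close>

definition is_trace_operator ::
    "'a::euclidean_space set \<Rightarrow> (('a \<Rightarrow> real) \<Rightarrow> ('a \<Rightarrow> real)) \<Rightarrow> bool" where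
  "is_trace_operator \<Omega> \<gamma> \<longleftrightarrow>
     (\<forall>v \<in> H1_space \<Omega>. \<gamma> v \<in> L2_space (surface_measure (frontier \<Omega>))) \<and>
     (\<forall>v \<in> H1_space \<Omega>. \<forall>w \<in> H1_space \<Omega>.
        AE x in surface_measure (frontier \<Omega>). \<gamma> (\<lambda>y. v y + w y) x = \<gamma> v x + \<gamma> w x) \<and>
     (\<forall>v \<in> H1_space \<Omega>. \<forall>c.
        AE x in surface_measure (frontier \<Omega>). \<gamma> (\<lambda>y. c * v y) x = c * \<gamma> v x) \<and>
     (\<exists>C. \<forall>v \<in> H1_space \<Omega>. L2_norm (surface_measure (frontier \<Omega>)) (\<gamma> v) \<le> C * H1_norm \<Omega> v) \<and>
     (\<forall>v \<in> H1_space \<Omega>. continuous_on (closure \<Omega>) v \<longrightarrow>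
        (AE x in surface_measure (frontier \<Omega>). \<gamma> v x = v x))"

definition trace_norm ::
    "'a::euclidean_space set \<Rightarrow> 'a set \<Rightarrow> (('a \<Rightarrow> real) \<Rightarrow> ('a \<Rightarrow> real)) \<Rightarrow> real" where
  "trace_norm \<Omega> \<Gamma>\<^sub>2 \<gamma> =
     (SUP v \<in> {v \<in> H1_space \<Omega>. H1_norm \<Omega> v \<noteq> 0}. L2_norm (surface_measure \<Gamma>\<^sub>2) (\<gamma> v) / H1_norm \<Omega> v)"

definition V0_space ::
    "'a::euclidean_space set \<Rightarrow> 'a set \<Rightarrow> (('a \<Rightarrow> real) \<Rightarrow> ('a \<Rightarrow> real)) \<Rightarrow> ('a \<Rightarrow> real) set" where
  "V0_space \<Omega> \<Gamma>\<^sub>1 \<gamma> = {v \<in> H1_space \<Omega>. AE x in surface_measure \<Gamma>\<^sub>1. \<gamma> v x = 0}"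

text \<open>
  \<open>H\<^sup>1\<^sup>/\<^sup>2(\<Gamma>)\<close> by finiteness of the Gagliardo seminorm: the exponent in the kernel is
  \<open>(n - 1) + 2 \<cdot> (1/2) = n\<close>.
\<close>

definition H_half_space :: "'a::euclidean_space set \<Rightarrow> ('a \<Rightarrow> real) set" where
  "H_half_space \<Gamma> = {b \<in> L2_space (surface_measure \<Gamma>).
     (\<integral>\<^sup>+x. \<integral>\<^sup>+y. ennreal ((b x - b y)\<^sup>2 / norm (x - y) ^ DIM('a))
        \<partial>surface_measure \<Gamma> \<partial>surface_measure \<Gamma>) < \<infinity>}"


section \<open>Dual space\<close>

definition dual_space ::
    "('c \<Rightarrow> real) set \<Rightarrow> (('c \<Rightarrow> real) \<Rightarrow> real) \<Rightarrow> (('c \<Rightarrow> real) \<Rightarrow> real) set" where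
  "dual_space X N = {l.
     (\<forall>v\<in>X. \<forall>w\<in>X. l (\<lambda>x. v x + w x) = l v + l w) \<and>
     (\<forall>v\<in>X. \<forall>c. l (\<lambda>x. c * v x) = c * l v) \<and>
     (\<exists>C. \<forall>v\<in>X. \<bar>l v\<bar> \<le> C * N v)}"

definition dual_norm ::
    "('c \<Rightarrow> real) set \<Rightarrow> (('c \<Rightarrow> real) \<Rightarrow> real) \<Rightarrow> (('c \<Rightarrow> real) \<Rightarrow> real) \<Rightarrow> real" where
  "dual_norm X N l = (SUP v \<in> {v \<in> X. N v \<le> 1}. \<bar>l v\<bar>)"


section \<open>Bochner spaces over (0, T)\<close>

definition strongly_measurable ::
    "real measure \<Rightarrow> ('c \<Rightarrow> real) set \<Rightarrow> (('c \<Rightarrow> real) \<Rightarrow> real) \<Rightarrow> (real \<Rightarrow> 'c \<Rightarrow> real) \<Rightarrow> bool" where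
  "strongly_measurable M X N u \<longleftrightarrow>
     (\<exists>s. (\<forall>k::nat. simple_function M (s k) \<and> (\<forall>t \<in> space M. s k t \<in> X)) \<and>
          (AE t in M. (\<lambda>k. N (\<lambda>x. s k t x - u t x)) \<longlonglongrightarrow> 0))"

definition bochner_L2 ::
    "real \<Rightarrow> ('c \<Rightarrow> real) set \<Rightarrow> (('c \<Rightarrow> real) \<Rightarrow> real) \<Rightarrow> (real \<Rightarrow> 'c \<Rightarrow> real) set" where
  "bochner_L2 T X N = {u.
     (AE t in lebesgue_on {0<..<T}. u t \<in> X) \<and>
     strongly_measurable (lebesgue_on {0<..<T}) X N u \<and>
     integrable (lebesgue_on {0<..<T}) (\<lambda>t. (N (u t))\<^sup>2)}"

definition bochner_norm ::
    "real \<Rightarrow> (('c \<Rightarrow> real) \<Rightarrow> real) \<Rightarrow> (real \<Rightarrow> 'c \<Rightarrow> real) \<Rightarrow> real" where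
  "bochner_norm T N u = sqrt (\<integral>t. (N (u t))\<^sup>2 \<partial>(lebesgue_on {0<..<T}))"

abbreviation L2L2_space :: "real \<Rightarrow> 'c measure \<Rightarrow> (real \<Rightarrow> 'c \<Rightarrow> real) set" where
  "L2L2_space T M \<equiv> bochner_L2 T (L2_space M) (L2_norm M)"

abbreviation L2L2_norm :: "real \<Rightarrow> 'c measure \<Rightarrow> (real \<Rightarrow> 'c \<Rightarrow> real) \<Rightarrow> real" where
  "L2L2_norm T M \<equiv> bochner_norm T (L2_norm M)"

definition ae_eq :: "real \<Rightarrow> 'c measure \<Rightarrow> (real \<Rightarrow> 'c \<Rightarrow> real) \<Rightarrow> (real \<Rightarrow> 'c \<Rightarrow> real) \<Rightarrow> bool" where
  "ae_eq T M u w \<longleftrightarrow> (AE t in lebesgue_on {0<..<T}. AE x in M. u t x = w t x)"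


section \<open>The heat problem with mixed boundary conditions\<close>

text \<open>\<open>u'\<close> is the distributional time derivative of \<open>u\<close>, with \<open>H\<close> identified with a subspace of \<open>X'\<close>.\<close>

definition is_weak_time_derivative ::
    "'a::euclidean_space set \<Rightarrow> real \<Rightarrow> ('a \<Rightarrow> real) set \<Rightarrow> (real \<Rightarrow> 'a \<Rightarrow> real) \<Rightarrow>
     (real \<Rightarrow> ('a \<Rightarrow> real) \<Rightarrow> real) \<Rightarrow> bool" where
  "is_weak_time_derivative \<Omega> T X u u' \<longleftrightarrow>
     (\<forall>\<phi>. test_function {0<..<T} \<phi> \<longrightarrow> (\<forall>v\<in>X.
        (\<integral>t. u' t v * \<phi> t \<partial>(lebesgue_on {0<..<T})) =
        - (\<integral>t. L2_inner (lebesgue_on \<Omega>) (u t) v * deriv \<phi> t \<partial>(lebesgue_on {0<..<T}))))"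

text \<open>\<open>u(0) = u\<^sub>0\<close>, read through the representative of \<open>u\<close> in \<open>C([0, T]; H)\<close>.\<close>

definition has_initial_value ::
    "'a::euclidean_space set \<Rightarrow> real \<Rightarrow> (real \<Rightarrow> 'a \<Rightarrow> real) \<Rightarrow> ('a \<Rightarrow> real) \<Rightarrow> bool" where
  "has_initial_value \<Omega> T u u\<^sub>0 \<longleftrightarrow>
     (\<exists>w. (\<forall>t\<in>{0..T}. w t \<in> L2_space (lebesgue_on \<Omega>)) \<and>
          (\<forall>t\<in>{0..T}. ((\<lambda>s. L2_norm (lebesgue_on \<Omega>) (\<lambda>x. w s x - w t x)) \<longlongrightarrow> 0) (at t within {0..T})) \<and>
          ae_eq T (lebesgue_on \<Omega>) w u \<and>
          (AE x in lebesgue_on \<Omega>. w 0 x = u\<^sub>0 x))"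

definition is_heat_solution ::
    "'a::euclidean_space set \<Rightarrow> 'a set \<Rightarrow> 'a set \<Rightarrow> real \<Rightarrow> (('a \<Rightarrow> real) \<Rightarrow> ('a \<Rightarrow> real)) \<Rightarrow>
     ('a \<Rightarrow> real) \<Rightarrow> (real \<Rightarrow> 'a \<Rightarrow> real) \<Rightarrow> (real \<Rightarrow> 'a \<Rightarrow> real) \<Rightarrow> (real \<Rightarrow> 'a \<Rightarrow> real) \<Rightarrow> bool" where
  "is_heat_solution \<Omega> \<Gamma>\<^sub>1 \<Gamma>\<^sub>2 T \<gamma> v\<^sub>b g q u \<longleftrightarrow>
     (let V\<^sub>0 = V0_space \<Omega> \<Gamma>\<^sub>1 \<gamma> in
      (\<lambda>t x. u t x - v\<^sub>b x) \<in> bochner_L2 T V\<^sub>0 (H1_norm \<Omega>) \<and>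
      has_initial_value \<Omega> T u v\<^sub>b \<and>
      (\<exists>u' \<in> bochner_L2 T (dual_space V\<^sub>0 (H1_norm \<Omega>)) (dual_norm V\<^sub>0 (H1_norm \<Omega>)).
         is_weak_time_derivative \<Omega> T V\<^sub>0 u u' \<and>
         (AE t in lebesgue_on {0<..<T}. \<forall>v\<in>V\<^sub>0.
            u' t v + energy_form \<Omega> (u t) v =
            L2_inner (lebesgue_on \<Omega>) (g t) v - L2_inner (surface_measure \<Gamma>\<^sub>2) (q t) (\<gamma> v))))"

definition heat_well_posed ::
    "'a::euclidean_space set \<Rightarrow> 'a set \<Rightarrow> 'a set \<Rightarrow> real \<Rightarrow> (('a \<Rightarrow> real) \<Rightarrow> ('a \<Rightarrow> real)) \<Rightarrow>
     ('a \<Rightarrow> real) \<Rightarrow> bool" where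
  "heat_well_posed \<Omega> \<Gamma>\<^sub>1 \<Gamma>\<^sub>2 T \<gamma> v\<^sub>b \<longleftrightarrow>
     (\<forall>g \<in> L2L2_space T (lebesgue_on \<Omega>). \<forall>q \<in> L2L2_space T (surface_measure \<Gamma>\<^sub>2).
        (\<exists>u. is_heat_solution \<Omega> \<Gamma>\<^sub>1 \<Gamma>\<^sub>2 T \<gamma> v\<^sub>b g q u) \<and>
        (\<forall>u w. is_heat_solution \<Omega> \<Gamma>\<^sub>1 \<Gamma>\<^sub>2 T \<gamma> v\<^sub>b g q u \<longrightarrow> is_heat_solution \<Omega> \<Gamma>\<^sub>1 \<Gamma>\<^sub>2 T \<gamma> v\<^sub>b g q w \<longrightarrow>
           ae_eq T (lebesgue_on \<Omega>) u w))"

definition heat_state ::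
    "'a::euclidean_space set \<Rightarrow> 'a set \<Rightarrow> 'a set \<Rightarrow> real \<Rightarrow> (('a \<Rightarrow> real) \<Rightarrow> ('a \<Rightarrow> real)) \<Rightarrow>
     ('a \<Rightarrow> real) \<Rightarrow> (real \<Rightarrow> 'a \<Rightarrow> real) \<Rightarrow> (real \<Rightarrow> 'a \<Rightarrow> real) \<Rightarrow> (real \<Rightarrow> 'a \<Rightarrow> real)" where
  "heat_state \<Omega> \<Gamma>\<^sub>1 \<Gamma>\<^sub>2 T \<gamma> v\<^sub>b g q = (SOME u. is_heat_solution \<Omega> \<Gamma>\<^sub>1 \<Gamma>\<^sub>2 T \<gamma> v\<^sub>b g q u)"


section \<open>The optimal control problems\<close>

definition J_plus ::
    "'a::euclidean_space set \<Rightarrow> 'a set \<Rightarrow> 'a set \<Rightarrow> real \<Rightarrow> (('a \<Rightarrow> real) \<Rightarrow> ('a \<Rightarrow> real)) \<Rightarrow>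
     ('a \<Rightarrow> real) \<Rightarrow> (real \<Rightarrow> 'a \<Rightarrow> real) \<Rightarrow> real \<Rightarrow> real \<Rightarrow>
     (real \<Rightarrow> 'a \<Rightarrow> real) \<times> (real \<Rightarrow> 'a \<Rightarrow> real) \<Rightarrow> real" where
  "J_plus \<Omega> \<Gamma>\<^sub>1 \<Gamma>\<^sub>2 T \<gamma> v\<^sub>b z\<^sub>d M M\<^sub>1 = (\<lambda>(g, q).
     1/2 * (L2L2_norm T (lebesgue_on \<Omega>) (\<lambda>t x. heat_state \<Omega> \<Gamma>\<^sub>1 \<Gamma>\<^sub>2 T \<gamma> v\<^sub>b g q t x - z\<^sub>d t x))\<^sup>2
     + M\<^sub>1/2 * (L2L2_norm T (lebesgue_on \<Omega>) g)\<^sup>2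
     + M/2 * (L2L2_norm T (surface_measure \<Gamma>\<^sub>2) q)\<^sup>2)"

definition J_1 ::
    "'a::euclidean_space set \<Rightarrow> 'a set \<Rightarrow> 'a set \<Rightarrow> real \<Rightarrow> (('a \<Rightarrow> real) \<Rightarrow> ('a \<Rightarrow> real)) \<Rightarrow>
     ('a \<Rightarrow> real) \<Rightarrow> (real \<Rightarrow> 'a \<Rightarrow> real) \<Rightarrow> real \<Rightarrow> real \<Rightarrow>
     (real \<Rightarrow> 'a \<Rightarrow> real) \<Rightarrow> (real \<Rightarrow> 'a \<Rightarrow> real) \<Rightarrow> real" where
  "J_1 \<Omega> \<Gamma>\<^sub>1 \<Gamma>\<^sub>2 T \<gamma> v\<^sub>b z\<^sub>d M M\<^sub>1 g = (\<lambda>q.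
     1/2 * (L2L2_norm T (lebesgue_on \<Omega>) (\<lambda>t x. heat_state \<Omega> \<Gamma>\<^sub>1 \<Gamma>\<^sub>2 T \<gamma> v\<^sub>b g q t x - z\<^sub>d t x))\<^sup>2
     + M\<^sub>1/2 * (L2L2_norm T (lebesgue_on \<Omega>) g)\<^sup>2
     + M/2 * (L2L2_norm T (surface_measure \<Gamma>\<^sub>2) q)\<^sup>2)"

text \<open>\<open>E\<close> is the relation of representing the same element of the space \<open>S\<close>.\<close>

definition is_unique_minimizer :: "'b set \<Rightarrow> ('b \<Rightarrow> 'b \<Rightarrow> bool) \<Rightarrow> ('b \<Rightarrow> real) \<Rightarrow> 'b \<Rightarrow> bool" where
  "is_unique_minimizer S E F x \<longleftrightarrow>
     x \<in> S \<and> (\<forall>y\<in>S. F x \<le> F y) \<and> (\<forall>y\<in>S. (\<forall>z\<in>S. F y \<le> F z) \<longrightarrow> E x y)"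

end

theory Submission
  imports Defs
begin

text \<open>
  For fixed \<open>g\<close> the state is affine in \<open>q\<close>, and its derivative \<open>w\<close> in direction
  \<open>f = q\<^sub>1 - q\<^sub>2\<close> does not depend on \<open>g\<close>. If \<open>q\<^sub>1\<close> is optimal for \<open>g\<^sub>1\<close> and \<open>q\<^sub>2\<close> for \<open>g\<^sub>2\<close>, with
  states \<open>u\<^sub>1\<close> and \<open>u\<^sub>2\<close>, the two Euler equations \<open>(u\<^sub>i - z\<^sub>d, w) + M (q\<^sub>i, f) = 0\<close> give
  \<open>M |f|\<^sup>2 = (u\<^sub>2 - u\<^sub>1, w) \<le> |u\<^sub>2 - u\<^sub>1| |w|\<close>. Testing the equation of \<open>w\<close> with \<open>w\<close> itself and using
  coercivity, \<open>\<lambda>\<^sub>0 |w| \<le> |\<gamma>\<^sub>0| |f|\<close>.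

  The last step needs \<open>\<integral>\<langle>w', w\<rangle> dt \<ge> 0\<close> for \<open>w(0) = 0\<close>. For backward difference quotients in place of \<open>w'\<close>
  this is elementary; they converge weakly in time when paired with simple functions, which are dense,
  and are bounded in the dual space uniformly in the step size. Uniqueness of weak gradients, hence bilinearity of
  \<open>a\<close>, rests on the fundamental lemma of the calculus of variations.
\<close>


section \<open>Smooth functions\<close>

text \<open>The obstacle is the null sets. The weak derivative identity holds separately for each
  fixed \<open>v\<close>, but testing with \<open>w\<close> inserts \<open>v = w t\<close>, which
  moves with \<open>t\<close>, and exceptional sets depending on \<open>v\<close> would be
  uncountably many. The remedy is the continuous representative \<open>W\<close> that the initial
  condition provides: for it, \<open>(W t, v)\<close> equals the primitive of \<open>B s v\<close>
  at every \<open>t\<close> and for all \<open>v\<close> at once, so \<open>w t\<close> may be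
  inserted and held fixed while the difference is taken in time. Backward differences fit
  \<open>W 0 = 0\<close>: extended by zero to negative times, the primitives and the norm of
  \<open>W\<close> stay continuous, and what telescoping leaves is an average over the last window
  before \<open>T\<close>, which has the right sign. Since the state is selected by choice, it is
  affine in \<open>q\<close> only up to functions of norm 0; the uniqueness that absorbs these is
  again the estimate for \<open>w\<close>, with \<open>f = 0\<close>. That \<open>qq\<close> is
  optimal for \<open>gg\<close> alone, which the comparison needs, follows by freezing the first
  argument of \<open>J_plus\<close>.\<close>

lemma C_k_SucI:
  assumes "\<And>x. (f has_derivative f' x) (at x)" and "\<And>i. i \<in> Basis \<Longrightarrow> C_k k (\<lambda>x. f' x i)"
  shows "C_k (Suc k) f"
proof -
  \<comment> \<open>\<open>C_k\<close> is phrased with the choice operator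
    \<open>frechet_derivative\<close>; uniqueness of derivatives lets any derivative found by the
    usual rules replace it.\<close>
  have "f differentiable (at x)" "frechet_derivative f (at x) = f' x" for x
    using assms(1) frechet_derivative_at differentiableI by metis+
  then show ?thesis using assms(2) by simp
qed

lemma C_k_has_derivative:
  "C_k (Suc k) f \<Longrightarrow> (f has_derivative frechet_derivative f (at x)) (at x)"
  by (auto simp: frechet_derivative_works)

lemma C_k_Suc_imp: "C_k (Suc k) f \<Longrightarrow> C_k k f"
proof (induction k arbitrary: f)
  case 0
  then show ?case
    by (auto intro!: continuous_at_imp_continuous_on differentiable_imp_continuous_within)
qed simp

lemma C_k_const: "C_k k (\<lambda>x. c)"
proof (induction k arbitrary: c)
  case (Suc k)
  show ?case by (rule C_k_SucI[OF has_derivative_const]) (rule Suc)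
qed simp

lemma C_k_add: "C_k k f \<Longrightarrow> C_k k g \<Longrightarrow> C_k k (\<lambda>x. f x + g x)"
proof (induction k arbitrary: f g)
  case 0
  then show ?case by (auto intro: continuous_intros)
next
  case (Suc k)
  show ?case
    by (rule C_k_SucI[OF has_derivative_add[OF C_k_has_derivative[OF Suc.prems(1)]
            C_k_has_derivative[OF Suc.prems(2)]]])
      (use Suc in auto)
qed

lemma C_k_partial: "C_k (Suc k) f \<Longrightarrow> i \<in> Basis \<Longrightarrow> C_k k (\<lambda>x. frechet_derivative f (at x) i)"
  by simp

lemma C_k_mult: "C_k k f \<Longrightarrow> C_k k g \<Longrightarrow> C_k k (\<lambda>x. f x * g x)"
proof (induction k arbitrary: f g)
  case 0
  then show ?case by (auto intro: continuous_intros)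
next
  case (Suc k)
  show ?case
  proof (rule C_k_SucI[OF has_derivative_mult[OF C_k_has_derivative[OF Suc.prems(1)]
            C_k_has_derivative[OF Suc.prems(2)]]])
    fix i :: 'a assume "i \<in> Basis"
    then show "C_k k (\<lambda>x. f x * frechet_derivative g (at x) i + frechet_derivative f (at x) i * g x)"
      by (intro C_k_add Suc.IH C_k_Suc_imp[OF Suc.prems(1)] C_k_Suc_imp[OF Suc.prems(2)]
          C_k_partial[OF Suc.prems(1)] C_k_partial[OF Suc.prems(2)])
  qed
qed

lemma C_k_diff: "C_k k f \<Longrightarrow> C_k k g \<Longrightarrow> C_k k (\<lambda>x. f x - g x)"
  using C_k_add[OF _ C_k_mult[OF C_k_const[where c="-1"]], of k f g] by simp

lemma C_k_uminus: "C_k k g \<Longrightarrow> C_k k (\<lambda>x. - g x)"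
  using C_k_diff[OF C_k_const[where c=0], of k g] by simp

lemma C_k_prod: "(\<And>i. i \<in> I \<Longrightarrow> C_k k (f i)) \<Longrightarrow> C_k k (\<lambda>x. \<Prod>i\<in>I. f i x)"
  by (induction I rule: infinite_finite_induct) (auto intro: C_k_const C_k_mult)

text \<open>The derivative of \<open>inverse f\<close> contains \<open>inverse f\<close> itself, but
  only up to order \<open>k\<close>, where the induction hypothesis already applies.\<close>

lemma C_k_inverse:
  assumes "\<And>x. f x \<noteq> 0"
  shows "C_k k f \<Longrightarrow> C_k k (\<lambda>x. inverse (f x))"
proof (induction k)
  case 0
  then show ?case using assms by (auto intro: continuous_intros)
next
  case (Suc k)
  then have inv: "C_k k (\<lambda>x. inverse (f x))" using C_k_Suc_imp by blast
  show ?case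
  proof (rule C_k_SucI[OF Deriv.has_derivative_inverse[OF assms C_k_has_derivative[OF Suc.prems]]])
    fix i :: 'a assume "i \<in> Basis"
    then show "C_k k (\<lambda>x. - (inverse (f x) * frechet_derivative f (at x) i * inverse (f x)))"
      by (intro C_k_uminus C_k_mult inv C_k_partial[OF Suc.prems])
  qed
qed

text \<open>The whole sequence of successive derivatives is carried along, so the induction steps
  from \<open>D n\<close> to \<open>D (Suc n)\<close> and a chain rule for \<open>C_k\<close> is
  avoided.\<close>

lemma C_k_affine_compose:
  fixes D :: "nat \<Rightarrow> real \<Rightarrow> real" and j :: "'a::euclidean_space"
  assumes "\<And>n s. (D n has_real_derivative D (Suc n) s) (at s)"
  shows "C_k k (\<lambda>x. D n (\<alpha> * (x \<bullet> j) + c))"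
proof (induction k arbitrary: n)
  case 0
  have "continuous_on UNIV (D n)"
    using assms DERIV_isCont by (blast intro: continuous_at_imp_continuous_on)
  then show ?case
    by (auto intro!: continuous_on_compose2[of UNIV "D n"] continuous_intros)
next
  case (Suc k)
  have d: "((\<lambda>x. D n (\<alpha> * (x \<bullet> j) + c)) has_derivative
      (\<lambda>h. (\<alpha> * (h \<bullet> j)) * D (Suc n) (\<alpha> * (x \<bullet> j) + c))) (at x)" for x
    by (rule DERIV_compose_FDERIV[OF assms]) (auto intro!: derivative_eq_intros)
  show ?case
    by (rule C_k_SucI[OF d]) (intro C_k_mult C_k_const Suc)
qed

text \<open>The family \<open>p(1/s) exp(-1/s)\<close> is closed under differentiation, so its members are smooth.\<close>

definition flat :: "real poly \<Rightarrow> real \<Rightarrow> real" where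
  "flat p s = (if s \<le> 0 then 0 else poly p (inverse s) * exp (- inverse s))"

lemma poly_div_exp_tendsto_0: "((\<lambda>x. poly p x * exp (- x)) \<longlongrightarrow> (0::real)) at_top"
proof -
  have "((\<lambda>x. \<Sum>i\<le>degree p. coeff p i * (x ^ i / exp x)) \<longlongrightarrow> (\<Sum>i\<le>degree p. coeff p i * 0)) at_top"
    by (intro tendsto_intros tendsto_power_div_exp_0)
  then show ?thesis
    by (simp add: poly_altdef sum_distrib_right exp_minus divide_inverse mult.assoc)
qed

text \<open>With \<open>y = 1/s\<close> one has \<open>d/ds = - y^2 d/dy\<close>, and applied to
  \<open>p(y) exp(-y)\<close> this gives the polynomial \<open>y^2 (p - p')\<close>.\<close>

lemma flat_has_derivative:
  "(flat p has_real_derivative flat ([:0, 0, 1:] * (p - pderiv p)) s) (at s)"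
proof -
  consider "s < 0" | "s = 0" | "s > 0" by linarith
  then show ?thesis
  proof cases
    case 1
    have "((\<lambda>_. 0) has_real_derivative 0) (at s)" by simp
    then have "(flat p has_real_derivative 0) (at s)"
      by (rule has_field_derivative_transform_within_open[where S="{..<0}"])
        (use 1 in \<open>auto simp: flat_def\<close>)
    moreover have "flat q s = 0" for q using 1 by (simp add: flat_def)
    ultimately show ?thesis by (simp only:)
  next
    case 2
    \<comment> \<open>The right difference quotient at 0 is again of the form polynomial times
      \<open>exp(-y)\<close>, with one more factor \<open>y = 1/h\<close> tending to
      infinity.\<close>
    have "((\<lambda>h. poly [:0, 1:] (inverse h) * poly p (inverse h) * exp (- inverse h)) \<longlongrightarrow> 0) (at_right 0)"
      using filterlim_compose[OF poly_div_exp_tendsto_0 filterlim_inverse_at_top_right, of "[:0,1:] * p"]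
      by (simp only: poly_mult)
    moreover have "\<forall>\<^sub>F h in at_right 0. poly [:0, 1:] (inverse h) * poly p (inverse h) * exp (- inverse h) = flat p h / h"
      unfolding eventually_at_right_field by (intro exI[of _ 1]) (simp add: flat_def divide_inverse)
    ultimately have "((\<lambda>h. flat p h / h) \<longlongrightarrow> 0) (at_right 0)"
      by (rule Lim_transform_eventually)
    moreover have "\<forall>\<^sub>F h in at_left 0. 0 = flat p h / h"
      unfolding eventually_at_left_field by (intro exI[of _ "-1"]) (simp add: flat_def)
    then have "((\<lambda>h. flat p h / h) \<longlongrightarrow> 0) (at_left 0)"
      by (rule Lim_transform_eventually[OF tendsto_const])
    ultimately have "((\<lambda>h. flat p h / h) \<longlongrightarrow> 0) (at 0)"
      by (simp add: filterlim_split_at)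
    moreover have "flat q 0 = 0" for q by (simp add: flat_def)
    ultimately show ?thesis using 2 by (simp only: DERIV_def diff_0_right add_0_left)
  next
    case 3
    have "((\<lambda>s. poly p (inverse s)) has_real_derivative poly (pderiv p) (inverse s) * - (inverse s ^ 2)) (at s)"
      by (rule DERIV_chain2[OF poly_DERIV])
        (use 3 DERIV_inverse[of s] in \<open>simp add: numeral_2_eq_2\<close>)
    moreover have "((\<lambda>s. exp (- inverse s)) has_real_derivative exp (- inverse s) * (inverse s ^ 2)) (at s)"
      by (rule DERIV_chain2[OF DERIV_exp])
        (use 3 DERIV_minus[OF DERIV_inverse[of s]] in \<open>simp add: numeral_2_eq_2\<close>)
    ultimately have "((\<lambda>s. poly p (inverse s) * exp (- inverse s)) has_real_derivative
        poly (pderiv p) (inverse s) * - (inverse s ^ 2) * exp (- inverse s)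
        + exp (- inverse s) * (inverse s ^ 2) * poly p (inverse s)) (at s)"
      by (rule DERIV_mult)
    moreover have "poly (pderiv p) y * - (y ^ 2) * E + E * (y ^ 2) * poly p y
        = poly ([:0, 0, 1:] * (p - pderiv p)) y * E" for y E
      by (simp add: power2_eq_square algebra_simps)
    ultimately have "((\<lambda>s. poly p (inverse s) * exp (- inverse s)) has_real_derivative
        flat ([:0, 0, 1:] * (p - pderiv p)) s) (at s)"
      using 3 by (simp add: flat_def del: poly_mult poly_diff poly_pCons)
    then show ?thesis
      by (rule has_field_derivative_transform_within_open[where S="{0<..}"])
        (use 3 in \<open>auto simp: flat_def\<close>)
  qed
qed

lemma C_k_flat: "C_k k (\<lambda>x::'a::euclidean_space. flat 1 (\<alpha> * (x \<bullet> j) + c))"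
proof -
  define D where "D n = flat (((\<lambda>p. [:0, 0, 1:] * (p - pderiv p)) ^^ n) 1)" for n
  have "(D n has_real_derivative D (Suc n) s) (at s)" for n s
    using flat_has_derivative by (simp add: D_def)
  from C_k_affine_compose[of D, OF this, of k 0] show ?thesis by (simp add: D_def)
qed

lemma flat_one: "flat 1 s = (if s \<le> 0 then 0 else exp (- inverse s))"
  by (simp add: flat_def)

lemma flat_one_bounds: "0 \<le> flat 1 s" "flat 1 s \<le> 1"
  by (auto simp: flat_one)

lemma flat_one_tendsto:
  assumes "s > 0"
  shows "(\<lambda>k. flat 1 (real k * s)) \<longlonglongrightarrow> 1"
proof -
  have "(\<lambda>k. exp (- (inverse (real k) * inverse s))) \<longlonglongrightarrow> exp (- (0 * inverse s))"
    by (intro tendsto_intros lim_inverse_n)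
  then have "(\<lambda>k. exp (- (inverse (real k) * inverse s))) \<longlonglongrightarrow> 1" by simp
  moreover have "exp (- (inverse (real k) * inverse s)) = flat 1 (real k * s)" if "k > 0" for k
    using that assms by (simp add: flat_one mult_le_0_iff)
  then have "\<forall>\<^sub>F k in sequentially. exp (- (inverse (real k) * inverse s)) = flat 1 (real k * s)"
    by (rule eventually_mono[OF eventually_gt_at_top])
  ultimately show ?thesis by (rule Lim_transform_eventually)
qed

section \<open>Test functions\<close>

lemma test_function_C_k: "test_function S \<phi> \<Longrightarrow> C_k k \<phi>"
  by (simp only: test_function_def)

lemma test_function_continuous: "test_function S \<phi> \<Longrightarrow> continuous_on UNIV \<phi>"
  using test_function_C_k[of S \<phi> 0] by simp

lemma test_functionE:
  assumes "test_function S \<phi>"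
  obtains K where "compact K" "K \<subseteq> S" "\<And>x. x \<notin> K \<Longrightarrow> \<phi> x = 0"
  using assms unfolding test_function_def by blast

lemma compact_support_bounded:
  fixes \<psi> :: "'a::euclidean_space \<Rightarrow> real"
  assumes "continuous_on UNIV \<psi>" "compact K" "\<And>x. x \<notin> K \<Longrightarrow> \<psi> x = 0"
  shows "\<exists>C. \<forall>x. \<bar>\<psi> x\<bar> \<le> C"
proof -
  have "bounded (\<psi> ` K)"
    using assms by (intro compact_imp_bounded compact_continuous_image continuous_on_subset[OF assms(1)]) auto
  then obtain B where "\<And>x. x \<in> K \<Longrightarrow> \<bar>\<psi> x\<bar> \<le> B" by (auto simp: bounded_real)
  then have "\<bar>\<psi> x\<bar> \<le> max B 0" for x
    using assms(3)[of x] by (cases "x \<in> K") (simp_all add: max.coboundedI1)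
  then show ?thesis by blast
qed

lemma test_function_bounded:
  assumes "test_function S \<phi>"
  shows "\<exists>C. \<forall>x. \<bar>\<phi> x\<bar> \<le> C"
proof -
  obtain K where "compact K" "\<And>x. x \<notin> K \<Longrightarrow> \<phi> x = 0"
    using test_functionE[OF assms(1)] by metis
  with test_function_continuous[OF assms] show ?thesis by (rule compact_support_bounded)
qed

lemma test_function_derivative:
  fixes \<phi> :: "'a::euclidean_space \<Rightarrow> real"
  assumes "test_function S \<phi>" "i \<in> Basis"
  shows "continuous_on UNIV (\<lambda>x. frechet_derivative \<phi> (at x) i)"
    and "\<exists>C. \<forall>x. \<bar>frechet_derivative \<phi> (at x) i\<bar> \<le> C"
proof -
  have "C_k (Suc 0) \<phi>" using assms(1) by (rule test_function_C_k)
  then show cont: "continuous_on UNIV (\<lambda>x. frechet_derivative \<phi> (at x) i)" using assms(2) by (simp only: C_k.simps)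
  obtain K where K: "compact K" "\<And>x. x \<notin> K \<Longrightarrow> \<phi> x = 0"
    using test_functionE[OF assms(1)] by metis
  have "frechet_derivative \<phi> (at x) i = 0" if "x \<notin> K" for x
  proof -
    have "(\<phi> has_derivative (\<lambda>_. 0)) (at x)"
    proof (rule has_derivative_transform_within_open[of "\<lambda>_. 0" _ _ UNIV "- K"])
      show "open (- K)" using K(1) compact_imp_closed open_Compl by blast
    qed (use K(2) that in simp_all)
    then have "frechet_derivative \<phi> (at x) = (\<lambda>_. 0)"
      by (rule frechet_derivative_at[symmetric])
    then show ?thesis by simp
  qed
  with compact_support_bounded[OF cont K(1)] show "\<exists>C. \<forall>x. \<bar>frechet_derivative \<phi> (at x) i\<bar> \<le> C"
    by blast
qed

lemma test_function_deriv:
  fixes \<phi> :: "real \<Rightarrow> real"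
  assumes "test_function S \<phi>"
  shows "(\<phi> has_real_derivative deriv \<phi> t) (at t)"
    and "continuous_on UNIV (deriv \<phi>)" and "\<exists>C. \<forall>t. \<bar>deriv \<phi> t\<bar> \<le> C"
proof -
  have "C_k (Suc 0) \<phi>" using assms(1) by (rule test_function_C_k)
  then have d: "(\<phi> has_derivative frechet_derivative \<phi> (at t)) (at t)" for t
    by (rule C_k_has_derivative)
  then show D: "(\<phi> has_real_derivative deriv \<phi> t) (at t)" for t
    by (intro DERIV_deriv_iff_real_differentiable[THEN iffD2] differentiableI)
  have "frechet_derivative \<phi> (at t) 1 = deriv \<phi> t" for t
    using fun_cong[OF has_derivative_unique[OF d D[unfolded has_field_derivative_def]], of t 1] by simp
  with test_function_derivative[OF assms, of 1]
  show "continuous_on UNIV (deriv \<phi>)" and "\<exists>C. \<forall>t. \<bar>deriv \<phi> t\<bar> \<le> C" by simp_all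
qed

text \<open>\<open>k\<close> is a steepness: inside the open box every factor tends to 1, outside it
  some factor is 0, so the limit is the indicator of \<open>box a b\<close>.\<close>

definition box_bump :: "'a::euclidean_space \<Rightarrow> 'a \<Rightarrow> nat \<Rightarrow> 'a \<Rightarrow> real" where
  "box_bump a b k x =
     (\<Prod>i\<in>Basis. flat 1 (real k * (x \<bullet> i - a \<bullet> i)) * flat 1 (real k * (b \<bullet> i - x \<bullet> i)))"

lemma C_k_box_bump: "C_k n (box_bump a b k)"
proof -
  have 1: "C_k n (\<lambda>x. flat 1 (real k * (x \<bullet> i - a \<bullet> i)))" for i :: 'a
    using C_k_flat[of n "real k" i "- real k * (a \<bullet> i)"] by (simp add: algebra_simps)
  have 2: "C_k n (\<lambda>x. flat 1 (real k * (b \<bullet> i - x \<bullet> i)))" for i :: 'a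
    using C_k_flat[of n "- real k" i "real k * (b \<bullet> i)"] by (simp add: algebra_simps)
  show ?thesis
    using C_k_prod[of Basis n "\<lambda>i x. flat 1 (real k * (x \<bullet> i - a \<bullet> i)) * flat 1 (real k * (b \<bullet> i - x \<bullet> i))"]
      C_k_mult[OF 1 2] unfolding box_bump_def[abs_def] by blast
qed

lemma box_bump_bounds: "0 \<le> box_bump a b k x" "box_bump a b k x \<le> 1"
  unfolding box_bump_def
  by (auto intro!: prod_nonneg prod_le_1 mult_nonneg_nonneg mult_le_one simp: flat_one_bounds)

lemma box_bump_eq_0: "x \<notin> box a b \<Longrightarrow> box_bump a b k x = 0"
  unfolding box_bump_def mem_box
  by (auto simp: flat_one mult_le_0_iff not_less intro!: prod_zero)

lemma box_bump_tendsto: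
  fixes x :: "'a::euclidean_space"
  assumes "x \<in> box a b"
  shows "(\<lambda>k. box_bump a b k x) \<longlonglongrightarrow> 1"
proof -
  have "(\<lambda>k. box_bump a b k x) \<longlonglongrightarrow> (\<Prod>i\<in>(Basis::'a set). 1 * 1)"
    unfolding box_bump_def
  proof (rule Limits.tendsto_prod)
    fix i :: 'a assume "i \<in> Basis"
    then show "(\<lambda>k. flat 1 (real k * (x \<bullet> i - a \<bullet> i)) * flat 1 (real k * (b \<bullet> i - x \<bullet> i)))
        \<longlonglongrightarrow> 1 * 1"
      using assms by (intro tendsto_mult flat_one_tendsto) (auto simp: mem_box)
  qed
  then show ?thesis by simp
qed

text \<open>That the closed boxes also lie in \<open>U\<close> keeps finite unions of bump supports
  compact inside \<open>U\<close>. Countability comes from Lindelof.\<close>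

lemma open_eq_Union_box_seq:
  fixes U :: "'a::euclidean_space set"
  assumes "open U"
  shows "\<exists>a b. U = (\<Union>n::nat. box (a n) (b n)) \<and> (\<forall>n. cbox (a n) (b n) \<subseteq> U)"
proof -
  define \<F> where "\<F> = {box a b | a b. cbox a b \<subseteq> U}"
  have "\<And>S. S \<in> \<F> \<Longrightarrow> open S" by (auto simp: \<F>_def)
  then obtain \<D> where \<D>: "\<D> \<subseteq> \<F>" "countable \<D>" "\<Union>\<D> = \<Union>\<F>" by (rule Lindelof)
  have "x \<in> \<Union>\<F>" if x: "x \<in> U" for x
  proof -
    obtain a b where "cbox a b \<subseteq> U" "x \<in> box a b" by (rule open_contains_cbox[OF assms x])
    then show ?thesis unfolding \<F>_def by blast
  qed
  moreover have "\<Union>\<F> \<subseteq> U"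
  proof
    fix x assume "x \<in> \<Union>\<F>"
    then obtain a b where "cbox a b \<subseteq> U" "x \<in> box a b" unfolding \<F>_def by blast
    then show "x \<in> U" using box_subset_cbox[of a b] by blast
  qed
  ultimately have U: "U = \<Union>(insert {} \<D>)" using \<D>(3) by auto
  \<comment> \<open>A box with its ends in the wrong order is empty. Adding it makes the family
    nonempty, so that it can be enumerated even when \<open>U\<close> is empty.\<close>
  obtain i :: 'a where "i \<in> Basis" using nonempty_Basis by blast
  then have "box (One::'a) 0 = {}" "cbox (One::'a) 0 = {}"
    by (auto simp: box_eq_empty intro!: bexI[of _ i])
  then have "{} \<in> \<F>" unfolding \<F>_def by (metis (mono_tags, lifting) empty_subsetI mem_Collect_eq)
  have "from_nat_into (insert {} \<D>) n \<in> \<F>" for n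
    using from_nat_into[of "insert {} \<D>" n] \<D>(1) \<open>{} \<in> \<F>\<close> by auto
  then have "\<forall>n. \<exists>a b. from_nat_into (insert {} \<D>) n = box a b \<and> cbox a b \<subseteq> U"
    unfolding \<F>_def by simp
  then obtain a b where ab: "\<And>n. from_nat_into (insert {} \<D>) n = box (a n) (b n)"
    "\<And>n. cbox (a n) (b n) \<subseteq> U"
    by metis
  have "range (from_nat_into (insert {} \<D>)) = insert {} \<D>"
    using \<D>(2) by (intro range_from_nat_into) auto
  then have "U = (\<Union>n. box (a n) (b n))"
    unfolding ab(1)[symmetric] U by simp
  with ab(2) show ?thesis by blast
qed

text \<open>The uniform bound 1 makes these approximations usable in dominated convergence, which
  turns information on test functions into information on open sets.\<close>

lemma test_functions_tendsto_indicator: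
  fixes U :: "'a::euclidean_space set"
  assumes "open U"
  shows "\<exists>\<phi>. (\<forall>k. test_function U (\<phi> k)) \<and> (\<forall>k x. \<bar>\<phi> k x\<bar> \<le> 1) \<and>
    (\<forall>x. (\<lambda>k. \<phi> k x) \<longlonglongrightarrow> indicator U x)"
proof -
  obtain a b where U': "U = (\<Union>n::nat. box (a n) (b n))" and ab: "\<forall>n. cbox (a n) (b n) \<subseteq> U"
    using open_eq_Union_box_seq[OF assms] by (elim exE conjE) (rule that)
  \<comment> \<open>The smooth counterpart of a union: the value is 0 where all bumps vanish and at
    least as large as each of them. Only \<open>k\<close> boxes enter at stage \<open>k\<close>, to
    keep the support compact.\<close>
  define \<phi> where "\<phi> k x = 1 - (\<Prod>n<k. 1 - box_bump (a n) (b n) k x)" for k :: nat and x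
  have prod01: "0 \<le> (\<Prod>n\<in>I. 1 - box_bump (a n) (b n) k x)" "(\<Prod>n\<in>I. 1 - box_bump (a n) (b n) k x) \<le> 1"
    for k x and I :: "nat set"
    by (intro prod_nonneg prod_le_1; simp add: box_bump_bounds)+
  show ?thesis
  proof (intro exI[of _ \<phi>] conjI allI)
    fix k
    have "\<phi> k x = 0" if "x \<notin> (\<Union>n<k. cbox (a n) (b n))" for x
    proof -
      have "box_bump (a n) (b n) k x = 0" if "n < k" for n
      proof (rule box_bump_eq_0)
        show "x \<notin> box (a n) (b n)" using \<open>x \<notin> _\<close> that box_subset_cbox[of "a n" "b n"] by blast
      qed
      then show ?thesis by (simp add: \<phi>_def)
    qed
    moreover have "compact (\<Union>n<k. cbox (a n) (b n))" by (intro compact_UN) auto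
    moreover have "(\<Union>n<k. cbox (a n) (b n)) \<subseteq> U" using ab by blast
    moreover have "C_k j (\<phi> k)" for j
    proof -
      have "C_k j (\<lambda>x. 1 - box_bump (a n) (b n) k x)" for n
        by (intro C_k_diff C_k_const C_k_box_bump)
      then show ?thesis unfolding \<phi>_def[abs_def] 
        using C_k_prod[of "{..<k}" j "\<lambda>n x. 1 - box_bump (a n) (b n) k x"]
        by (intro C_k_diff[OF C_k_const]) blast
    qed
    ultimately show "test_function U (\<phi> k)"
      unfolding test_function_def by (intro conjI allI exI[of _ "\<Union>n<k. cbox (a n) (b n)"]) auto
  next
    fix k x
    show "\<bar>\<phi> k x\<bar> \<le> 1" using prod01[of k x "{..<k}"] by (simp add: \<phi>_def)
  next
    fix x
    show "(\<lambda>k. \<phi> k x) \<longlonglongrightarrow> indicator U x"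
    proof (cases "x \<in> U")
      case True
      then obtain m where m: "x \<in> box (a m) (b m)" using U' by blast
      have "(\<lambda>k. \<phi> k x) \<longlonglongrightarrow> 1"
      proof (rule tendsto_sandwich[of "\<lambda>k. box_bump (a m) (b m) k x"])
        have "box_bump (a m) (b m) k x \<le> \<phi> k x" if "k > m" for k
        proof -
          have "(\<Prod>n<k. 1 - box_bump (a n) (b n) k x) =
              (1 - box_bump (a m) (b m) k x) * (\<Prod>n\<in>{..<k} - {m}. 1 - box_bump (a n) (b n) k x)"
            using that by (intro prod.remove) auto
          also have "\<dots> \<le> (1 - box_bump (a m) (b m) k x) * 1"
            by (intro mult_left_mono prod01) (simp add: box_bump_bounds)
          finally show ?thesis by (simp add: \<phi>_def)
        qed
        then show "\<forall>\<^sub>F k in sequentially. box_bump (a m) (b m) k x \<le> \<phi> k x"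
          by (intro eventually_mono[OF eventually_gt_at_top[of m]])
        show "\<forall>\<^sub>F k in sequentially. \<phi> k x \<le> 1" using prod01 by (simp add: \<phi>_def)
      qed (use box_bump_tendsto m in auto)
      then show ?thesis using True by simp
    next
      case False
      then have "x \<notin> box (a n) (b n)" for n using U' by blast
      then have "box_bump (a n) (b n) k x = 0" for n k by (rule box_bump_eq_0)
      then have "\<phi> k x = 0" for k by (simp add: \<phi>_def)
      then show ?thesis using False by simp
    qed
  qed
qed

section \<open>The fundamental lemma of the calculus of variations\<close>

lemma integrable_mult_bounded:
  fixes f g :: "'a \<Rightarrow> real"
  assumes "integrable M f" "g \<in> borel_measurable M" "\<And>x. \<bar>g x\<bar> \<le> C"
  shows "integrable M (\<lambda>x. f x * g x)"
proof (rule Bochner_Integration.integrable_bound)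
  show "integrable M (\<lambda>x. C * f x)" using assms(1) by simp
  show "(\<lambda>x. f x * g x) \<in> borel_measurable M" using assms by measurable
  have "\<bar>f x * g x\<bar> \<le> \<bar>C * f x\<bar>" for x
    using mult_left_mono[OF assms(3)[of x], of "\<bar>f x\<bar>"] assms(3)[of x]
    by (simp add: abs_mult mult.commute)
  then show "AE x in M. norm (f x * g x) \<le> norm (C * f x)" by simp
qed

text \<open>Smooth approximations of indicators make the integral of \<open>f\<close> vanish over
  open subsets of \<open>\<Omega>\<close>. Open sets generate the Borel sets and are closed under
  intersection, so all Borel integrals vanish, and a density with this property is zero a.e.\<close>

theorem fundamental_lemma_calculus_of_variations:
  fixes f :: "'a::euclidean_space \<Rightarrow> real"
  assumes "open \<Omega>" and f: "integrable (lebesgue_on \<Omega>) f"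
    and 0: "\<And>\<phi>. test_function \<Omega> \<phi> \<Longrightarrow> (\<integral>x. f x * \<phi> x \<partial>lebesgue_on \<Omega>) = 0"
  shows "AE x in lebesgue_on \<Omega>. f x = 0"
proof -
  have \<Omega>: "\<Omega> \<in> sets lebesgue" using \<open>open \<Omega>\<close> by simp
  define F where "F = (\<lambda>x. indicator \<Omega> x *\<^sub>R f x)"
  have F: "integrable lebesgue F"
    unfolding F_def using f \<Omega> by (subst (asm) integrable_restrict_space) simp_all
  have F_meas [measurable]: "F \<in> borel_measurable lebesgue" using F by simp
  \<comment> \<open>The generator argument runs over Borel sets and \<open>lborel\<close>, while the
    zero extension \<open>F\<close> is only Lebesgue measurable; hence a Borel version of
    it.\<close>
  obtain F' where F' [measurable]: "F' \<in> borel_measurable lborel" and F_eq: "AE x in lborel. F x = F' x"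
    using completion_ex_borel_measurable_real[OF F_meas] by auto
  have F'_meas [measurable]: "F' \<in> borel_measurable lebesgue" using F' by (rule measurable_completion)
  have ae: "AE x in lebesgue. F x = F' x" using F_eq by (rule AE_completion)
  have "integrable lebesgue F'" using F ae by (rule integrable_cong_AE_imp[OF _ F'_meas])
  then have F'int: "integrable lborel F'" by (simp add: integrable_completion)
  have open0: "(\<integral>x. indicator U x * F' x \<partial>lborel) = 0" if U: "open U" for U
  proof -
    obtain \<phi> where \<phi>: "\<forall>k. test_function (U \<inter> \<Omega>) (\<phi> k)" "\<forall>k x. \<bar>\<phi> k x\<bar> \<le> 1"
      "\<forall>x. (\<lambda>k. \<phi> k x) \<longlonglongrightarrow> indicator (U \<inter> \<Omega>) x"
      using test_functions_tendsto_indicator[OF open_Int[OF U \<open>open \<Omega>\<close>]] by (elim exE conjE) (rule that)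
    note \<phi> = \<phi>[rule_format]
    have meas: "\<phi> k \<in> borel_measurable (lebesgue_on \<Omega>)" for k
      by (rule continuous_imp_measurable_on_sets_lebesgue[OF continuous_on_subset[OF
            test_function_continuous[OF \<phi>(1)] subset_UNIV] \<Omega>])
    have "(\<lambda>k. \<integral>x. f x * \<phi> k x \<partial>lebesgue_on \<Omega>) \<longlonglongrightarrow> (\<integral>x. f x * indicator (U \<inter> \<Omega>) x \<partial>lebesgue_on \<Omega>)"
    proof (rule integral_dominated_convergence[where w="\<lambda>x. \<bar>f x\<bar>"])
      show "(\<lambda>x. f x * indicator (U \<inter> \<Omega>) x) \<in> borel_measurable (lebesgue_on \<Omega>)"
        using f U \<open>open \<Omega>\<close>
        by (intro borel_measurable_times borel_measurable_integrable[OF f] borel_measurable_indicator)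
          (auto simp: sets_restrict_space_iff)
      show "AE x in lebesgue_on \<Omega>. (\<lambda>k. f x * \<phi> k x) \<longlonglongrightarrow> f x * indicator (U \<inter> \<Omega>) x"
        using \<phi>(3) by (intro AE_I2 tendsto_mult) auto
      show "AE x in lebesgue_on \<Omega>. norm (f x * \<phi> k x) \<le> \<bar>f x\<bar>" for k
        using mult_left_mono[OF \<phi>(2)[of k], of "\<bar>f _\<bar>"] by (intro AE_I2) (simp add: abs_mult)
      show "(\<lambda>x. f x * \<phi> k x) \<in> borel_measurable (lebesgue_on \<Omega>)" for k
        by (intro borel_measurable_times borel_measurable_integrable[OF f] meas)
    qed (use f in simp)
    moreover have "(\<integral>x. f x * \<phi> k x \<partial>lebesgue_on \<Omega>) = 0" for k
    proof (rule 0)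
      show "test_function \<Omega> (\<phi> k)" using \<phi>(1)[of k] unfolding test_function_def by blast
    qed
    ultimately have "(\<integral>x. f x * indicator (U \<inter> \<Omega>) x \<partial>lebesgue_on \<Omega>) = 0"
      by (simp add: LIMSEQ_unique tendsto_const_iff)
    also have "(\<integral>x. f x * indicator (U \<inter> \<Omega>) x \<partial>lebesgue_on \<Omega>) =
        (\<integral>x. indicator U x * F x \<partial>lebesgue)"
      using \<Omega> by (subst integral_restrict_space)
        (auto intro!: Bochner_Integration.integral_cong simp: F_def indicator_def)
    also have "\<dots> = (\<integral>x. indicator U x * F' x \<partial>lebesgue)"
    proof (rule integral_cong_AE)
      have [measurable]: "U \<in> sets lebesgue" using U by simp
      show "(\<lambda>x. indicator U x * F x) \<in> borel_measurable lebesgue"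
        "(\<lambda>x. indicator U x * F' x) \<in> borel_measurable lebesgue" by measurable
      show "AE x in lebesgue. indicator U x * F x = indicator U x * F' x"
        using ae by eventually_elim simp
    qed
    also have "\<dots> = (\<integral>x. indicator U x * F' x \<partial>lborel)"
    proof (rule integral_completion)
      have [measurable]: "U \<in> sets lborel" using U by simp
      show "(\<lambda>x. indicator U x * F' x) \<in> borel_measurable lborel" by measurable
    qed
    finally show ?thesis .
  qed
  have borel0: "(\<integral>x. indicator A x * F' x \<partial>lborel) = 0" if A: "A \<in> sets borel" for A
  proof -
    have "Int_stable {S::'a set. open S}" by (auto simp: Int_stable_def)
    moreover have "{S::'a set. open S} \<subseteq> Pow UNIV" by simp
    moreover have "A \<in> sigma_sets UNIV {S. open S}" using A by (simp add: sets_borel)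
    ultimately show ?thesis
    proof (induction rule: sigma_sets_induct_disjoint)
      \<comment> \<open>Complements require the total integral to vanish, which is the open case
        with \<open>UNIV\<close>.\<close>
      case (compl A)
      then have A: "A \<in> sets borel" by (simp add: sets_borel)
      have "(\<integral>x. indicator (UNIV - A) x * F' x \<partial>lborel) = (\<integral>x. F' x - indicator A x * F' x \<partial>lborel)"
        by (intro Bochner_Integration.integral_cong) (auto simp: indicator_def)
      also have "\<dots> = (\<integral>x. F' x \<partial>lborel) - (\<integral>x. indicator A x * F' x \<partial>lborel)"
        using A F'int integrable_mult_indicator[of A lborel F']
        by (intro Bochner_Integration.integral_diff) auto
      finally show ?case using open0[of UNIV] compl by simp
    next
      case (union A)
      then have A: "A i \<in> sets lborel" for i by (auto simp: sets_borel)
      have "(LINT x:(\<Union>i. A i)|lborel. F' x) = (\<Sum>i. LINT x:A i|lborel. F' x)"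
        using union A integrable_mult_indicator[OF _ F'int, of "\<Union>i. A i"]
        by (intro lebesgue_integral_countable_add)
          (auto simp: disjoint_family_on_def set_integrable_def)
      then show ?case using union by (simp add: set_lebesgue_integral_def)
    qed (use open0 in auto)
  qed
  have "AE x in lborel. F' x = 0"
    using borel0 by (intro sigma_finite_measure.density_zero[OF sigma_finite_lborel F'int])
      (simp add: set_lebesgue_integral_def)
  then have "AE x in lborel. F x = 0" using F_eq by eventually_elim simp
  then have "AE x in lebesgue. F x = 0" by (rule AE_completion)
  then have "AE x in lebesgue. x \<in> \<Omega> \<longrightarrow> f x = 0" by eventually_elim (auto simp: F_def indicator_def)
  then show ?thesis using \<Omega> by (subst AE_restrict_space_iff) simp_all
qed


section \<open>Square integrable functions\<close>

text \<open>The discriminant condition, with \<open>r = 0\<close> included because the norms are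
  only seminorms. It yields both Cauchy-Schwarz inequalities and, with \<open>p = 0\<close>, the
  first-order condition at a minimum.\<close>

lemma abs_le_mult_if_quadratic_nonneg:
  fixes b p r :: real
  assumes "p \<ge> 0" "r \<ge> 0" and q: "\<And>t. 0 \<le> p\<^sup>2 + 2 * t * b + t\<^sup>2 * r\<^sup>2"
  shows "\<bar>b\<bar> \<le> p * r"
proof (cases "r = 0")
  case True
  have "b = 0"
  proof (rule ccontr)
    assume "b \<noteq> 0"
    \<comment> \<open>For \<open>r = 0\<close> the expression is affine in \<open>t\<close>; this
      parameter is chosen to give it the value -1.\<close>
    have "0 \<le> p\<^sup>2 + 2 * (- (p\<^sup>2 + 1) / (2 * b)) * b" using q[of "- (p\<^sup>2 + 1) / (2 * b)"] True by simp
    also have "\<dots> = - 1" using \<open>b \<noteq> 0\<close> by (simp add: field_simps)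
    finally show False by simp
  qed
  then show ?thesis using assms by simp
next
  case False
  have "0 \<le> p\<^sup>2 + 2 * (- b / r\<^sup>2) * b + (- b / r\<^sup>2)\<^sup>2 * r\<^sup>2" by (rule q)
  also have "\<dots> = p\<^sup>2 - b\<^sup>2 / r\<^sup>2" using False by (simp add: power2_eq_square field_simps)
  finally have "b\<^sup>2 \<le> (p * r)\<^sup>2" using False by (simp add: field_simps power_mult_distrib)
  then show ?thesis using assms by (simp add: abs_le_square_iff[symmetric])
qed

lemma L2_spaceD:
  assumes "f \<in> L2_space M"
  shows "f \<in> borel_measurable M" "integrable M (\<lambda>x. (norm (f x))\<^sup>2)"
  using assms by (simp_all add: L2_space_def)

lemma L2_norm_nonneg: "0 \<le> L2_norm M f"
  by (simp add: L2_norm_def integral_nonneg_AE)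

lemma L2_norm_power2: "(L2_norm M f)\<^sup>2 = (\<integral>x. (norm (f x))\<^sup>2 \<partial>M)"
  by (simp add: L2_norm_def integral_nonneg_AE)

lemma L2_inner_self: "L2_inner M f f = (L2_norm M f)\<^sup>2"
  by (simp add: L2_norm_power2 L2_inner_def power2_norm_eq_inner)

lemma L2_inner_commute: "L2_inner M f g = L2_inner M g f"
  by (simp add: L2_inner_def inner_commute)

lemma L2_integrable_inner:
  assumes f: "f \<in> L2_space M" and g: "g \<in> L2_space M"
  shows "integrable M (\<lambda>x. f x \<bullet> g x)"
proof (rule Bochner_Integration.integrable_bound)
  show "integrable M (\<lambda>x. (norm (f x))\<^sup>2 + (norm (g x))\<^sup>2)"
    using L2_spaceD[OF f] L2_spaceD[OF g] by simp
  show "(\<lambda>x. f x \<bullet> g x) \<in> borel_measurable M"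
    by (rule borel_measurable_inner[OF L2_spaceD(1)[OF f] L2_spaceD(1)[OF g]])
  have "\<bar>f x \<bullet> g x\<bar> \<le> (norm (f x))\<^sup>2 + (norm (g x))\<^sup>2" for x
  proof -
    have "2 * (norm (f x) * norm (g x)) \<le> (norm (f x))\<^sup>2 + (norm (g x))\<^sup>2"
      using sum_squares_bound[of "norm (f x)" "norm (g x)"] by (simp add: mult.assoc)
    moreover have "0 \<le> norm (f x) * norm (g x)" by simp
    moreover have "\<bar>f x \<bullet> g x\<bar> \<le> norm (f x) * norm (g x)" by (rule Cauchy_Schwarz_ineq2)
    ultimately show ?thesis by linarith
  qed
  then show "AE x in M. norm (f x \<bullet> g x) \<le> norm ((norm (f x))\<^sup>2 + (norm (g x))\<^sup>2)" by simp
qed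

lemma norm_add_scaleR_power2:
  "(norm (x + c *\<^sub>R y))\<^sup>2 = (norm x)\<^sup>2 + 2 * c * (x \<bullet> y) + c\<^sup>2 * (norm y)\<^sup>2"
  unfolding power2_norm_eq_inner
  by (simp add: inner_add_left inner_add_right inner_commute power2_eq_square algebra_simps)

lemma L2_space_add_scaleR:
  assumes f: "f \<in> L2_space M" and g: "g \<in> L2_space M"
  shows "(\<lambda>x. f x + c *\<^sub>R g x) \<in> L2_space M"
proof -
  have "integrable M (\<lambda>x. (norm (f x))\<^sup>2 + 2 * c * (f x \<bullet> g x) + c\<^sup>2 * (norm (g x))\<^sup>2)"
    using L2_spaceD(2)[OF f] L2_spaceD(2)[OF g] L2_integrable_inner[OF f g] by simp
  then show ?thesis
    using L2_spaceD(1)[OF f] L2_spaceD(1)[OF g]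
    by (simp add: L2_space_def norm_add_scaleR_power2)
qed

lemma L2_norm_add_scaleR_power2:
  assumes f: "f \<in> L2_space M" and g: "g \<in> L2_space M"
  shows "(L2_norm M (\<lambda>x. f x + c *\<^sub>R g x))\<^sup>2 =
    (L2_norm M f)\<^sup>2 + 2 * c * L2_inner M f g + c\<^sup>2 * (L2_norm M g)\<^sup>2"
  unfolding L2_norm_power2 norm_add_scaleR_power2 L2_inner_def
  using L2_spaceD(2)[OF f] L2_spaceD(2)[OF g] L2_integrable_inner[OF f g] by simp

lemma L2_inner_add_scaleR_left:
  assumes "f \<in> L2_space M" "g \<in> L2_space M" "h \<in> L2_space M"
  shows "L2_inner M (\<lambda>x. f x + c *\<^sub>R g x) h = L2_inner M f h + c * L2_inner M g h"
  unfolding L2_inner_def inner_add_left inner_scaleR_left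
  using L2_integrable_inner[OF assms(1,3)] L2_integrable_inner[OF assms(2,3)] by simp

lemma L2_Cauchy_Schwarz:
  assumes f: "f \<in> L2_space M" and g: "g \<in> L2_space M"
  shows "\<bar>L2_inner M f g\<bar> \<le> L2_norm M f * L2_norm M g"
proof (rule abs_le_mult_if_quadratic_nonneg)
  show "0 \<le> (L2_norm M f)\<^sup>2 + 2 * t * L2_inner M f g + t\<^sup>2 * (L2_norm M g)\<^sup>2" for t
    unfolding L2_norm_add_scaleR_power2[OF f g, symmetric] by simp
qed (rule L2_norm_nonneg)+

lemma L2_norm_add_scaleR_le:
  assumes f: "f \<in> L2_space M" and g: "g \<in> L2_space M"
  shows "L2_norm M (\<lambda>x. f x + c *\<^sub>R g x) \<le> L2_norm M f + \<bar>c\<bar> * L2_norm M g"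
proof (rule power2_le_imp_le)
  have "c * L2_inner M f g \<le> \<bar>c\<bar> * (L2_norm M f * L2_norm M g)"
    using mult_left_mono[OF L2_Cauchy_Schwarz[OF f g], of "\<bar>c\<bar>"] abs_ge_self[of "c * L2_inner M f g"]
    by (simp add: abs_mult)
  then show "(L2_norm M (\<lambda>x. f x + c *\<^sub>R g x))\<^sup>2 \<le> (L2_norm M f + \<bar>c\<bar> * L2_norm M g)\<^sup>2"
    unfolding L2_norm_add_scaleR_power2[OF f g]
    by (simp add: power2_sum power_mult_distrib mult.assoc mult.left_commute)
  show "0 \<le> L2_norm M f + \<bar>c\<bar> * L2_norm M g" by (simp add: L2_norm_nonneg)
qed

lemma L2_norm_cong_AE:
  assumes "AE x in M. f x = g x" "f \<in> borel_measurable M" "g \<in> borel_measurable M"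
  shows "L2_norm M f = L2_norm M g"
proof -
  have "(\<integral>x. (norm (f x))\<^sup>2 \<partial>M) = (\<integral>x. (norm (g x))\<^sup>2 \<partial>M)"
  proof (rule integral_cong_AE)
    show "AE x in M. (norm (f x))\<^sup>2 = (norm (g x))\<^sup>2" using assms(1) by eventually_elim simp
  qed (use assms(2,3) in measurable)
  then show ?thesis by (simp add: L2_norm_def)
qed

lemma L2_norm_eq_0:
  assumes "AE x in M. f x = 0" "f \<in> borel_measurable M"
  shows "L2_norm M f = 0"
  using L2_norm_cong_AE[OF assms(1,2)] by (simp add: L2_norm_def)

section \<open>Measurability over complete measures\<close>

lemma complete_lebesgue_on:
  assumes S: "S \<in> sets lebesgue"
  shows "complete_measure (lebesgue_on S)"
proof
  fix A B assume AB: "B \<subseteq> A" "A \<in> null_sets (lebesgue_on S)"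
  have S': "S \<inter> space lebesgue \<in> sets lebesgue" using S by simp
  have "A \<subseteq> S" "A \<in> null_sets lebesgue"
    using AB(2) null_sets_restrict_space[OF S, of A] by auto
  then have "B \<subseteq> S" "B \<in> null_sets lebesgue"
    using AB(1) completion.complete2[of B A lborel] by auto
  then show "B \<in> sets (lebesgue_on S)"
    using S by (simp add: sets_restrict_space_iff null_setsD2)
qed

text \<open>Membership in a space, limits and equations in time are all known only almost
  everywhere. Completeness is what lets measurability survive a change on a null set.\<close>

lemma (in complete_measure) borel_measurable_AE:
  assumes f: "f \<in> borel_measurable M" and ae: "AE x in M. f x = g x"
  shows "g \<in> borel_measurable M"
proof (rule measurableI)
  fix A :: "'b set" assume A: "A \<in> sets borel"
  show "g -` A \<inter> space M \<in> sets M"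
  proof (rule in_sets_AE)
    show "f -` A \<inter> space M \<in> sets M" using f A by (rule measurable_sets)
    show "AE x in M. x \<in> f -` A \<inter> space M \<longleftrightarrow> x \<in> g -` A \<inter> space M"
      using ae by eventually_elim simp
  qed simp
qed simp

lemma (in complete_measure) borel_measurable_LIMSEQ_AE:
  fixes f :: "'a \<Rightarrow> real"
  assumes s: "\<And>k. s k \<in> borel_measurable M" and ae: "AE x in M. (\<lambda>k. s k x) \<longlonglongrightarrow> f x"
  shows "f \<in> borel_measurable M"
proof (rule borel_measurable_AE)
  show "(\<lambda>x. lim (\<lambda>k. s k x)) \<in> borel_measurable M" by (rule borel_measurable_lim_metric[OF s])
  show "AE x in M. lim (\<lambda>k. s k x) = f x" using ae by eventually_elim (rule limI)
qed

section \<open>Bochner spaces\<close>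

abbreviation time_measure :: "real \<Rightarrow> real measure" where
  "time_measure T \<equiv> lebesgue_on {0<..<T}"

lemma complete_time_measure: "complete_measure (time_measure T)"
  by (rule complete_lebesgue_on) simp

lemmas borel_measurable_AE_time = complete_measure.borel_measurable_AE[OF complete_time_measure]
lemmas borel_measurable_LIMSEQ_time = complete_measure.borel_measurable_LIMSEQ_AE[OF complete_time_measure]

lemma time_integral_cong_AE:
  fixes f g :: "real \<Rightarrow> real"
  assumes f: "integrable (time_measure T) f" and ae: "AE t in time_measure T. f t = g t"
  shows "integrable (time_measure T) g"
    and "(\<integral>t. g t \<partial>time_measure T) = (\<integral>t. f t \<partial>time_measure T)"
proof -
  note mf = borel_measurable_integrable[OF f]
  note mg = borel_measurable_AE_time[OF mf ae]
  show "integrable (time_measure T) g" by (rule integrable_cong_AE_imp[OF f mg ae])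
  show "(\<integral>t. g t \<partial>time_measure T) = (\<integral>t. f t \<partial>time_measure T)"
    by (rule integral_cong_AE[OF mf mg ae, symmetric])
qed

lemma finite_time_measure: "finite_measure (time_measure T)"
  by (rule finite_measure_lebesgue_on) (simp add: lmeasurable_interval)

text \<open>Covers \<open>L2\<close>, \<open>H1\<close> and \<open>V0\<close> together. Functions
  stand for classes, so \<open>N\<close> may vanish on nonzero elements; the single combination
  \<open>u + c v\<close> yields sums, multiples and differences.\<close>

locale seminormed_functions =
  fixes X :: "('c \<Rightarrow> real) set" and N :: "('c \<Rightarrow> real) \<Rightarrow> real"
  assumes zero_mem: "(\<lambda>x. 0) \<in> X"
    and N_zero: "N (\<lambda>x. 0) = 0"
    and N_nonneg: "u \<in> X \<Longrightarrow> 0 \<le> N u"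
    and add_mult_mem: "u \<in> X \<Longrightarrow> v \<in> X \<Longrightarrow> (\<lambda>x. u x + c * v x) \<in> X"
    and N_add_mult_le: "u \<in> X \<Longrightarrow> v \<in> X \<Longrightarrow> N (\<lambda>x. u x + c * v x) \<le> N u + \<bar>c\<bar> * N v"
begin

lemma diff_mem: "u \<in> X \<Longrightarrow> v \<in> X \<Longrightarrow> (\<lambda>x. u x - v x) \<in> X"
  using add_mult_mem[of u v "-1"] by simp

lemma N_diff_le: "u \<in> X \<Longrightarrow> v \<in> X \<Longrightarrow> N (\<lambda>x. u x - v x) \<le> N u + N v"
  using N_add_mult_le[of u v "-1"] by simp

lemma N_abs_diff_le:
  assumes "u \<in> X" "v \<in> X"
  shows "\<bar>N u - N v\<bar> \<le> N (\<lambda>x. u x - v x)"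
  using N_add_mult_le[OF assms(2) diff_mem[OF assms], of 1]
    N_add_mult_le[OF assms(1) diff_mem[OF assms], of "-1"] by simp

lemma strongly_measurable_simple:
  assumes "simple_function (time_measure T) s" "\<And>t. t \<in> {0<..<T} \<Longrightarrow> s t \<in> X"
  shows "strongly_measurable (time_measure T) X N s"
  unfolding strongly_measurable_def
  using assms N_zero by (intro exI[of _ "\<lambda>_. s"]) simp

lemma strongly_measurable_add_mult:
  assumes u: "strongly_measurable (time_measure T) X N u" "AE t in time_measure T. u t \<in> X"
    and w: "strongly_measurable (time_measure T) X N w" "AE t in time_measure T. w t \<in> X"
  shows "strongly_measurable (time_measure T) X N (\<lambda>t x. u t x + c * w t x)"
proof -
  obtain s where s: "\<forall>k. simple_function (time_measure T) (s k) \<and> (\<forall>t\<in>space (time_measure T). s k t \<in> X)"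
    and s_lim: "AE t in time_measure T. (\<lambda>k. N (\<lambda>x. s k t x - u t x)) \<longlonglongrightarrow> 0"
    using u(1) unfolding strongly_measurable_def by blast
  obtain r where r: "\<forall>k. simple_function (time_measure T) (r k) \<and> (\<forall>t\<in>space (time_measure T). r k t \<in> X)"
    and r_lim: "AE t in time_measure T. (\<lambda>k. N (\<lambda>x. r k t x - w t x)) \<longlonglongrightarrow> 0"
    using w(1) unfolding strongly_measurable_def by blast
  have sf: "simple_function (time_measure T) (\<lambda>t x. s k t x + c * r k t x)" for k
    using simple_function_compose2[of "time_measure T" "s k" "r k" "\<lambda>f g x. f x + c * g x"] s r by blast
  have mem: "(\<lambda>x. s k t x + c * r k t x) \<in> X" if "t \<in> space (time_measure T)" for k t
    using s r that by (intro add_mult_mem) blast+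
  have lim: "AE t in time_measure T. (\<lambda>k. N (\<lambda>x. (s k t x + c * r k t x) - (u t x + c * w t x))) \<longlonglongrightarrow> 0"
    using s_lim r_lim u(2) w(2) AE_space[of "time_measure T"]
  proof eventually_elim
    case (elim t)
    have s': "(\<lambda>x. s k t x - u t x) \<in> X" and r': "(\<lambda>x. r k t x - w t x) \<in> X" for k
      using s r elim by (blast intro: diff_mem)+
    have eq: "(\<lambda>x. (s k t x + c * r k t x) - (u t x + c * w t x)) =
        (\<lambda>x. (s k t x - u t x) + c * (r k t x - w t x))" for k
      by (simp add: algebra_simps)
    show ?case unfolding eq
    proof (rule tendsto_sandwich[of "\<lambda>_. 0"])
      show "\<forall>\<^sub>F k in sequentially. 0 \<le> N (\<lambda>x. (s k t x - u t x) + c * (r k t x - w t x))"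
        using N_nonneg[OF add_mult_mem[OF s' r']] by simp
      show "\<forall>\<^sub>F k in sequentially. N (\<lambda>x. (s k t x - u t x) + c * (r k t x - w t x))
          \<le> N (\<lambda>x. s k t x - u t x) + \<bar>c\<bar> * N (\<lambda>x. r k t x - w t x)"
        using N_add_mult_le[OF s' r'] by simp
      show "(\<lambda>k. N (\<lambda>x. s k t x - u t x) + \<bar>c\<bar> * N (\<lambda>x. r k t x - w t x)) \<longlonglongrightarrow> 0"
        using tendsto_add[OF elim(1) tendsto_mult_left[OF elim(2), of "\<bar>c\<bar>"]] by simp
    qed simp
  qed
  show ?thesis
    unfolding strongly_measurable_def
    by (rule exI[of _ "\<lambda>k t x. s k t x + c * r k t x"]) (use sf mem lim in blast)
qed

text \<open>\<open>X\<close> carries no sigma algebra. Measurability comes from \<open>N\<close>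
  composed with a simple function, which is simple, and the inequality
  \<open>|N u - N v| \<le> N (u - v)\<close> carries it to the limit.\<close>

lemma strongly_measurable_N:
  assumes u: "strongly_measurable (time_measure T) X N u" "AE t in time_measure T. u t \<in> X"
  shows "(\<lambda>t. N (u t)) \<in> borel_measurable (time_measure T)"
proof -
  obtain s where s: "\<forall>k. simple_function (time_measure T) (s k) \<and> (\<forall>t\<in>space (time_measure T). s k t \<in> X)"
    and s_lim: "AE t in time_measure T. (\<lambda>k. N (\<lambda>x. s k t x - u t x)) \<longlonglongrightarrow> 0"
    using u(1) unfolding strongly_measurable_def by blast
  show ?thesis
  proof (rule borel_measurable_LIMSEQ_time)
    show "(\<lambda>t. N (s k t)) \<in> borel_measurable (time_measure T)" for k
      using s simple_function_compose1[of "time_measure T" "s k" N]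
      by (blast intro: borel_measurable_simple_function)
    show "AE t in time_measure T. (\<lambda>k. N (s k t)) \<longlonglongrightarrow> N (u t)"
      using s_lim u(2) AE_space[of "time_measure T"]
    proof eventually_elim
      case (elim t)
      have "(\<lambda>k. N (s k t) - N (u t)) \<longlonglongrightarrow> 0"
      proof (rule Lim_null_comparison[OF _ elim(1)])
        have "\<bar>N (s k t) - N (u t)\<bar> \<le> N (\<lambda>x. s k t x - u t x)" for k
          using s elim by (blast intro: N_abs_diff_le)
        then show "\<forall>\<^sub>F k in sequentially. norm (N (s k t) - N (u t)) \<le> N (\<lambda>x. s k t x - u t x)" by simp
      qed
      then show ?case by (rule LIM_zero_cancel)
    qed
  qed
qed

lemma bochner_L2D:
  assumes "u \<in> bochner_L2 T X N"
  shows "AE t in time_measure T. u t \<in> X" "strongly_measurable (time_measure T) X N u"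
    "integrable (time_measure T) (\<lambda>t. (N (u t))\<^sup>2)" "(\<lambda>t. N (u t)) \<in> borel_measurable (time_measure T)"
    "(\<lambda>t. N (u t)) \<in> L2_space (time_measure T)"
proof -
  show 1: "AE t in time_measure T. u t \<in> X" "strongly_measurable (time_measure T) X N u"
    "integrable (time_measure T) (\<lambda>t. (N (u t))\<^sup>2)"
    using assms by (simp_all add: bochner_L2_def)
  show 2: "(\<lambda>t. N (u t)) \<in> borel_measurable (time_measure T)"
    by (rule strongly_measurable_N[OF 1(2,1)])
  show "(\<lambda>t. N (u t)) \<in> L2_space (time_measure T)"
    using 1(3) 2 by (simp add: L2_space_def)
qed

lemma bochner_L2I:
  assumes sm: "strongly_measurable (time_measure T) X N u" and mem: "AE t in time_measure T. u t \<in> X"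
    and g: "integrable (time_measure T) g" and le: "AE t in time_measure T. (N (u t))\<^sup>2 \<le> g t"
  shows "u \<in> bochner_L2 T X N"
proof -
  have "integrable (time_measure T) (\<lambda>t. (N (u t))\<^sup>2)"
  proof (rule Bochner_Integration.integrable_bound[OF g])
    show "(\<lambda>t. (N (u t))\<^sup>2) \<in> borel_measurable (time_measure T)"
      using strongly_measurable_N[OF sm mem] by (rule borel_measurable_power)
    show "AE t in time_measure T. norm ((N (u t))\<^sup>2) \<le> norm (g t)"
      using le by eventually_elim simp
  qed
  then show ?thesis using sm mem by (simp add: bochner_L2_def)
qed

lemma bochner_L2_add_mult:
  assumes u: "u \<in> bochner_L2 T X N" and w: "w \<in> bochner_L2 T X N"
  shows "(\<lambda>t x. u t x + c * w t x) \<in> bochner_L2 T X N"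
proof -
  have mem: "AE t in time_measure T. (\<lambda>x. u t x + c * w t x) \<in> X"
    using bochner_L2D(1)[OF u] bochner_L2D(1)[OF w] by eventually_elim (rule add_mult_mem)
  have sm: "strongly_measurable (time_measure T) X N (\<lambda>t x. u t x + c * w t x)"
    by (rule strongly_measurable_add_mult[OF bochner_L2D(2,1)[OF u] bochner_L2D(2,1)[OF w]])
  show ?thesis
  proof (rule bochner_L2I[OF sm mem])
    show "integrable (time_measure T) (\<lambda>t. 2 * (N (u t))\<^sup>2 + 2 * c\<^sup>2 * (N (w t))\<^sup>2)"
      using bochner_L2D(3)[OF u] bochner_L2D(3)[OF w] by simp
    show "AE t in time_measure T. (N (\<lambda>x. u t x + c * w t x))\<^sup>2 \<le>
        2 * (N (u t))\<^sup>2 + 2 * c\<^sup>2 * (N (w t))\<^sup>2"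
      using bochner_L2D(1)[OF u] bochner_L2D(1)[OF w]
    proof eventually_elim
      case (elim t)
      have "(N (\<lambda>x. u t x + c * w t x))\<^sup>2 \<le> (N (u t) + \<bar>c\<bar> * N (w t))\<^sup>2"
        using N_add_mult_le[OF elim] N_nonneg[OF add_mult_mem[OF elim]] by (intro power_mono)
      also have "\<dots> \<le> 2 * (N (u t))\<^sup>2 + 2 * c\<^sup>2 * (N (w t))\<^sup>2"
        using sum_squares_bound[of "N (u t)" "\<bar>c\<bar> * N (w t)"]
        by (simp add: power2_sum power_mult_distrib)
      finally show ?case .
    qed
  qed
qed

lemma bochner_L2_diff:
  "u \<in> bochner_L2 T X N \<Longrightarrow> w \<in> bochner_L2 T X N \<Longrightarrow> (\<lambda>t x. u t x - w t x) \<in> bochner_L2 T X N"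
  using bochner_L2_add_mult[of u T w "-1"] by simp

lemma bochner_L2_const: "v \<in> X \<Longrightarrow> (\<lambda>t. v) \<in> bochner_L2 T X N"
  using strongly_measurable_simple[of T "\<lambda>t. v"] finite_measure.integrable_const[OF finite_time_measure]
  by (simp add: bochner_L2_def)

text \<open>The approximants given by strong measurability converge pointwise without any common
  bound. Cutting them off where they are too large compared with \<open>u\<close> supplies a
  dominating function.\<close>

lemma bochner_L2_simple_approx:
  assumes u: "u \<in> bochner_L2 T X N"
  shows "\<exists>\<sigma>. (\<forall>k. simple_function (time_measure T) (\<sigma> k)) \<and> (\<forall>k. \<forall>t\<in>{0<..<T}. \<sigma> k t \<in> X) \<and>
    (\<forall>k. \<sigma> k \<in> bochner_L2 T X N) \<and>
    (AE t in time_measure T. (\<lambda>k. N (\<lambda>x. \<sigma> k t x - u t x)) \<longlonglongrightarrow> 0) \<and>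
    (\<lambda>k. \<integral>t. (N (\<lambda>x. \<sigma> k t x - u t x))\<^sup>2 \<partial>time_measure T) \<longlonglongrightarrow> 0"
proof -
  let ?M = "time_measure T"
  note uX = bochner_L2D(1)[OF u] and uN[measurable] = bochner_L2D(4)[OF u]
  obtain s where s: "\<forall>k. simple_function ?M (s k) \<and> (\<forall>t\<in>space ?M. s k t \<in> X)"
    and s_lim: "AE t in ?M. (\<lambda>k. N (\<lambda>x. s k t x - u t x)) \<longlonglongrightarrow> 0"
    using bochner_L2D(2)[OF u] unfolding strongly_measurable_def by blast
  have sN: "(\<lambda>t. N (s k t)) \<in> borel_measurable ?M" for k
    using s simple_function_compose1[of ?M "s k" N]
    by (blast intro: borel_measurable_simple_function)
  \<comment> \<open>Where \<open>N (u t) > 0\<close>, the norms of the approximants tend to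
    \<open>N (u t)\<close>, so a threshold at twice that value is eventually respected and the
    cut-off does not disturb convergence.\<close>
  define A where "A k = {t \<in> space ?M. N (s k t) \<le> 2 * N (u t)}" for k
  have A: "A k \<in> sets ?M" for k
    using sN[of k] unfolding A_def by measurable
  define \<sigma> where "\<sigma> k t = (if t \<in> A k then s k t else (\<lambda>x. 0))" for k t
  have simple: "simple_function ?M (\<sigma> k)" for k
    unfolding \<sigma>_def[abs_def]
    using s A by (intro simple_function_If_set) (auto simp: A_def)
  have mem: "\<sigma> k t \<in> X" if "t \<in> {0<..<T}" for k t
    using s that zero_mem by (simp add: \<sigma>_def)
  have bound: "AE t in ?M. \<forall>k. N (\<sigma> k t) \<le> 2 * N (u t)"
    using uX by eventually_elim (auto simp: \<sigma>_def A_def N_zero N_nonneg)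
  have \<sigma>: "\<sigma> k \<in> bochner_L2 T X N" for k
  proof -
    have sm: "strongly_measurable ?M X N (\<sigma> k)"
      by (rule strongly_measurable_simple[OF simple mem])
    have ae: "AE t in ?M. \<sigma> k t \<in> X" using mem by (intro AE_I2) simp
    show ?thesis
    proof (rule bochner_L2I[OF sm ae])
      show "integrable ?M (\<lambda>t. 4 * (N (u t))\<^sup>2)" using bochner_L2D(3)[OF u] by simp
      show "AE t in ?M. (N (\<sigma> k t))\<^sup>2 \<le> 4 * (N (u t))\<^sup>2"
        using bound ae
      proof eventually_elim
        case (elim t)
        then have "(N (\<sigma> k t))\<^sup>2 \<le> (2 * N (u t))\<^sup>2" using N_nonneg by (intro power_mono) auto
        then show ?case by (simp add: power_mult_distrib)
      qed
    qed
  qed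
  have lim: "AE t in ?M. (\<lambda>k. N (\<lambda>x. \<sigma> k t x - u t x)) \<longlonglongrightarrow> 0"
    using s_lim uX AE_space[of ?M]
  proof eventually_elim
    case (elim t)
    then have st: "s k t \<in> X" for k using s by blast
    \<comment> \<open>A cut-off at \<open>t\<close> forces \<open>N (s - u) > N u\<close>, which
      excludes the first alternative. In the second, the substitute 0 differs from
      \<open>u t\<close> by an element of norm 0.\<close>
    have le: "N (\<lambda>x. \<sigma> k t x - u t x) \<le> N (\<lambda>x. s k t x - u t x)"
      if k: "N (\<lambda>x. s k t x - u t x) < N (u t) \<or> N (u t) = 0" for k
    proof (cases "t \<in> A k")
      case False
      then have "N (s k t) > 2 * N (u t)" using elim by (simp add: A_def)
      then have "N (u t) < N (s k t) - N (u t)" by simp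
      also have "\<dots> \<le> N (\<lambda>x. s k t x - u t x)" using N_abs_diff_le[OF st elim(2)] by (rule order_trans[OF abs_ge_self])
      finally have "N (u t) = 0" using k by simp
      moreover have "N (\<lambda>x. \<sigma> k t x - u t x) \<le> N (u t)"
        using False N_diff_le[OF zero_mem elim(2)] by (simp add: \<sigma>_def N_zero)
      ultimately show ?thesis using N_nonneg[OF diff_mem[OF st elim(2)], of k] by simp
    qed (simp add: \<sigma>_def)
    have ev: "\<forall>\<^sub>F k in sequentially. N (\<lambda>x. s k t x - u t x) < N (u t) \<or> N (u t) = 0"
    proof (cases "N (u t) = 0")
      case False
      then have "N (u t) > 0" using N_nonneg[OF elim(2)] by simp
      then have "\<forall>\<^sub>F k in sequentially. N (\<lambda>x. s k t x - u t x) < N (u t)"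
        using order_tendstoD(2)[OF elim(1)] by blast
      then show ?thesis by eventually_elim simp
    qed simp
    show ?case
    proof (rule tendsto_sandwich[OF _ _ tendsto_const elim(1)])
      have "\<sigma> k t \<in> X" for k using mem elim(3) by simp
      then show "\<forall>\<^sub>F k in sequentially. 0 \<le> N (\<lambda>x. \<sigma> k t x - u t x)"
        using N_nonneg[OF diff_mem[OF _ elim(2)]] by simp
      show "\<forall>\<^sub>F k in sequentially. N (\<lambda>x. \<sigma> k t x - u t x) \<le> N (\<lambda>x. s k t x - u t x)"
        using ev by eventually_elim (rule le)
    qed
  qed
  have "(\<lambda>k. \<integral>t. (N (\<lambda>x. \<sigma> k t x - u t x))\<^sup>2 \<partial>?M) \<longlonglongrightarrow> (\<integral>t. 0 \<partial>?M)"
  proof (rule integral_dominated_convergence[where w="\<lambda>t. 9 * (N (u t))\<^sup>2"])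
    show "(\<lambda>t. (N (\<lambda>x. \<sigma> k t x - u t x))\<^sup>2) \<in> borel_measurable ?M" for k
      using bochner_L2D(4)[OF bochner_L2_diff[OF \<sigma> u]] by (rule borel_measurable_power)
    show "integrable ?M (\<lambda>t. 9 * (N (u t))\<^sup>2)" using bochner_L2D(3)[OF u] by simp
    show "AE t in ?M. (\<lambda>k. (N (\<lambda>x. \<sigma> k t x - u t x))\<^sup>2) \<longlonglongrightarrow> 0"
      using lim by eventually_elim (use tendsto_power[of _ 0 _ 2] in fastforce)
    show "AE t in ?M. norm ((N (\<lambda>x. \<sigma> k t x - u t x))\<^sup>2) \<le> 9 * (N (u t))\<^sup>2" for k
      using bound uX AE_space[of ?M]
    proof eventually_elim
      case (elim t)
      have \<sigma>t: "\<sigma> k t \<in> X" using mem elim(3) by simp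
      have "N (\<lambda>x. \<sigma> k t x - u t x) \<le> N (\<sigma> k t) + N (u t)" by (rule N_diff_le[OF \<sigma>t elim(2)])
      also have "\<dots> \<le> 3 * N (u t)" using elim(1) by (simp add: add.commute[of "N (\<sigma> k t)"] spec[of _ k])
      finally have "(N (\<lambda>x. \<sigma> k t x - u t x))\<^sup>2 \<le> (3 * N (u t))\<^sup>2"
        using N_nonneg[OF diff_mem[OF \<sigma>t elim(2)]] by (intro power_mono)
      then show ?case by (simp add: power_mult_distrib)
    qed
  qed simp
  then have conv: "(\<lambda>k. \<integral>t. (N (\<lambda>x. \<sigma> k t x - u t x))\<^sup>2 \<partial>?M) \<longlonglongrightarrow> 0" by simp
  show ?thesis
    by (rule exI[of _ \<sigma>]) (intro conjI allI ballI simple mem \<sigma> lim conv)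
qed

end

section \<open>Functions of time with values in \<open>L2\<close>: norm, inner product,
  Cauchy-Schwarz\<close>

lemma bochner_norm_eq: "bochner_norm T N u = L2_norm (time_measure T) (\<lambda>t. N (u t))"
  by (simp add: bochner_norm_def L2_norm_def)

lemma seminormed_functions_L2: "seminormed_functions (L2_space M) (L2_norm M)"
proof
  show "(\<lambda>x. 0::real) \<in> L2_space M" by (simp add: L2_space_def)
  show "L2_norm M (\<lambda>x. 0::real) = 0" by (simp add: L2_norm_def)
  fix u v :: "'a \<Rightarrow> real" and c :: real assume "u \<in> L2_space M" "v \<in> L2_space M"
  then show "(\<lambda>x. u x + c * v x) \<in> L2_space M" "L2_norm M (\<lambda>x. u x + c * v x) \<le> L2_norm M u + \<bar>c\<bar> * L2_norm M v"
    using L2_space_add_scaleR[of u M v c] L2_norm_add_scaleR_le[of u M v c] by simp_all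
qed (rule L2_norm_nonneg)

interpretation L2: seminormed_functions "L2_space M" "L2_norm M" for M
  by (rule seminormed_functions_L2)

text \<open>By polarization. Strong measurability speaks about norms, so the inner product is
  reached through the norm of the sum.\<close>

lemma L2L2_inner_integrable:
  assumes u: "u \<in> L2L2_space T M" and w: "w \<in> L2L2_space T M"
  shows "integrable (time_measure T) (\<lambda>t. L2_inner M (u t) (w t))"
proof -
  note s = L2.bochner_L2_add_mult[OF u w, of 1]
  have "integrable (time_measure T)
      (\<lambda>t. ((L2_norm M (\<lambda>x. u t x + 1 * w t x))\<^sup>2 - (L2_norm M (u t))\<^sup>2 - (L2_norm M (w t))\<^sup>2) / 2)"
    using L2.bochner_L2D(3)[OF u] L2.bochner_L2D(3)[OF w] L2.bochner_L2D(3)[OF s] by simp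
  moreover have "AE t in time_measure T.
      ((L2_norm M (\<lambda>x. u t x + 1 * w t x))\<^sup>2 - (L2_norm M (u t))\<^sup>2 - (L2_norm M (w t))\<^sup>2) / 2
      = L2_inner M (u t) (w t)"
    using L2.bochner_L2D(1)[OF u] L2.bochner_L2D(1)[OF w]
  proof eventually_elim
    case (elim t)
    show ?case using L2_norm_add_scaleR_power2[OF elim, of 1] by simp
  qed
  ultimately show ?thesis by (rule time_integral_cong_AE(1))
qed

definition L2L2_inner :: "real \<Rightarrow> 'c measure \<Rightarrow> (real \<Rightarrow> 'c \<Rightarrow> real) \<Rightarrow> (real \<Rightarrow> 'c \<Rightarrow> real) \<Rightarrow> real" where
  "L2L2_inner T M u w = (\<integral>t. L2_inner M (u t) (w t) \<partial>time_measure T)"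

lemma L2L2_norm_power2: "(L2L2_norm T M u)\<^sup>2 = (\<integral>t. (L2_norm M (u t))\<^sup>2 \<partial>time_measure T)"
  by (simp add: bochner_norm_def integral_nonneg_AE)

lemma L2L2_norm_nonneg: "0 \<le> L2L2_norm T M u"
  by (simp add: bochner_norm_eq L2_norm_nonneg)

lemma L2L2_norm_add_mult_power2:
  assumes u: "u \<in> L2L2_space T M" and w: "w \<in> L2L2_space T M"
  shows "(L2L2_norm T M (\<lambda>t x. u t x + c * w t x))\<^sup>2 =
    (L2L2_norm T M u)\<^sup>2 + 2 * c * L2L2_inner T M u w + c\<^sup>2 * (L2L2_norm T M w)\<^sup>2"
proof -
  note I = L2.bochner_L2D(3)[OF u] L2.bochner_L2D(3)[OF w] L2L2_inner_integrable[OF u w]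
  have "(\<integral>t. (L2_norm M (\<lambda>x. u t x + c * w t x))\<^sup>2 \<partial>time_measure T) =
      (\<integral>t. (L2_norm M (u t))\<^sup>2 + 2 * c * L2_inner M (u t) (w t) + c\<^sup>2 * (L2_norm M (w t))\<^sup>2 \<partial>time_measure T)"
  proof (rule time_integral_cong_AE(2))
    show "AE t in time_measure T. (L2_norm M (u t))\<^sup>2 + 2 * c * L2_inner M (u t) (w t) + c\<^sup>2 * (L2_norm M (w t))\<^sup>2 =
        (L2_norm M (\<lambda>x. u t x + c * w t x))\<^sup>2"
      using L2.bochner_L2D(1)[OF u] L2.bochner_L2D(1)[OF w]
    proof eventually_elim
      case (elim t)
      show ?case using L2_norm_add_scaleR_power2[OF elim, of c] by simp
    qed
  qed (use I in simp)
  also have "\<dots> = (\<integral>t. (L2_norm M (u t))\<^sup>2 \<partial>time_measure T) +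
      2 * c * L2L2_inner T M u w + c\<^sup>2 * (\<integral>t. (L2_norm M (w t))\<^sup>2 \<partial>time_measure T)"
    unfolding L2L2_inner_def using I by simp
  finally show ?thesis by (simp add: L2L2_norm_power2)
qed

lemma L2L2_Cauchy_Schwarz:
  assumes u: "u \<in> L2L2_space T M" and w: "w \<in> L2L2_space T M"
  shows "\<bar>L2L2_inner T M u w\<bar> \<le> L2L2_norm T M u * L2L2_norm T M w"
proof (rule abs_le_mult_if_quadratic_nonneg)
  show "0 \<le> (L2L2_norm T M u)\<^sup>2 + 2 * t * L2L2_inner T M u w + t\<^sup>2 * (L2L2_norm T M w)\<^sup>2" for t
    unfolding L2L2_norm_add_mult_power2[OF u w, symmetric] by simp
qed (rule L2L2_norm_nonneg)+

lemma L2L2_inner_diff_left: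
  assumes u: "u \<in> L2L2_space T M" and v: "v \<in> L2L2_space T M" and w: "w \<in> L2L2_space T M"
  shows "L2L2_inner T M (\<lambda>t x. u t x - v t x) w = L2L2_inner T M u w - L2L2_inner T M v w"
proof -
  note I = L2L2_inner_integrable[OF u w] L2L2_inner_integrable[OF v w]
  have "L2L2_inner T M (\<lambda>t x. u t x - v t x) w =
      (\<integral>t. L2_inner M (u t) (w t) - L2_inner M (v t) (w t) \<partial>time_measure T)"
    unfolding L2L2_inner_def
  proof (rule time_integral_cong_AE(2))
    show "AE t in time_measure T. L2_inner M (u t) (w t) - L2_inner M (v t) (w t) =
        L2_inner M (\<lambda>x. u t x - v t x) (w t)"
      using L2.bochner_L2D(1)[OF u] L2.bochner_L2D(1)[OF v] L2.bochner_L2D(1)[OF w]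
    proof eventually_elim
      case (elim t)
      show ?case using L2_inner_add_scaleR_left[OF elim, of "-1"] by simp
    qed
  qed (use I in simp)
  then show ?thesis unfolding L2L2_inner_def using I by simp
qed


section \<open>Primitives in time\<close>

text \<open>A bridge from the Lebesgue integral over the open interval to the gauge integral over
  the closed one, where shifting, splitting and the fundamental theorem are at hand.\<close>

lemma time_integral_eq_integral:
  fixes f :: "real \<Rightarrow> real"
  assumes f: "continuous_on {0..T} f"
  shows "integrable (time_measure T) f" "(\<integral>t. f t \<partial>time_measure T) = integral {0..T} f"
proof -
  have "bounded (f ` {0..T})" by (intro compact_imp_bounded compact_continuous_image f) simp
  then obtain B where B: "\<forall>t\<in>{0..T}. \<bar>f t\<bar> \<le> B" by (auto simp: bounded_real)
  have "f \<in> borel_measurable (time_measure T)"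
    by (rule continuous_imp_measurable_on_sets_lebesgue[OF continuous_on_subset[OF f]]) auto
  then show I: "integrable (time_measure T) f"
  proof (rule finite_measure.integrable_const_bound[OF finite_time_measure, rotated])
    show "AE t in time_measure T. norm (f t) \<le> B" using B by (intro AE_I2) auto
  qed
  have "(\<integral>t. f t \<partial>time_measure T) = integral {0<..<T} f"
    by (rule lebesgue_integral_eq_integral[OF I]) simp
  then show "(\<integral>t. f t \<partial>time_measure T) = integral {0..T} f"
    by (simp add: integral_open_interval_real)
qed

lemma L2_space_time_integrable:
  fixes b :: "real \<Rightarrow> real"
  assumes "b \<in> L2_space (time_measure T)"
  shows "integrable (time_measure T) b"
proof -
  have "(\<lambda>t. 1::real) \<in> L2_space (time_measure T)"
    using finite_measure.integrable_const[OF finite_time_measure] by (simp add: L2_space_def)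
  from L2_integrable_inner[OF this assms] show ?thesis by simp
qed

text \<open>The indicator makes this total on the real line: 0 before time 0 and constant after
  \<open>T\<close>. Backward differences near 0 therefore see the extension by zero.\<close>

definition primitive :: "real \<Rightarrow> (real \<Rightarrow> real) \<Rightarrow> real \<Rightarrow> real" where
  "primitive T b t = (\<integral>s. indicator {..t} s * b s \<partial>time_measure T)"

lemma integrable_indicator_time:
  fixes b :: "real \<Rightarrow> real"
  assumes b: "integrable (time_measure T) b" and A: "A \<in> sets borel"
  shows "integrable (time_measure T) (\<lambda>s. indicator A s * b s)"
proof -
  have "integrable (time_measure T) (\<lambda>s. b s * indicator A s)"
  proof (rule integrable_mult_bounded[OF b, of _ 1])
    show "(indicator A :: real \<Rightarrow> real) \<in> borel_measurable (time_measure T)"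
      using A by (intro measurable_restrict_space1 measurable_completion) simp
  qed (simp add: indicator_def)
  then show ?thesis by (simp add: mult.commute)
qed

lemma primitive_nonpos: "t \<le> 0 \<Longrightarrow> primitive T b t = 0"
proof -
  assume "t \<le> 0"
  then have "(\<integral>s. indicator {..t} s * b s \<partial>time_measure T) = (\<integral>s. 0 \<partial>time_measure T)"
    by (intro Bochner_Integration.integral_cong) (auto simp: indicator_def)
  then show ?thesis by (simp add: primitive_def)
qed

lemma primitive_ge: "T \<le> t \<Longrightarrow> primitive T b t = (\<integral>s. b s \<partial>time_measure T)"
  unfolding primitive_def
  by (intro Bochner_Integration.integral_cong) (auto simp: indicator_def)

lemma primitive_diff:
  assumes b: "integrable (time_measure T) b" and "c \<le> d"
  shows "primitive T b d - primitive T b c = (\<integral>s. indicator {c<..d} s * b s \<partial>time_measure T)"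
proof -
  have "primitive T b d - primitive T b c =
      (\<integral>s. indicator {..d} s * b s - indicator {..c} s * b s \<partial>time_measure T)"
    unfolding primitive_def by (simp add: integrable_indicator_time[OF b])
  also have "\<dots> = (\<integral>s. indicator {c<..d} s * b s \<partial>time_measure T)"
    using \<open>c \<le> d\<close> by (intro Bochner_Integration.integral_cong) (auto simp: indicator_def)
  finally show ?thesis .
qed

lemma AE_time_neq: "AE s in time_measure T. s \<noteq> c"
proof -
  have "AE s in lebesgue. s \<noteq> c" by (rule AE_completion[OF AE_lborel_singleton])
  then have "AE s in lebesgue. s \<in> {0<..<T} \<longrightarrow> s \<noteq> c" by eventually_elim simp
  then show ?thesis by (subst AE_restrict_space_iff) simp_all
qed

lemma continuous_on_primitive:
  assumes b: "integrable (time_measure T) b"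
  shows "continuous_on UNIV (primitive T b)"
proof (rule continuous_at_imp_continuous_on, rule ballI)
  fix t :: real
  show "isCont (primitive T b) t"
  proof (rule continuous_at_sequentiallyI)
    fix X :: "nat \<Rightarrow> real" assume X: "X \<longlonglongrightarrow> t"
      show "(\<lambda>n. primitive T b (X n)) \<longlonglongrightarrow> primitive T b t"
        unfolding primitive_def
      proof (rule integral_dominated_convergence[where w="\<lambda>s. \<bar>b s\<bar>"])
        show "integrable (time_measure T) (\<lambda>s. \<bar>b s\<bar>)" using b by simp
        show "(\<lambda>s. indicator {..t} s * b s) \<in> borel_measurable (time_measure T)" for t
          by (rule borel_measurable_integrable[OF integrable_indicator_time[OF b]]) simp
        then show "(\<lambda>s. indicator {..X n} s * b s) \<in> borel_measurable (time_measure T)" for n .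
        show "AE s in time_measure T. (\<lambda>n. indicator {..X n} s * b s) \<longlonglongrightarrow> indicator {..t} s * b s"
          using AE_time_neq[where c=t]
        proof eventually_elim
          case (elim s)
          have "\<forall>\<^sub>F n in sequentially. indicator {..X n} s = (indicator {..t} s :: real)"
          proof (cases "s < t")
            case True
            then have "\<forall>\<^sub>F n in sequentially. s < X n" by (rule order_tendstoD(1)[OF X])
            then show ?thesis by eventually_elim (use True in \<open>simp add: indicator_def\<close>)
          next
            case False
            then have "t < s" using elim by simp
            then have "\<forall>\<^sub>F n in sequentially. X n < s" by (rule order_tendstoD(2)[OF X])
            then show ?thesis by eventually_elim (use \<open>t < s\<close> in \<open>simp add: indicator_def\<close>)
          qed
          then have "\<forall>\<^sub>F n in sequentially. indicator {..t} s * b s = indicator {..X n} s * b s"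
            by eventually_elim simp
          then show ?case by (rule Lim_transform_eventually[OF tendsto_const])
        qed
        show "AE s in time_measure T. norm (indicator {..X n} s * b s) \<le> \<bar>b s\<bar>" for n
          by (intro AE_I2) (simp add: indicator_def)
      qed
  qed
qed

text \<open>After the shift both integrals contain \<open>{0..T - h}\<close>, and the overhang at
  negative times is 0. What survives the cancellation is the last window.\<close>

lemma integral_backward_difference:
  fixes F :: "real \<Rightarrow> real"
  assumes F: "continuous_on {..T} F" "\<And>t. t \<le> 0 \<Longrightarrow> F t = 0" and h: "0 < h" "h < T"
  shows "integrable (time_measure T) (\<lambda>t. F t - F (t - h))"
    and "(\<integral>t. F t - F (t - h) \<partial>time_measure T) = integral {T - h..T} F"
proof -
  have 1: "continuous_on {0..T} F" by (rule continuous_on_subset[OF F(1)]) auto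
  have 2: "continuous_on {0..T} (\<lambda>t. F (t - h))"
    by (rule continuous_on_compose2[OF F(1)]) (use h in \<open>auto intro!: continuous_intros\<close>)
  show "integrable (time_measure T) (\<lambda>t. F t - F (t - h))"
    using time_integral_eq_integral(1)[OF 1] time_integral_eq_integral(1)[OF 2] by simp
  have "(\<integral>t. F t - F (t - h) \<partial>time_measure T) = integral {0..T} F - integral {0..T} (\<lambda>t. F (t - h))"
    using time_integral_eq_integral[OF 1] time_integral_eq_integral[OF 2] by simp
  also have "integral {0..T} (\<lambda>t. F (t - h)) = integral {-h..T - h} F"
    using integral_shift_real_ivl[of "-h" "-h" "T - h" F] by simp
  also have "\<dots> = integral {-h..0} F + integral {0..T - h} F"
    using h by (intro Henstock_Kurzweil_Integration.integral_combine[symmetric]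
        integrable_continuous_real continuous_on_subset[OF F(1)]) auto
  also have "integral {-h..0} F = integral {-h..0} (\<lambda>_. 0)"
    using F(2) by (intro Henstock_Kurzweil_Integration.integral_cong) auto
  also have "integral {0..T} F = integral {0..T - h} F + integral {T - h..T} F"
    using h by (intro Henstock_Kurzweil_Integration.integral_combine[symmetric]
        integrable_continuous_real continuous_on_subset[OF F(1)]) auto
  finally show "(\<integral>t. F t - F (t - h) \<partial>time_measure T) = integral {T - h..T} F" by simp
qed

section \<open>Moving averages in time: \<open>L2\<close> bound and weak convergence\<close>

lemma measure_time_Ioc_le:
  assumes "0 \<le> h"
  shows "(L2_norm (time_measure T) (indicator {t - h<..t} :: real \<Rightarrow> real))\<^sup>2 \<le> h"
proof -
  have "(L2_norm (time_measure T) (indicator {t - h<..t} :: real \<Rightarrow> real))\<^sup>2 =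
      (\<integral>s. indicator {0<..<T} s *\<^sub>R indicator {t - h<..t} s \<partial>lebesgue)"
    unfolding L2_norm_power2
    by (subst integral_restrict_space) (auto intro!: Bochner_Integration.integral_cong simp: indicator_def)
  also have "\<dots> = (\<integral>s. indicator ({0<..<T} \<inter> {t - h<..t}) s \<partial>lebesgue)"
    by (intro Bochner_Integration.integral_cong) (auto simp: indicator_def)
  also have "\<dots> = measure lebesgue ({0<..<T} \<inter> {t - h<..t})" by simp
  also have "\<dots> \<le> measure lebesgue {t - h<..t}"
    by (intro measure_mono_fmeasurable) (auto intro!: bounded_set_imp_lmeasurable)
  also have "\<dots> = h" using assms by simp
  finally show ?thesis .
qed

text \<open>The Steklov average of \<open>b\<close>, extended by zero, over
  \<open>{t - h<..t}\<close>. If \<open>b\<close> is the derivative of a function starting at 0, it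
  is the backward difference quotient of that function.\<close>

definition backward_quotient :: "real \<Rightarrow> real \<Rightarrow> (real \<Rightarrow> real) \<Rightarrow> real \<Rightarrow> real" where
  "backward_quotient T h b t = (primitive T b t - primitive T b (t - h)) / h"

lemma backward_quotient_continuous:
  assumes "integrable (time_measure T) b"
  shows "continuous_on S (backward_quotient T h b)"
proof -
  note c = continuous_on_primitive[OF assms]
  have "continuous_on S (\<lambda>t. primitive T b (t - h))"
    by (rule continuous_on_compose2[OF c]) (auto intro!: continuous_intros)
  moreover have "continuous_on S (primitive T b)" by (rule continuous_on_subset[OF c]) simp
  ultimately show ?thesis
    unfolding backward_quotient_def[abs_def] divide_inverse by (intro continuous_intros)
qed

text \<open>Cauchy-Schwarz on a window of length \<open>h\<close>, followed by telescoping of the primitive of \<open>b\<^sup>2\<close>.\<close>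

lemma backward_quotient_L2:
  fixes b :: "real \<Rightarrow> real"
  assumes b: "b \<in> L2_space (time_measure T)" and h: "0 < h" "h < T"
  shows "backward_quotient T h b \<in> L2_space (time_measure T)"
    and "L2_norm (time_measure T) (backward_quotient T h b) \<le> L2_norm (time_measure T) b"
proof -
  let ?M = "time_measure T"
  define \<Phi> where "\<Phi> = primitive T (\<lambda>s. (b s)\<^sup>2)"
  note bI = L2_space_time_integrable[OF b]
  have b2: "integrable ?M (\<lambda>s. (b s)\<^sup>2)" using L2_spaceD(2)[OF b] by simp
  note cont = backward_quotient_continuous[OF bI, of _ h]
  show mem: "backward_quotient T h b \<in> L2_space ?M"
  proof -
    have c2: "continuous_on {0..T} (\<lambda>t. (norm (backward_quotient T h b t))\<^sup>2)"
      by (intro continuous_on_power continuous_on_norm cont)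
    show ?thesis
      unfolding L2_space_def
      using time_integral_eq_integral(1)[OF c2]
        borel_measurable_integrable[OF time_integral_eq_integral(1)[OF cont[of "{0..T}"]]]
      by simp
  qed
  have le: "(backward_quotient T h b t)\<^sup>2 \<le> (\<Phi> t - \<Phi> (t - h)) / h" for t
  proof -
    let ?i = "indicator {t - h<..t} :: real \<Rightarrow> real"
    have iL2: "?i \<in> L2_space ?M"
    proof -
      have "integrable ?M (\<lambda>s. ?i s * 1)"
        using finite_measure.integrable_const[OF finite_time_measure] by (intro integrable_indicator_time) auto
      moreover have "(norm (?i s))\<^sup>2 = ?i s" for s by (simp add: indicator_def)
      ultimately show ?thesis by (simp add: L2_space_def borel_measurable_integrable)
    qed
    have ibI: "integrable ?M (\<lambda>s. ?i s * b s)" by (rule integrable_indicator_time[OF bI]) simp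
    have ib2I: "integrable ?M (\<lambda>s. ?i s * (b s)\<^sup>2)" by (rule integrable_indicator_time[OF b2]) simp
    have ib2: "(norm (?i s * b s))\<^sup>2 = ?i s * (b s)\<^sup>2" for s by (simp add: indicator_def)
    have ibL2: "(\<lambda>s. ?i s * b s) \<in> L2_space ?M"
      using borel_measurable_integrable[OF ibI] ib2I by (simp only: L2_space_def mem_Collect_eq ib2)
    have "primitive T b t - primitive T b (t - h) = L2_inner ?M ?i (\<lambda>s. ?i s * b s)"
    proof -
      have "primitive T b t - primitive T b (t - h) = (\<integral>s. ?i s * b s \<partial>?M)"
        using primitive_diff[OF bI, of "t - h" t] h by simp
      also have "\<dots> = L2_inner ?M ?i (\<lambda>s. ?i s * b s)"
        unfolding L2_inner_def
        by (intro Bochner_Integration.integral_cong refl) (simp add: indicator_def)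
      finally show ?thesis .
    qed
    then have "\<bar>primitive T b t - primitive T b (t - h)\<bar> \<le> L2_norm ?M ?i * L2_norm ?M (\<lambda>s. ?i s * b s)"
      using L2_Cauchy_Schwarz[OF iL2 ibL2] by simp
    then have "\<bar>primitive T b t - primitive T b (t - h)\<bar>\<^sup>2 \<le> (L2_norm ?M ?i * L2_norm ?M (\<lambda>s. ?i s * b s))\<^sup>2"
      by (rule power_mono) simp
    then have "(primitive T b t - primitive T b (t - h))\<^sup>2 \<le> (L2_norm ?M ?i * L2_norm ?M (\<lambda>s. ?i s * b s))\<^sup>2"
      by simp
    also have "\<dots> \<le> h * (L2_norm ?M (\<lambda>s. ?i s * b s))\<^sup>2"
      unfolding power_mult_distrib using h by (intro mult_right_mono measure_time_Ioc_le) auto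
    also have "(L2_norm ?M (\<lambda>s. ?i s * b s))\<^sup>2 = \<Phi> t - \<Phi> (t - h)"
      unfolding L2_norm_power2 ib2 \<Phi>_def using primitive_diff[OF b2, of "t - h" t] h by simp
    finally have "(primitive T b t - primitive T b (t - h))\<^sup>2 / h\<^sup>2 \<le> (h * (\<Phi> t - \<Phi> (t - h))) / h\<^sup>2"
      by (rule divide_right_mono) simp
    also have "\<dots> = (\<Phi> t - \<Phi> (t - h)) / h" using h by (simp add: power2_eq_square)
    finally show ?thesis by (simp add: backward_quotient_def power_divide)
  qed
  have \<Phi>_cont: "continuous_on {..T} \<Phi>"
    unfolding \<Phi>_def by (rule continuous_on_subset[OF continuous_on_primitive[OF b2]]) simp
  have \<Phi>_0: "\<Phi> t = 0" if "t \<le> 0" for t using that unfolding \<Phi>_def by (rule primitive_nonpos)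
  have \<Phi>_le: "\<Phi> t \<le> (L2_norm ?M b)\<^sup>2" for t
  proof -
    have "\<Phi> t \<le> (\<integral>s. (b s)\<^sup>2 \<partial>?M)"
      unfolding \<Phi>_def primitive_def
      by (intro integral_mono integrable_indicator_time b2) (auto simp: indicator_def)
    then show ?thesis by (simp add: L2_norm_power2)
  qed
  note bd = integral_backward_difference[OF \<Phi>_cont \<Phi>_0 h]
  have "(L2_norm ?M (backward_quotient T h b))\<^sup>2 = (\<integral>t. (backward_quotient T h b t)\<^sup>2 \<partial>?M)"
    by (simp add: L2_norm_power2)
  also have "\<dots> \<le> (\<integral>t. (\<Phi> t - \<Phi> (t - h)) / h \<partial>?M)"
    using L2_spaceD(2)[OF mem] bd(1) le by (intro integral_mono) simp_all
  also have "\<dots> = integral {T - h..T} \<Phi> / h" using bd(2) by simp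
  also have "\<dots> \<le> (h * (L2_norm ?M b)\<^sup>2) / h"
  proof (rule divide_right_mono)
    have "integral {T - h..T} \<Phi> \<le> integral {T - h..T} (\<lambda>_. (L2_norm ?M b)\<^sup>2)"
      by (intro integral_le integrable_continuous_real continuous_on_subset[OF \<Phi>_cont])
        (auto intro: \<Phi>_le)
    then show "integral {T - h..T} \<Phi> \<le> h * (L2_norm ?M b)\<^sup>2" using h by simp
  qed (use h in simp)
  also have "\<dots> = (L2_norm ?M b)\<^sup>2" using h by simp
  finally show "L2_norm ?M (backward_quotient T h b) \<le> L2_norm ?M b"
    by (rule power2_le_imp_le[OF _ L2_norm_nonneg])
qed

text \<open>Because \<open>e k\<close> does not depend on \<open>n\<close>, three errors of size
  \<open>r / 3\<close> suffice to interchange the limits. Applied to enlarge the class of test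
  functions and later to leave simple functions of time.\<close>

lemma LIMSEQ_uniform_approx:
  fixes a :: "nat \<Rightarrow> nat \<Rightarrow> real"
  assumes conv: "\<And>k. (\<lambda>n. a n k) \<longlonglongrightarrow> l k"
    and le: "\<And>k. \<forall>\<^sub>F n in sequentially. \<bar>a n k - a' n\<bar> \<le> e k" and le': "\<And>k. \<bar>l k - l'\<bar> \<le> e k"
    and e: "e \<longlonglongrightarrow> 0"
  shows "a' \<longlonglongrightarrow> l'"
proof (rule tendstoI)
  fix r :: real assume "r > 0"
  then have "\<forall>\<^sub>F k in sequentially. e k < r / 3" by (intro order_tendstoD(2)[OF e]) simp
  then obtain k where k: "e k < r / 3" by (auto simp: eventually_sequentially)
  have "\<forall>\<^sub>F n in sequentially. dist (a n k) (l k) < r / 3"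
    by (rule tendstoD[OF conv]) (use \<open>r > 0\<close> in simp)
  then show "\<forall>\<^sub>F n in sequentially. dist (a' n) l' < r"
    using le[of k]
  proof eventually_elim
    case (elim n)
    then show ?case using le'[of k] k unfolding dist_real_def by linarith
  qed
qed

text \<open>Level sets of simple functions of time are only Lebesgue measurable, while induction
  over generated sets reaches Borel sets.\<close>

lemma time_set_eq_borel_AE:
  assumes A: "A \<in> sets (time_measure T)"
  shows "\<exists>A'\<in>sets borel. AE t in time_measure T. indicator A t = (indicator A' t :: real)"
proof -
  have "A \<in> sets lebesgue" using A by (simp add: sets_restrict_space_iff)
  then have "(indicator A :: real \<Rightarrow> real) \<in> borel_measurable lebesgue" by simp
  then obtain g where g: "g \<in> borel_measurable lborel" "AE t in lborel. indicator A t = (g t :: real)"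
    using completion_ex_borel_measurable_real[of "indicator A" lborel] by auto
  define A' where "A' = g -` {1}"
  have "A' \<in> sets borel" unfolding A'_def using measurable_sets[OF g(1), of "{1}"] by simp
  moreover have "AE t in lborel. indicator A t = (indicator A' t :: real)"
    using g(2)
  proof eventually_elim
    case (elim t)
    then show ?case by (cases "t \<in> A") (auto simp: A'_def indicator_def)
  qed
  then have "AE t in lebesgue. indicator A t = (indicator A' t :: real)" by (rule AE_completion)
  then have "AE t in lebesgue. t \<in> {0<..<T} \<longrightarrow> indicator A t = (indicator A' t :: real)"
    by eventually_elim simp
  then have "AE t in time_measure T. indicator A t = (indicator A' t :: real)"
    by (subst AE_restrict_space_iff) simp_all
  ultimately show ?thesis by blast
qed

lemma indicator_mult_L2:
  fixes f :: "real \<Rightarrow> real"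
  assumes f: "f \<in> L2_space (time_measure T)" and A: "A \<in> sets borel"
  shows "(\<integral>t. indicator A t * f t \<partial>time_measure T) = L2_inner (time_measure T) (indicator A) f"
    "(indicator A :: real \<Rightarrow> real) \<in> L2_space (time_measure T)"
proof -
  show "(\<integral>t. indicator A t * f t \<partial>time_measure T) = L2_inner (time_measure T) (indicator A) f"
    by (simp add: L2_inner_def)
  have "integrable (time_measure T) (\<lambda>s. indicator A s * (1::real))"
    using finite_measure.integrable_const[OF finite_time_measure] A by (intro integrable_indicator_time) auto
  moreover have "(norm (indicator A s :: real))\<^sup>2 = indicator A s" for s by (simp add: indicator_def)
  ultimately show "(indicator A :: real \<Rightarrow> real) \<in> L2_space (time_measure T)"
    by (simp add: L2_space_def borel_measurable_integrable)
qed


lemma average_tendsto: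
  fixes G :: "real \<Rightarrow> real"
  assumes G: "continuous_on UNIV G" and h: "\<And>n. 0 < h n" "h \<longlonglongrightarrow> 0"
  shows "(\<lambda>n. integral {c - h n..c} G / h n) \<longlonglongrightarrow> G c"
proof (rule tendstoI)
  fix e :: real assume "e > 0"
  have "isCont G c" using G by (simp add: continuous_on_eq_continuous_at)
  then obtain d where d: "d > 0" "\<And>t. dist t c < d \<Longrightarrow> dist (G t) (G c) < e / 2"
    using \<open>e > 0\<close> unfolding continuous_at_eps_delta dist_norm by (metis half_gt_zero)
  have "\<forall>\<^sub>F n in sequentially. h n < d" using order_tendstoD(2)[OF h(2) d(1)] .
  then show "\<forall>\<^sub>F n in sequentially. dist (integral {c - h n..c} G / h n) (G c) < e"
  proof eventually_elim
    case (elim n)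
    have cont: "continuous_on {c - h n..c} G" by (rule continuous_on_subset[OF G]) simp
    have "norm (integral {c - h n..c} (\<lambda>t. G t - G c)) \<le> e / 2 * (c - (c - h n))"
    proof (rule integral_bound)
      show "c - h n \<le> c" using h(1)[of n] by simp
      show "continuous_on {c - h n..c} (\<lambda>t. G t - G c)" by (intro continuous_on_diff cont continuous_on_const)
      fix t assume "t \<in> {c - h n..c}"
      then have "dist t c < d" using elim by (auto simp: dist_real_def)
      then show "norm (G t - G c) \<le> e / 2" using d(2)[of t] by (simp add: dist_norm)
    qed
    moreover have "integral {c - h n..c} (\<lambda>t. G t - G c) = integral {c - h n..c} G - h n * G c"
    proof -
      have "integral {c - h n..c} (\<lambda>t. G t - G c) = integral {c - h n..c} G - integral {c - h n..c} (\<lambda>t. G c)"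
        by (intro Henstock_Kurzweil_Integration.integral_diff integrable_continuous_real cont continuous_on_const)
      then show ?thesis using h(1)[of n] by simp
    qed
    ultimately have "\<bar>integral {c - h n..c} G - h n * G c\<bar> \<le> e / 2 * h n" by simp
    then have "\<bar>integral {c - h n..c} G - h n * G c\<bar> / h n \<le> e / 2 * h n / h n"
      using h(1)[of n] by (intro divide_right_mono) auto
    moreover have "\<bar>integral {c - h n..c} G - h n * G c\<bar> / h n = \<bar>integral {c - h n..c} G / h n - G c\<bar>"
    proof -
      have "integral {c - h n..c} G / h n - G c = (integral {c - h n..c} G - h n * G c) / h n"
        using h(1)[of n] by (simp add: field_simps)
      then show ?thesis using h(1)[of n] by (simp add: abs_divide)
    qed
    ultimately show ?case using h(1)[of n] \<open>e > 0\<close> by (simp add: dist_real_def)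
  qed
qed

text \<open>The offset 2 keeps every step strictly below \<open>T\<close>, already for
  \<open>n = 0\<close>.\<close>

definition step_size :: "real \<Rightarrow> nat \<Rightarrow> real" where
  "step_size T n = T / (real n + 2)"

lemma step_size:
  assumes "0 < T"
  shows "0 < step_size T n" "step_size T n < T" "step_size T \<longlonglongrightarrow> 0"
proof -
  show "0 < step_size T n" using assms by (simp add: step_size_def)
  have "T * 1 < T * (real n + 2)" using assms by (intro mult_strict_left_mono) auto
  then show "step_size T n < T" by (simp add: step_size_def pos_divide_less_eq)
  have "(\<lambda>n. T * inverse (real (n + 2))) \<longlonglongrightarrow> T * 0"
    by (intro tendsto_mult tendsto_const LIMSEQ_ignore_initial_segment[OF lim_inverse_n])
  then show "step_size T \<longlonglongrightarrow> 0" unfolding step_size_def[abs_def] by (simp add: divide_inverse add.commute)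
qed

text \<open>Over a half-line the difference quotient telescopes to the mean of the primitive over
  the last window before \<open>c\<close>, and continuity of the primitive gives the limit.\<close>

lemma backward_quotient_integral_Iio:
  assumes b: "b \<in> L2_space (time_measure T)" and T: "0 < T"
  shows "(\<lambda>n. \<integral>t. indicator {..<a} t * backward_quotient T (step_size T n) b t \<partial>time_measure T)
    \<longlonglongrightarrow> (\<integral>t. indicator {..<a} t * b t \<partial>time_measure T)"
proof -
  define G where "G = primitive T b"
  define c where "c = min a T"
  note bI = L2_space_time_integrable[OF b]
  have G: "continuous_on UNIV G" unfolding G_def by (rule continuous_on_primitive[OF bI])
  \<comment> \<open>Testing with a half-line amounts to replacing the final time \<open>T\<close> by
    \<open>c\<close>, so the telescoping identity applies verbatim with \<open>c\<close>. If
    \<open>c \<le> 0\<close> the interval is empty.\<close>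
  have lhs: "(\<integral>t. indicator {..<a} t * f t \<partial>time_measure T) = (\<integral>t. f t \<partial>time_measure c)"
    for f :: "real \<Rightarrow> real"
  proof -
    have "(\<integral>t. indicator {..<a} t * f t \<partial>time_measure T) =
        (\<integral>t. indicator {0<..<T} t *\<^sub>R (indicator {..<a} t * f t) \<partial>lebesgue)"
      by (rule integral_restrict_space) simp
    also have "\<dots> = (\<integral>t. indicator {0<..<c} t *\<^sub>R f t \<partial>lebesgue)"
      by (intro Bochner_Integration.integral_cong refl) (auto simp: indicator_def c_def)
    also have "\<dots> = (\<integral>t. f t \<partial>time_measure c)"
      by (rule integral_restrict_space[symmetric]) simp
    finally show ?thesis .
  qed
  have "(\<integral>t. indicator {..<a} t * b t \<partial>time_measure T) = (\<integral>t. indicator {..a} t * b t \<partial>time_measure T)"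
    by (rule time_integral_cong_AE(2)[OF integrable_indicator_time[OF bI]])
      (simp, use AE_time_neq[where c=a] in \<open>eventually_elim, simp add: indicator_def\<close>)
  also have "\<dots> = G a" by (simp add: G_def primitive_def)
  also have "\<dots> = G c" by (simp add: c_def G_def min_def primitive_ge)
  finally have rhs: "(\<integral>t. indicator {..<a} t * b t \<partial>time_measure T) = G c" .
  show ?thesis
  proof (cases "c \<le> 0")
    case True
    then have "(\<integral>t. f t \<partial>time_measure c) = 0" for f :: "real \<Rightarrow> real"
      using integral_restrict_space[of "{0<..<c}" lebesgue f] by simp
    moreover have "G c = 0" unfolding G_def by (rule primitive_nonpos[OF True])
    ultimately show ?thesis unfolding lhs[of "backward_quotient _ _ _"] rhs by simp
  next
    case False
    have "\<forall>\<^sub>F n in sequentially. step_size T n < c"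
      using False by (intro order_tendstoD(2)[OF step_size(3)[OF T]]) simp
    then have "\<forall>\<^sub>F n in sequentially. integral {c - step_size T n..c} G / step_size T n =
        (\<integral>t. indicator {..<a} t * backward_quotient T (step_size T n) b t \<partial>time_measure T)"
    proof eventually_elim
      case (elim n)
      have "(\<integral>t. G t - G (t - step_size T n) \<partial>time_measure c) = integral {c - step_size T n..c} G"
        using elim step_size(1)[OF T]
        by (intro integral_backward_difference(2)[OF continuous_on_subset[OF G]])
          (auto simp: G_def primitive_nonpos)
      then show ?case unfolding lhs by (simp add: backward_quotient_def G_def)
    qed
    then show ?thesis
      unfolding rhs by (rule Lim_transform_eventually[OF average_tendsto[OF G step_size(1)[OF T] step_size(3)[OF T]]])
  qed
qed

text \<open>The common bound \<open>C\<close> controls the effect of replacing one test function by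
  a nearby one uniformly in \<open>n\<close>, so the test functions that work form a closed
  set.\<close>

lemma L2_weak_limit_closed:
  fixes f :: "nat \<Rightarrow> real \<Rightarrow> real"
  assumes f: "\<And>n. f n \<in> L2_space M" "\<And>n. L2_norm M (f n) \<le> C"
    and b: "b \<in> L2_space M" "L2_norm M b \<le> C"
    and \<psi>: "\<And>k. \<psi> k \<in> L2_space M" "\<psi>' \<in> L2_space M" "(\<lambda>k. L2_norm M (\<lambda>x. \<psi> k x - \<psi>' x)) \<longlonglongrightarrow> 0"
    and conv: "\<And>k. (\<lambda>n. L2_inner M (\<psi> k) (f n)) \<longlonglongrightarrow> L2_inner M (\<psi> k) b"
  shows "(\<lambda>n. L2_inner M \<psi>' (f n)) \<longlonglongrightarrow> L2_inner M \<psi>' b"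
proof (rule LIMSEQ_uniform_approx[OF conv])
  have le: "\<bar>L2_inner M (\<psi> k) g - L2_inner M \<psi>' g\<bar> \<le> C * L2_norm M (\<lambda>x. \<psi> k x - \<psi>' x)"
    if g: "g \<in> L2_space M" "L2_norm M g \<le> C" for g k
  proof -
    have "L2_inner M (\<psi> k) g - L2_inner M \<psi>' g = L2_inner M (\<lambda>x. \<psi> k x - \<psi>' x) g"
      using L2_inner_add_scaleR_left[OF \<psi>(1,2) g(1), of k "-1"] by simp
    also have "\<bar>\<dots>\<bar> \<le> L2_norm M (\<lambda>x. \<psi> k x - \<psi>' x) * L2_norm M g"
      by (rule L2_Cauchy_Schwarz[OF L2.diff_mem[OF \<psi>(1,2)] g(1)])
    also have "\<dots> \<le> L2_norm M (\<lambda>x. \<psi> k x - \<psi>' x) * C"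
      by (rule mult_left_mono[OF g(2) L2_norm_nonneg])
    finally show ?thesis by (simp add: mult.commute)
  qed
  show "\<forall>\<^sub>F n in sequentially. \<bar>L2_inner M (\<psi> k) (f n) - L2_inner M \<psi>' (f n)\<bar> \<le> C * L2_norm M (\<lambda>x. \<psi> k x - \<psi>' x)" for k
    using le[OF f] by simp
  show "\<bar>L2_inner M (\<psi> k) b - L2_inner M \<psi>' b\<bar> \<le> C * L2_norm M (\<lambda>x. \<psi> k x - \<psi>' x)" for k
    by (rule le[OF b])
  show "(\<lambda>k. C * L2_norm M (\<lambda>x. \<psi> k x - \<psi>' x)) \<longlonglongrightarrow> 0"
    using tendsto_mult_left[OF \<psi>(3), of C] by simp
qed

lemma indicator_UN_tendsto_L2:
  fixes A :: "nat \<Rightarrow> real set"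
  assumes A: "\<And>i. A i \<in> sets borel"
  shows "(\<lambda>k. L2_norm (time_measure T) (\<lambda>x. indicator (\<Union>i<k. A i) x - indicator (\<Union>i. A i) x :: real)) \<longlonglongrightarrow> 0"
proof -
  let ?M = "time_measure T"
  have meas: "(\<lambda>x. indicator S x :: real) \<in> borel_measurable ?M" if "S \<in> sets borel" for S :: "real set"
    using that by (intro measurable_restrict_space1 measurable_completion) simp
  have "(\<lambda>k. \<integral>x. (indicator (\<Union>i<k. A i) x - indicator (\<Union>i. A i) x :: real)\<^sup>2 \<partial>?M) \<longlonglongrightarrow> (\<integral>x. 0 \<partial>?M)"
  proof (rule integral_dominated_convergence[where w="\<lambda>_. 1"])
    show "integrable ?M (\<lambda>_. 1::real)" by (rule finite_measure.integrable_const[OF finite_time_measure])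
    have UA: "(\<Union>i<k. A i) \<in> sets borel" "(\<Union>i. A i) \<in> sets borel" for k :: nat using A by blast+
    show "(\<lambda>x. (indicator (\<Union>i<k. A i) x - indicator (\<Union>i. A i) x :: real)\<^sup>2) \<in> borel_measurable ?M" for k
      by (intro borel_measurable_power borel_measurable_diff meas UA)
    show "AE x in ?M. (\<lambda>k. (indicator (\<Union>i<k. A i) x - indicator (\<Union>i. A i) x :: real)\<^sup>2) \<longlonglongrightarrow> 0"
    proof (rule AE_I2)
      fix x
      have "\<forall>\<^sub>F k in sequentially. 0 = (indicator (\<Union>i<k. A i) x - indicator (\<Union>i. A i) x :: real)\<^sup>2"
      proof (cases "x \<in> (\<Union>i. A i)")
        case True
        then obtain i where i: "x \<in> A i" by blast
        have "0 = (indicator (\<Union>i<k. A i) x - indicator (\<Union>i. A i) x :: real)\<^sup>2" if "i < k" for k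
        proof -
          have "x \<in> (\<Union>i<k. A i)" using i that by blast
          then show ?thesis using indicator_simps(1)[OF True] indicator_simps(1)[of x "\<Union>i<k. A i"] by simp
        qed
        then show ?thesis by (rule eventually_mono[OF eventually_gt_at_top])
      next
        case False
        then have "x \<notin> (\<Union>i<k. A i)" for k by blast
        then have "indicator (\<Union>i<k. A i) x = (0::real)" for k by (rule indicator_simps(2))
        moreover have "indicator (\<Union>i. A i) x = (0::real)" using False by (rule indicator_simps(2))
        ultimately have "0 = (indicator (\<Union>i<k. A i) x - indicator (\<Union>i. A i) x :: real)\<^sup>2" for k
          by simp
        then show ?thesis by (rule always_eventually[OF allI])
      qed
      then show "(\<lambda>k. (indicator (\<Union>i<k. A i) x - indicator (\<Union>i. A i) x :: real)\<^sup>2) \<longlonglongrightarrow> 0"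
        by (rule Lim_transform_eventually[OF tendsto_const])
    qed
    show "AE x in ?M. norm ((indicator (\<Union>i<k. A i) x - indicator (\<Union>i. A i) x :: real)\<^sup>2) \<le> 1" for k
      by (intro AE_I2) (simp add: indicator_def)
  qed simp
  then have "(\<lambda>k. sqrt (\<integral>x. (indicator (\<Union>i<k. A i) x - indicator (\<Union>i. A i) x :: real)\<^sup>2 \<partial>?M)) \<longlonglongrightarrow> sqrt 0"
    by (intro tendsto_real_sqrt) simp
  then show ?thesis by (simp add: L2_norm_def)
qed

text \<open>It suffices to test with half-lines, since the quotients are bounded in \<open>L\<^sup>2\<close>.\<close>

lemma backward_quotient_weak_limit:
  assumes b: "b \<in> L2_space (time_measure T)" and T: "0 < T" and A: "A \<in> sets (time_measure T)"
  shows "(\<lambda>n. \<integral>t. indicator A t * backward_quotient T (step_size T n) b t \<partial>time_measure T)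
    \<longlonglongrightarrow> (\<integral>t. indicator A t * b t \<partial>time_measure T)"
proof -
  let ?M = "time_measure T"
  define f where "f n = backward_quotient T (step_size T n) b" for n
  have f: "f n \<in> L2_space ?M" "L2_norm ?M (f n) \<le> L2_norm ?M b" for n
    unfolding f_def using backward_quotient_L2[OF b] step_size(1,2)[OF T] by auto
  have I: "integrable ?M (\<lambda>t. indicator A t * g t)"
    if "g \<in> L2_space ?M" "A \<in> sets borel" for g :: "real \<Rightarrow> real" and A
    by (rule integrable_indicator_time[OF L2_space_time_integrable[OF that(1)] that(2)])
  define P where "P A \<longleftrightarrow> (\<lambda>n. \<integral>t. indicator A t * f n t \<partial>?M) \<longlonglongrightarrow> (\<integral>t. indicator A t * b t \<partial>?M)" for A
  have half: "P {..<a}" for a unfolding P_def f_def by (rule backward_quotient_integral_Iio[OF b T])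
  have univ: "P UNIV"
  proof -
    have "(\<integral>t. indicator UNIV t * g t \<partial>?M) = (\<integral>t. indicator {..<T} t * g t \<partial>?M)" for g :: "real \<Rightarrow> real"
      by (intro Bochner_Integration.integral_cong) (auto simp: indicator_def)
    then show ?thesis using half[of T] unfolding P_def by simp
  qed
  have borel: "P A" if A: "A \<in> sets borel" for A
  proof -
    have "Int_stable (range (\<lambda>a::real. {..<a}))" 
    proof (rule Int_stableI_image)
      show "\<exists>k\<in>UNIV. {..<i} \<inter> {..<j} = {..<k}" for i j :: real
        by (rule bexI[of _ "min i j"]) auto
    qed
    moreover have "range (\<lambda>a::real. {..<a}) \<subseteq> Pow UNIV" by simp
    moreover have borel_eq: "sets borel = sigma_sets UNIV (range (\<lambda>a::real. {..<a}))"
      by (subst borel_Iio) simp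
    then have "A \<in> sigma_sets UNIV (range (\<lambda>a::real. {..<a}))" using A by simp
    ultimately show ?thesis
    proof (induction rule: sigma_sets_induct_disjoint)
      case (basic A)
      then show ?case using half by blast
    next
      case empty
      show ?case by (simp add: P_def)
    next
      case (compl A)
      then have A: "A \<in> sets borel" using borel_eq by simp
      have eq: "(\<integral>t. indicator (UNIV - A) t * g t \<partial>?M) =
          (\<integral>t. indicator UNIV t * g t \<partial>?M) - (\<integral>t. indicator A t * g t \<partial>?M)" if "g \<in> L2_space ?M" for g :: "real \<Rightarrow> real"
      proof -
        have "(\<integral>t. indicator (UNIV - A) t * g t \<partial>?M) = (\<integral>t. indicator UNIV t * g t - indicator A t * g t \<partial>?M)"
          by (intro Bochner_Integration.integral_cong refl) (simp add: indicator_def)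
        also have "\<dots> = (\<integral>t. indicator UNIV t * g t \<partial>?M) - (\<integral>t. indicator A t * g t \<partial>?M)"
          by (intro Bochner_Integration.integral_diff I that A) simp
        finally show ?thesis .
      qed
      show ?case
        using tendsto_diff[OF univ[unfolded P_def] compl.IH[unfolded P_def]]
        unfolding P_def eq[OF f(1)] eq[OF b] .
    next
      case (union A)
      then have A: "A i \<in> sets borel" for i using borel_eq by auto
      then have UA: "(\<Union>i<k. A i) \<in> sets borel" "(\<Union>i. A i) \<in> sets borel" for k :: nat by blast+
      have fin: "P (\<Union>i<k. A i)" for k
      proof (induction k)
        case (Suc k)
        have "(\<Union>i<k. A i) \<inter> A k = {}"
          using union(1) unfolding disjoint_family_on_def by (auto simp: set_eq_iff) (metis less_irrefl)
        then have ind: "indicator (\<Union>i<Suc k. A i) t = (indicator (\<Union>i<k. A i) t + indicator (A k) t :: real)" for t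
          by (auto simp: indicator_def lessThan_Suc)
        have eq: "(\<integral>t. indicator (\<Union>i<Suc k. A i) t * g t \<partial>?M) =
            (\<integral>t. indicator (\<Union>i<k. A i) t * g t \<partial>?M) + (\<integral>t. indicator (A k) t * g t \<partial>?M)"
          if "g \<in> L2_space ?M" for g :: "real \<Rightarrow> real"
          unfolding ind distrib_right
          by (intro Bochner_Integration.integral_add I that UA A)
        show ?case
          using tendsto_add[OF Suc[unfolded P_def] union(3)[of k, unfolded P_def]]
          unfolding P_def eq[OF f(1)] eq[OF b] .
      qed (simp add: P_def)
      \<comment> \<open>Additivity reaches finite unions only. The countable union is their limit in
        \<open>L2\<close>, and the uniform bound on \<open>f n\<close> allows passing to it.\<close>
      have "(\<lambda>n. L2_inner ?M (indicator (\<Union>i. A i)) (f n)) \<longlonglongrightarrow> L2_inner ?M (indicator (\<Union>i. A i)) b"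
      proof (rule L2_weak_limit_closed[OF f b order_refl])
        show "(indicator (\<Union>i<k. A i) :: real \<Rightarrow> real) \<in> L2_space ?M" for k :: nat by (rule indicator_mult_L2(2)[OF b UA(1)])
        show "(indicator (\<Union>i. A i) :: real \<Rightarrow> real) \<in> L2_space ?M" by (rule indicator_mult_L2(2)[OF b UA(2)])
        show "(\<lambda>k. L2_norm ?M (\<lambda>x. indicator (\<Union>i<k. A i) x - indicator (\<Union>i. A i) x :: real)) \<longlonglongrightarrow> 0"
          by (rule indicator_UN_tendsto_L2[OF A])
        show "(\<lambda>n. L2_inner ?M (indicator (\<Union>i<k. A i)) (f n)) \<longlonglongrightarrow> L2_inner ?M (indicator (\<Union>i<k. A i)) b" for k
          using fin[of k] unfolding P_def indicator_mult_L2(1)[OF f(1) UA(1)] indicator_mult_L2(1)[OF b UA(1)] .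
      qed
      then show ?case
        unfolding P_def indicator_mult_L2(1)[OF f(1) UA(2)] indicator_mult_L2(1)[OF b UA(2)] .
    qed
  qed
  obtain A' where A': "A' \<in> sets borel" "AE t in ?M. indicator A t = (indicator A' t :: real)"
    using time_set_eq_borel_AE[OF A] by blast
  have eq: "(\<integral>t. indicator A t * g t \<partial>?M) = (\<integral>t. indicator A' t * g t \<partial>?M)" if "g \<in> L2_space ?M" for g :: "real \<Rightarrow> real"
    by (rule time_integral_cong_AE(2)[OF I[OF that A'(1)]]) (use A'(2) in \<open>eventually_elim, simp\<close>)
  show ?thesis
    using borel[OF A'(1)] unfolding P_def f_def[symmetric] eq[OF f(1)] eq[OF b] .
qed


section \<open>Weak time derivatives\<close>

text \<open>The standard smooth transition from 0 on \<open>x \<le> 0\<close> to 1 on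
  \<open>x \<ge> 1\<close>. Differences of steepened translates are smooth substitutes for the
  indicator of an interval.\<close>

definition smooth_step :: "real \<Rightarrow> real" where
  "smooth_step x = flat 1 x * inverse (flat 1 x + flat 1 (1 - x))"

lemma smooth_step_denominator: "flat 1 x + flat 1 (1 - x) > 0"
proof (cases "x > 0")
  case True
  then have "flat 1 x > 0" by (simp add: flat_one)
  then show ?thesis using flat_one_bounds(1)[of "1 - x"] by simp
next
  case False
  then have "flat 1 (1 - x) > 0" by (simp add: flat_one)
  then show ?thesis using flat_one_bounds(1)[of x] by simp
qed

lemma smooth_step_eq: "x \<le> 0 \<Longrightarrow> smooth_step x = 0" "1 \<le> x \<Longrightarrow> smooth_step x = 1"
  using smooth_step_denominator[of x] by (auto simp: smooth_step_def flat_one)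

lemma smooth_step_bounds: "0 \<le> smooth_step x" "smooth_step x \<le> 1"
proof -
  show "0 \<le> smooth_step x"
    using smooth_step_denominator[of x] flat_one_bounds(1)[of x] by (simp add: smooth_step_def)
  show "smooth_step x \<le> 1"
    using smooth_step_denominator[of x] flat_one_bounds(1)[of "1 - x"]
    by (simp add: smooth_step_def divide_inverse[symmetric] pos_divide_le_eq)
qed

lemma C_k_smooth_step: "C_k n (\<lambda>t. smooth_step (\<alpha> * t + c))"
proof -
  have 1: "C_k n (\<lambda>t::real. flat 1 (\<alpha> * t + c))"
    using C_k_flat[of n \<alpha> "1::real" c] by simp
  have "- \<alpha> * (t \<bullet> 1) + (1 - c) = 1 - (\<alpha> * t + c)" for t :: real by simp
  then have 2: "C_k n (\<lambda>t::real. flat 1 (1 - (\<alpha> * t + c)))"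
    using C_k_flat[of n "- \<alpha>" "1::real" "1 - c"] by (simp only:)
  show ?thesis
    unfolding smooth_step_def
    using smooth_step_denominator by (intro C_k_mult 1 C_k_inverse C_k_add 2) (metis less_irrefl)
qed

lemma smooth_step_has_derivative:
  "(smooth_step has_real_derivative deriv smooth_step x) (at x)"
  "continuous_on UNIV (deriv smooth_step)"
  "\<exists>C. \<forall>x. \<bar>deriv smooth_step x\<bar> \<le> C"
  "x \<notin> {0..1} \<Longrightarrow> deriv smooth_step x = 0"
proof -
  have "C_k (Suc 0) smooth_step" using C_k_smooth_step[of "Suc 0" 1 0] by simp
  then have d: "(smooth_step has_derivative frechet_derivative smooth_step (at x)) (at x)" for x
    by (rule C_k_has_derivative)
  then show D: "(smooth_step has_real_derivative deriv smooth_step x) (at x)" for x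
    by (intro DERIV_deriv_iff_real_differentiable[THEN iffD2] differentiableI)
  have "frechet_derivative smooth_step (at x) 1 = deriv smooth_step x" for x
    using fun_cong[OF has_derivative_unique[OF d D[unfolded has_field_derivative_def]], of x 1] by simp
  moreover have "C_k 0 (\<lambda>x. frechet_derivative smooth_step (at x) 1)"
    by (rule C_k_partial[OF \<open>C_k (Suc 0) smooth_step\<close>]) simp
  ultimately show c: "continuous_on UNIV (deriv smooth_step)" by simp
  show 0: "deriv smooth_step x = 0" if "x \<notin> {0..1}" for x
  proof -
    have "(smooth_step has_real_derivative 0) (at x)"
    proof (cases "x < 0")
      case True
      show ?thesis
        by (rule has_field_derivative_transform_within_open[OF DERIV_const[of 0] open_lessThan[of 0]])
          (use True in \<open>simp_all add: smooth_step_eq\<close>)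
    next
      case False
      then have "x > 1" using that by auto
      show ?thesis
        by (rule has_field_derivative_transform_within_open[OF DERIV_const[of 1] open_greaterThan[of 1]])
          (use \<open>x > 1\<close> in \<open>simp_all add: smooth_step_eq\<close>)
    qed
    then show ?thesis by (rule DERIV_imp_deriv)
  qed
  show "\<exists>C. \<forall>x. \<bar>deriv smooth_step x\<bar> \<le> C"
    by (rule compact_support_bounded[OF c compact_Icc 0])
qed

section \<open>Weak derivatives of continuous functions\<close>

lemma eventually_less_real: "\<forall>\<^sub>F k in sequentially. r < real k"
  using filterlim_real_sequentially unfolding filterlim_at_top_dense by blast

lemma smooth_step_delta:
  fixes p :: "real \<Rightarrow> real"
  assumes p: "continuous_on {0..T} p" and c: "0 < c" "c < T"
  shows "(\<lambda>k. \<integral>t. p t * (real k * deriv smooth_step (real k * (t - c))) \<partial>time_measure T) \<longlonglongrightarrow> p c"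
proof (rule tendstoI)
  fix e :: real assume "e > 0"
  define g where "g k t = real k * deriv smooth_step (real k * (t - c))" for k t
  obtain C where C: "\<And>x. \<bar>deriv smooth_step x\<bar> \<le> C"
    using smooth_step_has_derivative(3) by auto
  have "C \<ge> 0" using C[of 0] by simp
  \<comment> \<open>\<open>C\<close> bounds the mass of the kernel, so an oscillation of
    \<open>p\<close> below \<open>e'\<close> costs at most \<open>e' C < e\<close>; the 1 guards
    against \<open>C = 0\<close>.\<close>
  define e' where "e' = e / (C + 1)"
  have e': "e' > 0" "e' * C < e"
  proof -
    show "e' > 0" using \<open>e > 0\<close> \<open>C \<ge> 0\<close> by (simp add: e'_def)
    then have "e' * C < e' * (C + 1)" by (intro mult_strict_left_mono) auto
    then show "e' * C < e" using \<open>C \<ge> 0\<close> by (simp add: e'_def)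
  qed
  have "isCont p c"
    using continuous_on_interior[OF p] c by simp
  then obtain d where d: "d > 0" "\<forall>t. dist t c < d \<longrightarrow> dist (p t) (p c) < e'"
    using e'(1) unfolding continuous_at_eps_delta dist_norm by metis
  have gcont: "continuous_on S (g k)" for S k
  proof -
    have "continuous_on S (\<lambda>t. deriv smooth_step (real k * (t - c)))"
      by (rule continuous_on_compose2[OF smooth_step_has_derivative(2)]) (auto intro!: continuous_intros)
    then show ?thesis unfolding g_def[abs_def] by (intro continuous_on_mult continuous_on_const)
  qed
  have "\<forall>\<^sub>F k in sequentially. max (1 / d) (max (1 / c) (1 / (T - c))) < real k"
    by (rule eventually_less_real)
  then show "\<forall>\<^sub>F k in sequentially. dist (\<integral>t. p t * (real k * deriv smooth_step (real k * (t - c))) \<partial>time_measure T) (p c) < e"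
  proof eventually_elim
    case (elim k)
    \<comment> \<open>\<open>k\<close> is large enough for the window \<open>{c..c + 1 / k}\<close>
      to lie within distance \<open>d\<close> of \<open>c\<close> and before
      \<open>T\<close>.\<close>
    then have k: "1 < real k * d" "1 < real k * c" "1 < real k * (T - c)"
      using d(1) c by (auto simp: pos_divide_less_eq)
    have k0: "0 < real k" using k(2) by (cases "k = 0") auto
    note k = k k0
    have pg: "continuous_on {0..T} (\<lambda>t. p t * g k t)" "continuous_on {0..T} (\<lambda>t. (p t - p c) * g k t)"
      "continuous_on {0..T} (\<lambda>t. p c * g k t)"
      by (intro continuous_on_mult continuous_on_diff continuous_on_const p gcont)+
    have "(g k has_integral (smooth_step (real k * (T - c)) - smooth_step (real k * (0 - c)))) {0..T}"
    proof (rule fundamental_theorem_of_calculus)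
      show "0 \<le> T" using c by simp
      fix t assume "t \<in> {0..T}"
      have "((\<lambda>t. smooth_step (real k * (t - c))) has_real_derivative deriv smooth_step (real k * (t - c)) * real k) (at t)"
        by (rule DERIV_chain2[OF smooth_step_has_derivative(1)]) (auto intro!: derivative_eq_intros)
      then show "((\<lambda>t. smooth_step (real k * (t - c))) has_vector_derivative g k t) (at t within {0..T})"
        unfolding has_real_derivative_iff_has_vector_derivative[symmetric] g_def
        by (simp add: mult.commute has_field_derivative_at_within)
    qed
    moreover have "smooth_step (real k * (T - c)) = 1" using k by (intro smooth_step_eq) simp
    moreover have "smooth_step (real k * (0 - c)) = 0" using k c by (intro smooth_step_eq) (simp add: mult_nonneg_nonpos)
    ultimately have g1: "integral {0..T} (g k) = 1" by (simp add: integral_unique)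
    have "(\<integral>t. p t * g k t \<partial>time_measure T) = integral {0..T} (\<lambda>t. p t * g k t)"
      by (rule time_integral_eq_integral(2)[OF pg(1)])
    also have "\<dots> = integral {0..T} (\<lambda>t. (p t - p c) * g k t + p c * g k t)" by (simp add: algebra_simps)
    also have "\<dots> = integral {0..T} (\<lambda>t. (p t - p c) * g k t) + integral {0..T} (\<lambda>t. p c * g k t)"
      by (intro Henstock_Kurzweil_Integration.integral_add integrable_continuous_real pg)
    also have "integral {0..T} (\<lambda>t. p c * g k t) = p c" using g1 by simp
    finally have eq: "(\<integral>t. p t * g k t \<partial>time_measure T) - p c = integral {0..T} (\<lambda>t. (p t - p c) * g k t)" by simp
    have "norm (integral {0..T} (\<lambda>t. (p t - p c) * g k t)) \<le>
        integral {0..T} (\<lambda>t. if t \<in> {c..c + 1 / real k} then e' * (real k * C) else 0)"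
    proof (rule Henstock_Kurzweil_Integration.integral_norm_bound_integral)
      show "(\<lambda>t. (p t - p c) * g k t) integrable_on {0..T}" by (intro integrable_continuous_real pg)
      have sub: "{c..c + 1 / real k} \<subseteq> {0..T}" using c k by (auto simp: field_simps)
      show "(\<lambda>t. if t \<in> {c..c + 1 / real k} then e' * (real k * C) else 0) integrable_on {0..T}"
        using integrable_restrict_Int[of "{c..c + 1 / real k}" "\<lambda>_. e' * (real k * C)" "{0..T}"] sub
        by (simp add: Int_absorb2 integrable_const_ivl)
      fix t assume t: "t \<in> {0..T}"
      show "norm ((p t - p c) * g k t) \<le> (if t \<in> {c..c + 1 / real k} then e' * (real k * C) else 0)"
      proof (cases "t \<in> {c..c + 1 / real k}")
        case True
        then have "dist t c \<le> 1 / real k" by (auto simp: dist_real_def)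
        also have "\<dots> < d" using k by (simp add: pos_divide_less_eq mult.commute)
        finally have "\<bar>p t - p c\<bar> \<le> e'" using d(2) by (auto simp: dist_real_def intro: less_imp_le)
        moreover have "\<bar>g k t\<bar> \<le> real k * C" unfolding g_def abs_mult using C by (intro mult_mono) auto
        ultimately have "\<bar>p t - p c\<bar> * \<bar>g k t\<bar> \<le> e' * (real k * C)"
          using e'(1) by (intro mult_mono) auto
        then show ?thesis using True by (simp add: abs_mult)
      next
        case False
        then have "real k * (t - c) \<notin> {0..1}"
          using k(4) by (auto simp: zero_le_mult_iff field_simps)
        then have "g k t = 0" unfolding g_def by (simp add: smooth_step_has_derivative(4))
        then show ?thesis using False by (simp only: if_False mult_zero_right norm_zero order_refl)
      qed
    qed
    also have "\<dots> = e' * C"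
    proof -
      have sub: "{c..c + 1 / real k} \<subseteq> {0..T}" using c k by (auto simp: field_simps)
      have "integral {0..T} (\<lambda>t. if t \<in> {c..c + 1 / real k} then e' * (real k * C) else 0) =
          integral {c..c + 1 / real k} (\<lambda>_. e' * (real k * C))"
        using sub by (simp only: Henstock_Kurzweil_Integration.integral_restrict_Int Int_absorb2 Int_absorb1)
      also have "\<dots> = e' * C" using k(4) by simp
      finally show ?thesis .
    qed
    finally show ?case using eq e'(2) unfolding g_def by (simp add: dist_real_def)
  qed
qed

text \<open>Smoothed indicators of \<open>{c<..d}\<close> serve as test functions. Their derivatives
  act in the limit as evaluation at \<open>c\<close> minus evaluation at \<open>d\<close>, which
  turns the weak identity into the fundamental theorem of calculus.\<close>

lemma continuous_weak_derivative_diff: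
  assumes b: "integrable (time_measure T) b" and p: "continuous_on {0..T} p"
    and weak: "\<And>\<phi>. test_function {0<..<T} \<phi> \<Longrightarrow>
      (\<integral>t. b t * \<phi> t \<partial>time_measure T) = - (\<integral>t. p t * deriv \<phi> t \<partial>time_measure T)"
    and cd: "0 < c" "c < d" "d < T"
  shows "p d - p c = primitive T b d - primitive T b c"
proof -
  let ?M = "time_measure T"
  define \<phi> where "\<phi> k t = smooth_step (real k * (t - c)) - smooth_step (real k * (t - d))" for k t
  define \<phi>' where "\<phi>' k t = real k * deriv smooth_step (real k * (t - c)) - real k * deriv smooth_step (real k * (t - d))" for k t
  have D: "(\<phi> k has_real_derivative \<phi>' k t) (at t)" for k t
  proof -
    have "((\<lambda>t. smooth_step (real k * (t - a))) has_real_derivative deriv smooth_step (real k * (t - a)) * real k) (at t)" for a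
      by (rule DERIV_chain2[OF smooth_step_has_derivative(1)]) (auto intro!: derivative_eq_intros)
    from DERIV_diff[OF this[of c] this[of d]] show ?thesis
      unfolding \<phi>_def[abs_def] \<phi>'_def by (simp add: mult.commute)
  qed
  have smooth: "C_k j (\<phi> k)" for j k
  proof -
    have eq: "real k * (t - a) = real k * t + - (real k * a)" for t a by (simp add: algebra_simps)
    show ?thesis
      unfolding \<phi>_def[abs_def] eq by (intro C_k_diff C_k_smooth_step)
  qed
  have "\<forall>\<^sub>F k in sequentially. 1 / (T - d) < real k" by (rule eventually_less_real)
  then have eq: "\<forall>\<^sub>F k in sequentially. - (\<integral>t. b t * \<phi> k t \<partial>?M) = (\<integral>t. p t * \<phi>' k t \<partial>?M)"
  proof eventually_elim
    case (elim k)
    then have "1 < real k * (T - d)" using cd by (simp add: pos_divide_less_eq)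
    moreover from this have k0: "0 < real k" by (cases "k = 0") auto
    ultimately have "1 / real k < T - d" by (simp add: pos_divide_less_eq mult.commute)
    with k0 have k: "0 < real k" "d + 1 / real k < T" by auto
    \<comment> \<open>The smoothed indicator reaches beyond \<open>d\<close> by
      \<open>1 / k\<close>; only for large \<open>k\<close> does its support stay inside the open
      time interval.\<close>
    have zero: "\<phi> k t = 0" if "t \<notin> {c..d + 1 / real k}" for t
    proof (cases "t < c")
      case True
      then have "real k * (t - c) \<le> 0" "real k * (t - d) \<le> 0" using k cd by (auto simp: mult_le_0_iff)
      then show ?thesis by (simp add: \<phi>_def smooth_step_eq)
    next
      case False
      then have "d + 1 / real k < t" using that by simp
      then have "1 \<le> real k * (t - d)" using k by (simp add: field_simps)
      moreover have "real k * (t - d) \<le> real k * (t - c)" using k cd by (intro mult_left_mono) auto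
      ultimately show ?thesis by (simp add: \<phi>_def smooth_step_eq)
    qed
    have "test_function {0<..<T} (\<phi> k)"
      unfolding test_function_def
      by (intro conjI allI smooth exI[of _ "{c..d + 1 / real k}"] compact_Icc impI zero)
        (use cd k in auto)
    from weak[OF this] have "(\<integral>t. b t * \<phi> k t \<partial>?M) = - (\<integral>t. p t * deriv (\<phi> k) t \<partial>?M)" .
    moreover have "deriv (\<phi> k) = \<phi>' k" using D by (intro ext DERIV_imp_deriv)
    ultimately show ?case by simp
  qed
  have lim_b: "(\<lambda>k. \<integral>t. b t * \<phi> k t \<partial>?M) \<longlonglongrightarrow> (\<integral>t. indicator {c<..d} t * b t \<partial>?M)"
  proof (rule integral_dominated_convergence[where w="\<lambda>t. \<bar>b t\<bar>"])
    show "integrable ?M (\<lambda>t. \<bar>b t\<bar>)" using b by simp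
    show "(\<lambda>t. indicator {c<..d} t * b t) \<in> borel_measurable ?M"
      by (rule borel_measurable_integrable[OF integrable_indicator_time[OF b]]) simp
    have "continuous_on UNIV (\<phi> k)" for k using smooth[of 0 k] by simp
    then have "\<phi> k \<in> borel_measurable ?M" for k
      by (intro continuous_imp_measurable_on_sets_lebesgue[OF continuous_on_subset]) auto
    then show "(\<lambda>t. b t * \<phi> k t) \<in> borel_measurable ?M" for k
      by (intro borel_measurable_times borel_measurable_integrable[OF b])
    have lim1: "(\<lambda>k. smooth_step (real k * s)) \<longlonglongrightarrow> (if s \<le> 0 then 0 else 1)" for s
    proof (cases "s \<le> 0")
      case True
      then have "smooth_step (real k * s) = 0" for k by (intro smooth_step_eq) (simp add: mult_nonneg_nonpos)
      then show ?thesis using True by simp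
    next
      case False
      have "\<forall>\<^sub>F k in sequentially. 1 / s < real k" by (rule eventually_less_real)
      then have "\<forall>\<^sub>F k in sequentially. 1 = smooth_step (real k * s)"
      proof eventually_elim
        case (elim k)
        then have "1 \<le> real k * s" using False by (simp add: field_simps)
        then show ?case by (simp add: smooth_step_eq)
      qed
      then show ?thesis using False by (simp add: Lim_transform_eventually[OF tendsto_const])
    qed
    show "AE t in ?M. (\<lambda>k. b t * \<phi> k t) \<longlonglongrightarrow> indicator {c<..d} t * b t"
    proof (rule AE_I2)
      fix t
      have "(\<lambda>k. \<phi> k t) \<longlonglongrightarrow> (if t - c \<le> 0 then 0 else 1) - (if t - d \<le> 0 then 0 else 1)"
        unfolding \<phi>_def by (intro tendsto_diff lim1)
      also have "(if t - c \<le> 0 then 0 else 1) - (if t - d \<le> 0 then 0 else 1) = (indicator {c<..d} t :: real)"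
        using cd by (simp add: indicator_def)
      finally show "(\<lambda>k. b t * \<phi> k t) \<longlonglongrightarrow> indicator {c<..d} t * b t"
        by (subst mult.commute) (rule tendsto_mult_left)
    qed
    show "AE t in ?M. norm (b t * \<phi> k t) \<le> \<bar>b t\<bar>" for k
    proof (rule AE_I2)
      fix t
      have "\<bar>\<phi> k t\<bar> \<le> 1"
        using smooth_step_bounds[of "real k * (t - c)"] smooth_step_bounds[of "real k * (t - d)"]
        by (simp add: \<phi>_def)
      then show "norm (b t * \<phi> k t) \<le> \<bar>b t\<bar>" using mult_left_mono[of "\<bar>\<phi> k t\<bar>" 1 "\<bar>b t\<bar>"] by (simp add: abs_mult)
    qed
  qed
  have "(\<lambda>k. \<integral>t. p t * \<phi>' k t \<partial>?M) \<longlonglongrightarrow> p c - p d"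
  proof -
    have cont: "continuous_on {0..T} (\<lambda>t. p t * (real k * deriv smooth_step (real k * (t - a))))" for k a
    proof -
      have "continuous_on {0..T} (\<lambda>t. deriv smooth_step (real k * (t - a)))"
        by (rule continuous_on_compose2[OF smooth_step_has_derivative(2)]) (auto intro!: continuous_intros)
      then show ?thesis by (intro continuous_on_mult continuous_on_const p)
    qed
    have "(\<integral>t. p t * \<phi>' k t \<partial>?M) =
        (\<integral>t. p t * (real k * deriv smooth_step (real k * (t - c))) \<partial>?M) -
        (\<integral>t. p t * (real k * deriv smooth_step (real k * (t - d))) \<partial>?M)" for k
      unfolding \<phi>'_def right_diff_distrib[of "p _"]
      by (intro Bochner_Integration.integral_diff time_integral_eq_integral(1)[OF cont])
    then show ?thesis
      using cd tendsto_diff[OF smooth_step_delta[OF p, of c] smooth_step_delta[OF p, of d]] by (simp only:)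
  qed
  then have "(\<lambda>k. - (\<integral>t. b t * \<phi> k t \<partial>?M)) \<longlonglongrightarrow> p c - p d"
    by (rule Lim_transform_eventually) (use eq in eventually_elim, simp)
  from LIMSEQ_unique[OF this tendsto_minus[OF lim_b]] show ?thesis
    using primitive_diff[OF b, of c d] cd by simp
qed

text \<open>The difference of the two functions is constant in the open interval and, by continuity,
  up to the end points, where its value at 0 is 0. The identity is thus obtained at every time
  rather than almost everywhere.\<close>

lemma continuous_weak_derivative_primitive:
  assumes T: "0 < T" and b: "integrable (time_measure T) b" and p: "continuous_on {0..T} p" "p 0 = 0"
    and weak: "\<And>\<phi>. test_function {0<..<T} \<phi> \<Longrightarrow>
      (\<integral>t. b t * \<phi> t \<partial>time_measure T) = - (\<integral>t. p t * deriv \<phi> t \<partial>time_measure T)"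
    and t: "t \<in> {0..T}"
  shows "p t = primitive T b t"
proof -
  define r where "r t = p t - primitive T b t" for t
  have r: "continuous_on {0..T} r"
    unfolding r_def[abs_def]
    by (intro continuous_on_diff p continuous_on_subset[OF continuous_on_primitive[OF b] subset_UNIV])
  have eq: "r c = r d" if "c \<in> {0<..<T}" "d \<in> {0<..<T}" "c < d" for c d
    using continuous_weak_derivative_diff[OF b p(1) weak, of c d] that by (simp add: r_def)
  have const: "r s = r (T / 2)" if "s \<in> {0<..<T}" for s
  proof (cases s "T / 2" rule: linorder_cases)
    case less
    then show ?thesis using eq[of s "T / 2"] that T by simp
  next
    case greater
    then show ?thesis using eq[of "T / 2" s] that T by simp
  qed (simp only:)
  have all: "r s = r (T / 2)" if "s \<in> {0..T}" for s
  proof (rule continuous_constant_on_closure[of "{0<..<T}" r "r (T / 2)"])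
    show "continuous_on (closure {0<..<T}) r" using r T by simp
    show "s \<in> closure {0<..<T}" using that T by simp
  qed (rule const)
  have "r t = r 0" using all[OF t] all[of 0] T by simp
  also have "r 0 = 0" using p(2) by (simp add: r_def primitive_nonpos)
  finally show ?thesis by (simp add: r_def)
qed


section \<open>The energy inequality\<close>

text \<open>\<open>B t\<close> plays the part of the time derivative at \<open>t\<close> as a
  functional on \<open>X\<close>, and \<open>m t\<close> bounds its dual norm. Measurability is
  asked for fixed \<open>v\<close> only, whereas linearity and the bound hold off one null set
  common to all \<open>v\<close>.\<close>

locale form_family = seminormed_functions X N
  for X :: "('c \<Rightarrow> real) set" and N :: "('c \<Rightarrow> real) \<Rightarrow> real" +
  fixes T :: real and B :: "real \<Rightarrow> ('c \<Rightarrow> real) \<Rightarrow> real" and m :: "real \<Rightarrow> real"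
  assumes B_measurable: "v \<in> X \<Longrightarrow> (\<lambda>t. B t v) \<in> borel_measurable (time_measure T)"
    and B_linear: "AE t in time_measure T. \<forall>u\<in>X. \<forall>v\<in>X. \<forall>c. B t (\<lambda>x. u x + c * v x) = B t u + c * B t v"
    and B_bound: "AE t in time_measure T. \<forall>v\<in>X. \<bar>B t v\<bar> \<le> m t * N v"
    and m_L2: "m \<in> L2_space (time_measure T)"
begin

lemma B_diff: "AE t in time_measure T. \<forall>u\<in>X. \<forall>v\<in>X. B t (\<lambda>x. u x - v x) = B t u - B t v"
  using B_linear
proof eventually_elim
  case (elim t)
  show ?case
  proof (intro ballI)
    fix u v assume "u \<in> X" "v \<in> X"
    then have "B t (\<lambda>x. u x + (-1) * v x) = B t u + (-1) * B t v" using elim by blast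
    then show "B t (\<lambda>x. u x - v x) = B t u - B t v" by simp
  qed
qed

section \<open>Pairing a family of functionals with functions of time\<close>

lemma B_L2:
  assumes v: "v \<in> X"
  shows "(\<lambda>t. B t v) \<in> L2_space (time_measure T)"
proof -
  have "integrable (time_measure T) (\<lambda>t. (norm (B t v))\<^sup>2)"
  proof (rule Bochner_Integration.integrable_bound)
    show "integrable (time_measure T) (\<lambda>t. (norm (m t))\<^sup>2 * (N v)\<^sup>2)"
      using L2_spaceD(2)[OF m_L2] by (rule integrable_mult_left)
    show "(\<lambda>t. (norm (B t v))\<^sup>2) \<in> borel_measurable (time_measure T)"
      using B_measurable[OF v] by measurable
    show "AE t in time_measure T. norm ((norm (B t v))\<^sup>2) \<le> norm ((norm (m t))\<^sup>2 * (N v)\<^sup>2)"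
      using B_bound
    proof eventually_elim
      case (elim t)
      then have "\<bar>B t v\<bar> \<le> m t * N v" using v by blast
      then have "\<bar>B t v\<bar>\<^sup>2 \<le> (m t * N v)\<^sup>2" by (rule power_mono) simp
      then show ?case by (simp add: power_mult_distrib)
    qed
  qed
  then show ?thesis using B_measurable[OF v] by (simp add: L2_space_def)
qed

text \<open>On each level set of \<open>s\<close> the argument is frozen, so the pairing splits into
  finitely many scalar problems with fixed \<open>v\<close>.\<close>

lemma B_simple:
  assumes s: "simple_function (time_measure T) s" and sX: "\<And>t. t \<in> {0<..<T} \<Longrightarrow> s t \<in> X"
  shows "(\<lambda>t. B t (s t)) \<in> borel_measurable (time_measure T)"
    and "(\<integral>t. B t (s t) \<partial>time_measure T) =
      (\<Sum>v\<in>s ` {0<..<T}. \<integral>t. indicator (s -` {v} \<inter> {0<..<T}) t * B t v \<partial>time_measure T)"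
proof -
  let ?M = "time_measure T" and ?S = "s ` {0<..<T}"
  have fin: "finite ?S" using s by (simp add: simple_function_def)
  have A: "s -` {v} \<inter> {0<..<T} \<in> sets ?M" if "v \<in> ?S" for v
    using s that by (auto simp: simple_function_def)
  have eq: "B t (s t) = (\<Sum>v\<in>?S. indicator (s -` {v} \<inter> {0<..<T}) t * B t v)" if "t \<in> space ?M" for t
  proof -
    have t: "t \<in> {0<..<T}" using that by simp
    have "(\<Sum>v\<in>?S. indicator (s -` {v} \<inter> {0<..<T}) t * B t v) = (\<Sum>v\<in>?S. if v = s t then B t v else 0)"
      using t by (intro sum.cong) (auto simp: indicator_def)
    also have "\<dots> = B t (s t)" using fin t by (simp add: sum.delta)
    finally show ?thesis by simp
  qed
  have I: "integrable ?M (\<lambda>t. indicator (s -` {v} \<inter> {0<..<T}) t * B t v)" if "v \<in> ?S" for v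
  proof -
    have "v \<in> X" using that sX by blast
    from integrable_real_mult_indicator[OF A[OF that] L2_space_time_integrable[OF B_L2[OF this]]]
    show ?thesis by (simp add: mult.commute)
  qed
  have "(\<lambda>t. \<Sum>v\<in>?S. indicator (s -` {v} \<inter> {0<..<T}) t * B t v) \<in> borel_measurable ?M"
    by (rule borel_measurable_sum[OF borel_measurable_integrable[OF I]])
  then show "(\<lambda>t. B t (s t)) \<in> borel_measurable ?M"
    by (subst measurable_cong[OF eq]) 
  have "(\<integral>t. B t (s t) \<partial>?M) = (\<integral>t. (\<Sum>v\<in>?S. indicator (s -` {v} \<inter> {0<..<T}) t * B t v) \<partial>?M)"
    by (rule Bochner_Integration.integral_cong[OF refl eq])
  also have "\<dots> = (\<Sum>v\<in>?S. \<integral>t. indicator (s -` {v} \<inter> {0<..<T}) t * B t v \<partial>?M)"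
    by (rule Bochner_Integration.integral_sum[OF I])
  finally show "(\<integral>t. B t (s t) \<partial>?M) = (\<Sum>v\<in>?S. \<integral>t. indicator (s -` {v} \<inter> {0<..<T}) t * B t v \<partial>?M)" .
qed

lemma B_bochner_measurable:
  assumes u: "u \<in> bochner_L2 T X N"
  shows "(\<lambda>t. B t (u t)) \<in> borel_measurable (time_measure T)"
proof -
  obtain s where s: "\<forall>k. simple_function (time_measure T) (s k)" "\<forall>k. \<forall>t\<in>{0<..<T}. s k t \<in> X"
    and lim: "AE t in time_measure T. (\<lambda>k. N (\<lambda>x. s k t x - u t x)) \<longlonglongrightarrow> 0"
    using bochner_L2_simple_approx[OF u] by blast
  show ?thesis
  proof (rule borel_measurable_LIMSEQ_time)
    show "(\<lambda>t. B t (s k t)) \<in> borel_measurable (time_measure T)" for k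
      by (rule B_simple(1)) (use s in blast)+
    show "AE t in time_measure T. (\<lambda>k. B t (s k t)) \<longlonglongrightarrow> B t (u t)"
      using lim B_diff B_bound bochner_L2D(1)[OF u] AE_space[of "time_measure T"]
    proof eventually_elim
      case (elim t)
      have st: "s k t \<in> X" for k using s(2) elim(5) by simp
      have "(\<lambda>k. B t (s k t) - B t (u t)) \<longlonglongrightarrow> 0"
      proof (rule Lim_null_comparison)
        have "\<bar>B t (s k t) - B t (u t)\<bar> \<le> m t * N (\<lambda>x. s k t x - u t x)" for k
        proof -
          have "B t (s k t) - B t (u t) = B t (\<lambda>x. s k t x - u t x)" using elim(2,4) st by simp
          then show ?thesis using elim(3) diff_mem[OF st elim(4)] by simp
        qed
        then show "\<forall>\<^sub>F k in sequentially. norm (B t (s k t) - B t (u t)) \<le> m t * N (\<lambda>x. s k t x - u t x)" by simp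
        show "(\<lambda>k. m t * N (\<lambda>x. s k t x - u t x)) \<longlonglongrightarrow> 0"
          using tendsto_mult_left[OF elim(1), of "m t"] by simp
      qed
      then show ?case by (rule LIM_zero_cancel)
    qed
  qed
qed

lemma B_bochner_integrable:
  assumes u: "u \<in> bochner_L2 T X N"
  shows "integrable (time_measure T) (\<lambda>t. B t (u t))"
    and "\<bar>\<integral>t. B t (u t) \<partial>time_measure T\<bar> \<le> L2_norm (time_measure T) m * L2_norm (time_measure T) (\<lambda>t. N (u t))"
proof -
  have mN: "integrable (time_measure T) (\<lambda>t. m t * N (u t))"
    using L2_integrable_inner[OF m_L2 bochner_L2D(5)[OF u]] by simp
  have le: "AE t in time_measure T. \<bar>B t (u t)\<bar> \<le> m t * N (u t)"
    using B_bound bochner_L2D(1)[OF u] by eventually_elim blast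
  show I: "integrable (time_measure T) (\<lambda>t. B t (u t))"
  proof (rule Bochner_Integration.integrable_bound[OF mN B_bochner_measurable[OF u]])
    show "AE t in time_measure T. norm (B t (u t)) \<le> norm (m t * N (u t))"
      using le by eventually_elim (simp only: real_norm_def order_trans[OF _ abs_ge_self])
  qed
  have "\<bar>\<integral>t. B t (u t) \<partial>time_measure T\<bar> \<le> (\<integral>t. \<bar>B t (u t)\<bar> \<partial>time_measure T)"
    by (rule integral_abs_bound)
  also have "\<dots> \<le> (\<integral>t. m t * N (u t) \<partial>time_measure T)"
    using I by (intro integral_mono_AE mN le) simp
  also have "\<dots> = L2_inner (time_measure T) m (\<lambda>t. N (u t))" by (simp add: L2_inner_def)
  also have "\<dots> \<le> L2_norm (time_measure T) m * L2_norm (time_measure T) (\<lambda>t. N (u t))"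
    using L2_Cauchy_Schwarz[OF m_L2 bochner_L2D(5)[OF u]] by simp
  finally show "\<bar>\<integral>t. B t (u t) \<partial>time_measure T\<bar> \<le> L2_norm (time_measure T) m * L2_norm (time_measure T) (\<lambda>t. N (u t))" .
qed

text \<open>The constant depends on the family only through the \<open>L2\<close> norm of
  \<open>m\<close>, so the estimate is uniform over all families with a common bound on that
  norm.\<close>

lemma B_bochner_diff_le:
  assumes u: "u \<in> bochner_L2 T X N" and w: "w \<in> bochner_L2 T X N"
  shows "\<bar>(\<integral>t. B t (u t) \<partial>time_measure T) - (\<integral>t. B t (w t) \<partial>time_measure T)\<bar>
    \<le> L2_norm (time_measure T) m * L2_norm (time_measure T) (\<lambda>t. N (\<lambda>x. u t x - w t x))"
proof -
  note I = B_bochner_integrable(1)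
  have "(\<integral>t. B t (u t) \<partial>time_measure T) - (\<integral>t. B t (w t) \<partial>time_measure T) =
      (\<integral>t. B t (u t) - B t (w t) \<partial>time_measure T)"
    using I[OF u] I[OF w] by simp
  also have "\<dots> = (\<integral>t. B t (\<lambda>x. u t x - w t x) \<partial>time_measure T)"
    by (rule time_integral_cong_AE(2)[OF I[OF bochner_L2_diff[OF u w]]])
      (use B_diff bochner_L2D(1)[OF u] bochner_L2D(1)[OF w] in \<open>eventually_elim, simp\<close>)
  finally show ?thesis using B_bochner_integrable(2)[OF bochner_L2_diff[OF u w]] by simp
qed

text \<open>Averaging in \<open>s\<close> absorbs the exceptional null set, so linearity and the
  bound hold at every \<open>t\<close>; the average of \<open>m\<close> dominates the averaged
  functional.\<close>

lemma form_family_backward_quotient: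
  assumes h: "0 < h" "h < T"
  shows "form_family X N T (\<lambda>t v. backward_quotient T h (\<lambda>s. B s v) t) (backward_quotient T h m)"
proof
  note I = L2_space_time_integrable[OF B_L2]
  fix v assume "v \<in> X"
  then show "(\<lambda>t. backward_quotient T h (\<lambda>s. B s v) t) \<in> borel_measurable (time_measure T)"
    by (intro continuous_imp_measurable_on_sets_lebesgue[OF backward_quotient_continuous] I) auto
next
  note I = L2_space_time_integrable[OF B_L2]
  have lin: "primitive T (\<lambda>s. B s (\<lambda>x. u x + c * v x)) t = primitive T (\<lambda>s. B s u) t + c * primitive T (\<lambda>s. B s v) t"
    if uv: "u \<in> X" "v \<in> X" for u v c t
  proof -
    note i = integrable_indicator_time[OF I[OF uv(1)], of "{..t}"] integrable_indicator_time[OF I[OF uv(2)], of "{..t}"]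
    have "primitive T (\<lambda>s. B s (\<lambda>x. u x + c * v x)) t =
        (\<integral>s. indicator {..t} s * B s u + c * (indicator {..t} s * B s v) \<partial>time_measure T)"
      unfolding primitive_def
    proof (rule time_integral_cong_AE(2))
      show "AE s in time_measure T. indicator {..t} s * B s u + c * (indicator {..t} s * B s v) =
          indicator {..t} s * B s (\<lambda>x. u x + c * v x)"
        using B_linear
      proof eventually_elim
        case (elim s)
        then have "B s (\<lambda>x. u x + c * v x) = B s u + c * B s v" using uv by blast
        then show ?case by (simp add: algebra_simps)
      qed
    qed (use i in simp)
    also have "\<dots> = primitive T (\<lambda>s. B s u) t + c * primitive T (\<lambda>s. B s v) t"
      unfolding primitive_def using i by simp
    finally show ?thesis .
  qed
  show "AE t in time_measure T. \<forall>u\<in>X. \<forall>v\<in>X. \<forall>c. backward_quotient T h (\<lambda>s. B s (\<lambda>x. u x + c * v x)) t =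
      backward_quotient T h (\<lambda>s. B s u) t + c * backward_quotient T h (\<lambda>s. B s v) t"
  proof (intro AE_I2 ballI allI)
    fix t u v c assume "u \<in> X" "v \<in> X"
    then show "backward_quotient T h (\<lambda>s. B s (\<lambda>x. u x + c * v x)) t =
        backward_quotient T h (\<lambda>s. B s u) t + c * backward_quotient T h (\<lambda>s. B s v) t"
      using h by (simp add: backward_quotient_def lin field_simps)
  qed
  show "AE t in time_measure T. \<forall>v\<in>X. \<bar>backward_quotient T h (\<lambda>s. B s v) t\<bar> \<le> backward_quotient T h m t * N v"
  proof (intro AE_I2 ballI)
    fix t v assume v: "v \<in> X"
    let ?i = "indicator {t - h<..t} :: real \<Rightarrow> real"
    note mI = L2_space_time_integrable[OF m_L2]
    note i = integrable_indicator_time[OF I[OF v], of "{t - h<..t}"] integrable_indicator_time[OF mI, of "{t - h<..t}"]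
    have "\<bar>primitive T (\<lambda>s. B s v) t - primitive T (\<lambda>s. B s v) (t - h)\<bar> =
        \<bar>\<integral>s. ?i s * B s v \<partial>time_measure T\<bar>"
      using primitive_diff[OF I[OF v], of "t - h" t] h by simp
    also have "\<dots> \<le> (\<integral>s. \<bar>?i s * B s v\<bar> \<partial>time_measure T)" by (rule integral_abs_bound)
    also have "\<dots> \<le> (\<integral>s. N v * (?i s * m s) \<partial>time_measure T)"
    proof (rule integral_mono_AE)
      show "AE s in time_measure T. \<bar>?i s * B s v\<bar> \<le> N v * (?i s * m s)"
        using B_bound
      proof eventually_elim
        case (elim s)
        then have "\<bar>B s v\<bar> \<le> m s * N v" using v by blast
        then show ?case by (simp add: indicator_def mult.commute)
      qed
    qed (use i in simp_all)
    also have "\<dots> = N v * (primitive T m t - primitive T m (t - h))"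
      using primitive_diff[OF mI, of "t - h" t] h by simp
    finally show "\<bar>backward_quotient T h (\<lambda>s. B s v) t\<bar> \<le> backward_quotient T h m t * N v"
      using h by (simp add: backward_quotient_def abs_divide divide_right_mono mult.commute)
  qed
  show "backward_quotient T h m \<in> L2_space (time_measure T)"
    by (rule backward_quotient_L2(1)[OF m_L2 h])
qed

text \<open>The argument \<open>w t\<close> stays frozen while the average runs over
  \<open>s\<close>. For simple functions the claim is a finite sum of scalar weak limits; density
  does the rest, since averaging does not increase the norm of \<open>m\<close> and the error is
  uniform in the step.\<close>

lemma backward_quotient_form_tendsto:
  assumes T: "0 < T" and w: "w \<in> bochner_L2 T X N"
  shows "(\<lambda>n. \<integral>t. backward_quotient T (step_size T n) (\<lambda>s. B s (w t)) t \<partial>time_measure T)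
    \<longlonglongrightarrow> (\<integral>t. B t (w t) \<partial>time_measure T)"
proof -
  let ?M = "time_measure T"
  have fam: "form_family X N T (\<lambda>t v. backward_quotient T (step_size T n) (\<lambda>s. B s v) t)
      (backward_quotient T (step_size T n) m)" for n
    by (rule form_family_backward_quotient[OF step_size(1,2)[OF T]])
  obtain \<sigma> where \<sigma>: "\<forall>k. simple_function ?M (\<sigma> k)" "\<forall>k. \<forall>t\<in>{0<..<T}. \<sigma> k t \<in> X" "\<forall>k. \<sigma> k \<in> bochner_L2 T X N"
    and lim: "(\<lambda>k. \<integral>t. (N (\<lambda>x. \<sigma> k t x - w t x))\<^sup>2 \<partial>?M) \<longlonglongrightarrow> 0"
    using bochner_L2_simple_approx[OF w] by blast
  define e where "e k = L2_norm ?M (\<lambda>t. N (\<lambda>x. \<sigma> k t x - w t x))" for k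
  have e: "e \<longlonglongrightarrow> 0"
    using tendsto_real_sqrt[OF lim] unfolding e_def[abs_def] L2_norm_def by simp
  show ?thesis
  proof (rule LIMSEQ_uniform_approx)
    show "(\<lambda>n. \<integral>t. backward_quotient T (step_size T n) (\<lambda>s. B s (\<sigma> k t)) t \<partial>?M) \<longlonglongrightarrow> (\<integral>t. B t (\<sigma> k t) \<partial>?M)" for k
    proof -
      have s: "simple_function ?M (\<sigma> k)" and sX: "\<And>t. t \<in> {0<..<T} \<Longrightarrow> \<sigma> k t \<in> X"
        using \<sigma> by blast+
      have A: "\<sigma> k -` {v} \<inter> {0<..<T} \<in> sets ?M" if "v \<in> \<sigma> k ` {0<..<T}" for v
        using s that by (auto simp: simple_function_def)
      have "(\<lambda>n. \<Sum>v\<in>\<sigma> k ` {0<..<T}. \<integral>t. indicator (\<sigma> k -` {v} \<inter> {0<..<T}) t *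
            backward_quotient T (step_size T n) (\<lambda>s. B s v) t \<partial>?M) \<longlonglongrightarrow>
          (\<Sum>v\<in>\<sigma> k ` {0<..<T}. \<integral>t. indicator (\<sigma> k -` {v} \<inter> {0<..<T}) t * B t v \<partial>?M)"
      proof (rule tendsto_sum)
        fix v assume v: "v \<in> \<sigma> k ` {0<..<T}"
        then have "v \<in> X" using sX by blast
        then show "(\<lambda>n. \<integral>t. indicator (\<sigma> k -` {v} \<inter> {0<..<T}) t *
              backward_quotient T (step_size T n) (\<lambda>s. B s v) t \<partial>?M) \<longlonglongrightarrow>
            (\<integral>t. indicator (\<sigma> k -` {v} \<inter> {0<..<T}) t * B t v \<partial>?M)"
          by (intro backward_quotient_weak_limit[OF B_L2 T A[OF v]])
      qed
      then show ?thesis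
        by (simp only: B_simple(2)[OF s sX] form_family.B_simple(2)[OF fam s sX])
    qed
    have "\<bar>(\<integral>t. backward_quotient T (step_size T n) (\<lambda>s. B s (\<sigma> k t)) t \<partial>?M) -
        (\<integral>t. backward_quotient T (step_size T n) (\<lambda>s. B s (w t)) t \<partial>?M)\<bar> \<le> L2_norm ?M m * e k" for n k
    proof -
      have "\<bar>(\<integral>t. backward_quotient T (step_size T n) (\<lambda>s. B s (\<sigma> k t)) t \<partial>?M) -
          (\<integral>t. backward_quotient T (step_size T n) (\<lambda>s. B s (w t)) t \<partial>?M)\<bar>
          \<le> L2_norm ?M (backward_quotient T (step_size T n) m) * e k"
        using form_family.B_bochner_diff_le[OF fam \<sigma>(3)[rule_format] w] unfolding e_def .
      also have "\<dots> \<le> L2_norm ?M m * e k"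
        by (rule mult_right_mono[OF backward_quotient_L2(2)[OF m_L2 step_size(1,2)[OF T]]]) (simp add: e_def L2_norm_nonneg)
      finally show ?thesis .
    qed
    then show "\<forall>\<^sub>F n in sequentially. \<bar>(\<integral>t. backward_quotient T (step_size T n) (\<lambda>s. B s (\<sigma> k t)) t \<partial>?M) -
        (\<integral>t. backward_quotient T (step_size T n) (\<lambda>s. B s (w t)) t \<partial>?M)\<bar> \<le> L2_norm ?M m * e k" for k
      by simp
    show "\<bar>(\<integral>t. B t (\<sigma> k t) \<partial>?M) - (\<integral>t. B t (w t) \<partial>?M)\<bar> \<le> L2_norm ?M m * e k" for k
      using B_bochner_diff_le[OF \<sigma>(3)[rule_format] w] unfolding e_def .
    show "(\<lambda>k. L2_norm ?M m * e k) \<longlonglongrightarrow> 0"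
      using tendsto_mult_left[OF e, of "L2_norm ?M m"] by simp
  qed
qed

text \<open>Since \<open>2 (a - b, a) \<ge> |a|\<^sup>2 - |b|\<^sup>2\<close>, the backward quotients of \<open>W\<close> paired with \<open>W\<close> dominate those
  of \<open>|W|\<^sup>2 / 2\<close>, whose time integrals are averages of \<open>|W|\<^sup>2 / 2\<close> because \<open>W\<close> vanishes at 0.\<close>

lemma energy_nonneg:
  assumes T: "0 < T" and X: "X \<subseteq> L2_space \<mu>"
    and W: "\<And>t. t \<in> {0..T} \<Longrightarrow> W t \<in> L2_space \<mu>"
    and W_cont: "\<And>t. t \<in> {0..T} \<Longrightarrow> ((\<lambda>s. L2_norm \<mu> (\<lambda>x. W s x - W t x)) \<longlongrightarrow> 0) (at t within {0..T})"
    and W_0: "AE x in \<mu>. W 0 x = 0"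
    and w: "w \<in> bochner_L2 T X N" and Ww: "AE t in time_measure T. AE x in \<mu>. W t x = w t x"
    and W_B: "\<And>v t. v \<in> X \<Longrightarrow> t \<in> {0..T} \<Longrightarrow> L2_inner \<mu> (W t) v = primitive T (\<lambda>s. B s v) t"
  shows "0 \<le> (\<integral>t. B t (w t) \<partial>time_measure T)"
proof -
  let ?M = "time_measure T"
  \<comment> \<open>The energy extended by zero. Continuity across 0 comes from \<open>W 0\<close>
    being null.\<close>
  define F where "F t = (if t \<le> 0 then 0 else (L2_norm \<mu> (W t))\<^sup>2 / 2)" for t
  have N_cont: "continuous_on {0..T} (\<lambda>t. L2_norm \<mu> (W t))"
    unfolding continuous_on_def
  proof
    fix t assume t: "t \<in> {0..T}"
    have "((\<lambda>s. L2_norm \<mu> (W s) - L2_norm \<mu> (W t)) \<longlongrightarrow> 0) (at t within {0..T})"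
    proof (rule Lim_null_comparison[OF _ W_cont[OF t]])
      show "\<forall>\<^sub>F s in at t within {0..T}. norm (L2_norm \<mu> (W s) - L2_norm \<mu> (W t)) \<le> L2_norm \<mu> (\<lambda>x. W s x - W t x)"
        using L2.N_abs_diff_le[OF W W[OF t]] by (simp add: eventually_at_topological) blast
    qed
    then show "((\<lambda>t. L2_norm \<mu> (W t)) \<longlongrightarrow> L2_norm \<mu> (W t)) (at t within {0..T})" by (rule LIM_zero_cancel)
  qed
  have N_0: "L2_norm \<mu> (W 0) = 0"
    using W_0 L2_spaceD(1)[OF W] T by (intro L2_norm_eq_0) auto
  have F_cont: "continuous_on {..T} F"
  proof -
    have "continuous_on ({..0} \<union> {0..T}) (\<lambda>t. if t \<le> 0 then 0 else (L2_norm \<mu> (W t))\<^sup>2 / 2)"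
    proof (rule continuous_on_cases)
      show "continuous_on {0..T} (\<lambda>t. (L2_norm \<mu> (W t))\<^sup>2 / 2)"
        unfolding divide_inverse by (intro continuous_on_mult continuous_on_power N_cont continuous_on_const)
      show "\<forall>t. t \<in> {..0} \<and> \<not> t \<le> 0 \<or> t \<in> {0..T} \<and> t \<le> 0 \<longrightarrow> 0 = (L2_norm \<mu> (W t))\<^sup>2 / 2"
        using N_0 by auto
    qed auto
    moreover have "{..0} \<union> {0..T} = {..T}" using T by auto
    ultimately show ?thesis unfolding F_def[abs_def] by simp
  qed
  have F_nonneg: "0 \<le> F t" for t by (simp add: F_def)
  have "0 \<le> (\<integral>t. backward_quotient T (step_size T n) (\<lambda>s. B s (w t)) t \<partial>?M)" for n
  proof -
    define h where "h = step_size T n"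
    have h: "0 < h" "h < T" unfolding h_def using step_size[OF T] by auto
    interpret D: form_family X N T "\<lambda>t v. backward_quotient T h (\<lambda>s. B s v) t" "backward_quotient T h m"
      by (rule form_family_backward_quotient[OF h])
    note bd = integral_backward_difference[OF F_cont _ h]
    have "0 \<le> integral {T - h..T} F"
      using h by (intro Henstock_Kurzweil_Integration.integral_nonneg integrable_continuous_real
          continuous_on_subset[OF F_cont]) (auto intro: F_nonneg)
    also have "\<dots> = (\<integral>t. F t - F (t - h) \<partial>?M)" by (rule bd(2)[symmetric]) (simp add: F_def)
    also have "\<dots> \<le> (\<integral>t. h * backward_quotient T h (\<lambda>s. B s (w t)) t \<partial>?M)"
    proof (rule integral_mono_AE)
      show "integrable ?M (\<lambda>t. F t - F (t - h))" by (rule bd(1)) (simp add: F_def)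
      show "integrable ?M (\<lambda>t. h * backward_quotient T h (\<lambda>s. B s (w t)) t)"
        using D.B_bochner_integrable(1)[OF w] by simp
      show "AE t in ?M. F t - F (t - h) \<le> h * backward_quotient T h (\<lambda>s. B s (w t)) t"
        using Ww bochner_L2D(1)[OF w] AE_space[of ?M]
      proof eventually_elim
        case (elim t)
        then have t: "t \<in> {0..T}" "0 < t" "t \<le> T" by auto
        \<comment> \<open>\<open>W_B\<close> holds for every time and every element of
          \<open>X\<close>, so an element that depends on \<open>t\<close> is admissible
          here.\<close>
        define v where "v = w t"
        have v: "v \<in> X" "v \<in> L2_space \<mu>" using elim(2) X by (auto simp: v_def)
        define a where "a = W t"
        have a: "a \<in> L2_space \<mu>" unfolding a_def by (rule W[OF t(1)])
        \<comment> \<open>The value at \<open>t - h\<close> of \<open>W\<close> extended by zero,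
          matching the primitive, which is 0 at negative times.\<close>
        define b where "b = (if t - h \<le> 0 then (\<lambda>x. 0) else W (t - h))"
        have b: "b \<in> L2_space \<mu>" unfolding b_def using W[of "t - h"] t h L2.zero_mem by auto
        have inner_v: "L2_inner \<mu> f v = L2_inner \<mu> f a" if f: "f \<in> L2_space \<mu>" for f
          unfolding L2_inner_def
        proof (rule integral_cong_AE)
          show "AE x in \<mu>. f x \<bullet> v x = f x \<bullet> a x" using elim(1) unfolding v_def a_def by eventually_elim simp
        qed (use L2_integrable_inner[OF f v(2)] L2_integrable_inner[OF f a] in \<open>simp_all add: borel_measurable_integrable\<close>)
        have "primitive T (\<lambda>s. B s v) t = L2_inner \<mu> a v" unfolding a_def by (rule W_B[OF v(1) t(1), symmetric])
        moreover have "primitive T (\<lambda>s. B s v) (t - h) = L2_inner \<mu> b v"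
        proof (cases "t - h \<le> 0")
          case True
          then show ?thesis by (simp add: b_def primitive_nonpos L2_inner_def)
        next
          case False
          then show ?thesis using W_B[OF v(1), of "t - h"] t h by (simp add: b_def)
        qed
        ultimately have "h * backward_quotient T h (\<lambda>s. B s v) t = L2_inner \<mu> a a - L2_inner \<mu> b a"
          using h by (simp add: backward_quotient_def inner_v[OF a] inner_v[OF b])
        moreover have "0 \<le> (L2_norm \<mu> a)\<^sup>2 - 2 * L2_inner \<mu> b a + (L2_norm \<mu> b)\<^sup>2"
          using L2_norm_add_scaleR_power2[OF a b, of "-1"] L2_inner_commute[of \<mu> a b]
            zero_le_power2[of "L2_norm \<mu> (\<lambda>x. a x + (-1) *\<^sub>R b x)"] by simp
        moreover have "F t = (L2_norm \<mu> a)\<^sup>2 / 2" using t by (simp add: F_def a_def)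
        moreover have "F (t - h) = (L2_norm \<mu> b)\<^sup>2 / 2" by (simp add: F_def b_def L2.N_zero)
        ultimately show ?case unfolding v_def[symmetric] L2_inner_self by simp
      qed
    qed
    finally have "0 \<le> h * (\<integral>t. backward_quotient T h (\<lambda>s. B s (w t)) t \<partial>?M)" by simp
    then show ?thesis using h unfolding h_def by (simp add: zero_le_mult_iff)
  qed
  then show ?thesis
    using LIMSEQ_le_const[OF backward_quotient_form_tendsto[OF T w], of 0] by blast
qed

end


section \<open>Sobolev spaces\<close>

lemma (in finite_measure) L2_space_imp_integrable:
  assumes f: "f \<in> L2_space M"
  shows "integrable M f"
proof (rule Bochner_Integration.integrable_bound)
  show "integrable M (\<lambda>x. 1 + (norm (f x))\<^sup>2)" using L2_spaceD(2)[OF f] by simp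
  show "f \<in> borel_measurable M" by (rule L2_spaceD(1)[OF f])
  have "norm (f x) \<le> 1 + (norm (f x))\<^sup>2" for x
    using sum_squares_bound[of 1 "norm (f x)"] norm_ge_zero[of "f x"] zero_le_power2[of "norm (f x)"]
    by (simp only: mult_1_right power_one)
  then show "AE x in M. norm (f x) \<le> norm (1 + (norm (f x))\<^sup>2)" by simp
qed

text \<open>Boundedness makes the measure finite, so that square integrable functions are integrable
  and may be multiplied by bounded test functions and their derivatives.\<close>

locale bounded_open_set =
  fixes \<Omega> :: "'a::euclidean_space set"
  assumes open_\<Omega>: "open \<Omega>" and bounded_\<Omega>: "bounded \<Omega>"
begin

sublocale finite_measure "lebesgue_on \<Omega>"
  by (rule finite_measure_lebesgue_on) (use bounded_set_imp_lmeasurable[OF bounded_\<Omega>] open_\<Omega> in auto)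

lemma continuous_measurable:
  "continuous_on UNIV \<phi> \<Longrightarrow> \<phi> \<in> borel_measurable (lebesgue_on \<Omega>)" for \<phi> :: "'a \<Rightarrow> real"
  by (rule continuous_imp_measurable_on_sets_lebesgue[OF continuous_on_subset]) (use open_\<Omega> in auto)

lemma integrable_mult_test_derivative:
  assumes "integrable (lebesgue_on \<Omega>) u" "test_function \<Omega> \<phi>" "i \<in> Basis"
  shows "integrable (lebesgue_on \<Omega>) (\<lambda>x. u x * frechet_derivative \<phi> (at x) i)"
proof -
  obtain C where C: "\<And>x. \<bar>frechet_derivative \<phi> (at x) i\<bar> \<le> C"
    using test_function_derivative(2)[OF assms(2,3)] by blast
  show ?thesis
    by (rule integrable_mult_bounded[OF assms(1)
          continuous_measurable[OF test_function_derivative(1)[OF assms(2,3)]] C])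
qed

lemma integrable_mult_test:
  assumes "integrable (lebesgue_on \<Omega>) u" "test_function \<Omega> \<phi>"
  shows "integrable (lebesgue_on \<Omega>) (\<lambda>x. u x * \<phi> x)"
proof -
  obtain C where C: "\<And>x. \<bar>\<phi> x\<bar> \<le> C"
    using test_function_bounded[OF assms(2)] by blast
  show ?thesis
    by (rule integrable_mult_bounded[OF assms(1)
          continuous_measurable[OF test_function_continuous[OF assms(2)]] C])
qed

lemma L2_component_integrable:
  assumes "G \<in> L2_space (lebesgue_on \<Omega>)"
  shows "integrable (lebesgue_on \<Omega>) (\<lambda>x. G x \<bullet> i)"
  using L2_space_imp_integrable[OF assms] by simp

lemma is_weak_gradient_add_scaleR:
  assumes L2: "u \<in> L2_space (lebesgue_on \<Omega>)" "v \<in> L2_space (lebesgue_on \<Omega>)"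
      "G \<in> L2_space (lebesgue_on \<Omega>)" "H \<in> L2_space (lebesgue_on \<Omega>)"
    and uG: "is_weak_gradient \<Omega> u G" and vH: "is_weak_gradient \<Omega> v H"
  shows "is_weak_gradient \<Omega> (\<lambda>x. u x + c * v x) (\<lambda>x. G x + c *\<^sub>R H x)"
  unfolding is_weak_gradient_def
proof (intro allI impI ballI)
  fix \<phi> and i :: 'a assume \<phi>: "test_function \<Omega> \<phi>" and i: "i \<in> Basis"
  let ?M = "lebesgue_on \<Omega>" and ?d = "\<lambda>x. frechet_derivative \<phi> (at x) i"
  note Id = integrable_mult_test_derivative[OF _ \<phi> i, OF L2_space_imp_integrable]
  note I = integrable_mult_test[OF _ \<phi>, OF L2_component_integrable[where i=i]]
  have "(\<integral>x. (u x + c * v x) * ?d x \<partial>?M) = (\<integral>x. u x * ?d x + c * (v x * ?d x) \<partial>?M)"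
    by (simp add: algebra_simps)
  also have "\<dots> = (\<integral>x. u x * ?d x \<partial>?M) + c * (\<integral>x. v x * ?d x \<partial>?M)"
    using Id[OF L2(1)] Id[OF L2(2)] by simp
  also have "\<dots> = - ((\<integral>x. (G x \<bullet> i) * \<phi> x \<partial>?M) + c * (\<integral>x. (H x \<bullet> i) * \<phi> x \<partial>?M))"
    using uG vH \<phi> i unfolding is_weak_gradient_def by simp
  also have "(\<integral>x. (G x \<bullet> i) * \<phi> x \<partial>?M) + c * (\<integral>x. (H x \<bullet> i) * \<phi> x \<partial>?M) =
      (\<integral>x. (G x \<bullet> i) * \<phi> x + c * ((H x \<bullet> i) * \<phi> x) \<partial>?M)"
    using I[OF L2(3)] I[OF L2(4)] by simp
  also have "\<dots> = (\<integral>x. ((G x + c *\<^sub>R H x) \<bullet> i) * \<phi> x \<partial>?M)"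
    by (simp add: inner_add_left algebra_simps)
  finally show "(\<integral>x. (u x + c * v x) * ?d x \<partial>?M) = - (\<integral>x. ((G x + c *\<^sub>R H x) \<bullet> i) * \<phi> x \<partial>?M)" .
qed

lemma weak_gradient_unique:
  assumes L2: "G \<in> L2_space (lebesgue_on \<Omega>)" "H \<in> L2_space (lebesgue_on \<Omega>)"
    and uG: "is_weak_gradient \<Omega> u G" and uH: "is_weak_gradient \<Omega> u H"
  shows "AE x in lebesgue_on \<Omega>. G x = H x"
proof -
  let ?M = "lebesgue_on \<Omega>"
  have "AE x in ?M. G x \<bullet> i - H x \<bullet> i = 0" if i: "i \<in> Basis" for i
  proof (rule fundamental_lemma_calculus_of_variations[OF open_\<Omega>])
    show "integrable ?M (\<lambda>x. G x \<bullet> i - H x \<bullet> i)"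
      by (intro Bochner_Integration.integrable_diff L2_component_integrable L2)
    fix \<phi> assume \<phi>: "test_function \<Omega> \<phi>"
    note I = integrable_mult_test[OF L2_component_integrable[where i=i] \<phi>]
    have "(\<integral>x. (G x \<bullet> i - H x \<bullet> i) * \<phi> x \<partial>?M) = (\<integral>x. (G x \<bullet> i) * \<phi> x \<partial>?M) - (\<integral>x. (H x \<bullet> i) * \<phi> x \<partial>?M)"
      using I[OF L2(1)] I[OF L2(2)] by (simp add: left_diff_distrib)
    also have "(\<integral>x. (G x \<bullet> i) * \<phi> x \<partial>?M) = (\<integral>x. (H x \<bullet> i) * \<phi> x \<partial>?M)"
      using uG[unfolded is_weak_gradient_def, rule_format, OF \<phi> i]
        uH[unfolded is_weak_gradient_def, rule_format, OF \<phi> i] by simp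
    finally show "(\<integral>x. (G x \<bullet> i - H x \<bullet> i) * \<phi> x \<partial>?M) = 0" by simp
  qed
  then have "AE x in ?M. \<forall>i\<in>Basis. G x \<bullet> i - H x \<bullet> i = 0"
    by (simp add: AE_finite_all[OF finite_Basis])
  then show ?thesis
    by eventually_elim (simp add: euclidean_eq_iff[where 'a='a])
qed

section \<open>\<open>H1\<close> as a seminormed space and the bilinear energy form\<close>

lemma H1_spaceD:
  assumes "u \<in> H1_space \<Omega>"
  shows "u \<in> L2_space (lebesgue_on \<Omega>)" "weak_gradient \<Omega> u \<in> L2_space (lebesgue_on \<Omega>)"
    "is_weak_gradient \<Omega> u (weak_gradient \<Omega> u)"
proof -
  show "u \<in> L2_space (lebesgue_on \<Omega>)" using assms by (simp add: H1_space_def)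
  have "\<exists>G. G \<in> L2_space (lebesgue_on \<Omega>) \<and> is_weak_gradient \<Omega> u G"
    using assms unfolding H1_space_def by blast
  from someI_ex[OF this] show "weak_gradient \<Omega> u \<in> L2_space (lebesgue_on \<Omega>)"
    "is_weak_gradient \<Omega> u (weak_gradient \<Omega> u)"
    unfolding weak_gradient_def by auto
qed

lemma H1_space_add_mult:
  assumes u: "u \<in> H1_space \<Omega>" and v: "v \<in> H1_space \<Omega>"
  shows "(\<lambda>x. u x + c * v x) \<in> H1_space \<Omega>"
    and "AE x in lebesgue_on \<Omega>. weak_gradient \<Omega> (\<lambda>x. u x + c * v x) x = weak_gradient \<Omega> u x + c *\<^sub>R weak_gradient \<Omega> v x"
proof -
  let ?G = "\<lambda>x. weak_gradient \<Omega> u x + c *\<^sub>R weak_gradient \<Omega> v x"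
  have wg: "is_weak_gradient \<Omega> (\<lambda>x. u x + c * v x) ?G"
    by (rule is_weak_gradient_add_scaleR[OF H1_spaceD(1)[OF u] H1_spaceD(1)[OF v] H1_spaceD(2)[OF u]
          H1_spaceD(2)[OF v] H1_spaceD(3)[OF u] H1_spaceD(3)[OF v]])
  have GL2: "?G \<in> L2_space (lebesgue_on \<Omega>)"
    by (rule L2_space_add_scaleR[OF H1_spaceD(2)[OF u] H1_spaceD(2)[OF v]])
  have L2: "(\<lambda>x. u x + c * v x) \<in> L2_space (lebesgue_on \<Omega>)"
    by (rule L2.add_mult_mem[OF H1_spaceD(1)[OF u] H1_spaceD(1)[OF v]])
  show H1: "(\<lambda>x. u x + c * v x) \<in> H1_space \<Omega>"
    unfolding H1_space_def using wg GL2 L2 by blast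
  show "AE x in lebesgue_on \<Omega>. weak_gradient \<Omega> (\<lambda>x. u x + c * v x) x = ?G x"
    by (rule weak_gradient_unique[OF H1_spaceD(2)[OF H1] GL2 H1_spaceD(3)[OF H1] wg])
qed

text \<open>The gradient chosen for the zero function is zero only almost everywhere, so even this
  value of the norm rests on uniqueness of weak gradients.\<close>

lemma H1_zero: "(\<lambda>x. 0) \<in> H1_space \<Omega>" "L2_norm (lebesgue_on \<Omega>) (weak_gradient \<Omega> (\<lambda>x. 0)) = 0"
proof -
  have z: "(\<lambda>x. 0) \<in> L2_space (lebesgue_on \<Omega>)" "(\<lambda>x. 0::'a) \<in> L2_space (lebesgue_on \<Omega>)"
    by (simp_all add: L2_space_def)
  have wg: "is_weak_gradient \<Omega> (\<lambda>x. 0) (\<lambda>x. 0)" by (simp add: is_weak_gradient_def)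
  show H1: "(\<lambda>x. 0) \<in> H1_space \<Omega>" unfolding H1_space_def using z wg by blast
  have "AE x in lebesgue_on \<Omega>. weak_gradient \<Omega> (\<lambda>x. 0) x = 0"
    by (rule weak_gradient_unique[OF H1_spaceD(2)[OF H1] z(2) H1_spaceD(3)[OF H1] wg])
  then show "L2_norm (lebesgue_on \<Omega>) (weak_gradient \<Omega> (\<lambda>x. 0)) = 0"
    by (rule L2_norm_eq_0[OF _ L2_spaceD(1)[OF H1_spaceD(2)[OF H1]]])
qed

sublocale H1: seminormed_functions "H1_space \<Omega>" "H1_norm \<Omega>"
proof
  show "(\<lambda>x. 0) \<in> H1_space \<Omega>" by (rule H1_zero)
  show "H1_norm \<Omega> (\<lambda>x. 0) = 0" by (simp add: H1_norm_def H1_zero L2.N_zero)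
  show "0 \<le> H1_norm \<Omega> u" for u by (simp add: H1_norm_def)
  fix u v c assume u: "u \<in> H1_space \<Omega>" and v: "v \<in> H1_space \<Omega>"
  show "(\<lambda>x. u x + c * v x) \<in> H1_space \<Omega>" by (rule H1_space_add_mult[OF u v])
  let ?n = "L2_norm (lebesgue_on \<Omega>)"
  let ?G = "weak_gradient \<Omega>"
  have 1: "?n (\<lambda>x. u x + c * v x) \<le> ?n u + \<bar>c\<bar> * ?n v"
    by (rule L2.N_add_mult_le[OF H1_spaceD(1)[OF u] H1_spaceD(1)[OF v]])
  have "L2_norm (lebesgue_on \<Omega>) (?G (\<lambda>x. u x + c * v x)) = L2_norm (lebesgue_on \<Omega>) (\<lambda>x. ?G u x + c *\<^sub>R ?G v x)"
    by (rule L2_norm_cong_AE[OF H1_space_add_mult(2)[OF u v]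
          L2_spaceD(1)[OF H1_spaceD(2)[OF H1_space_add_mult(1)[OF u v]]]
          L2_spaceD(1)[OF L2_space_add_scaleR[OF H1_spaceD(2)[OF u] H1_spaceD(2)[OF v]]]])
  also have "\<dots> \<le> L2_norm (lebesgue_on \<Omega>) (?G u) + \<bar>c\<bar> * L2_norm (lebesgue_on \<Omega>) (?G v)"
    by (rule L2_norm_add_scaleR_le[OF H1_spaceD(2)[OF u] H1_spaceD(2)[OF v]])
  finally have 2: "L2_norm (lebesgue_on \<Omega>) (?G (\<lambda>x. u x + c * v x)) \<le> L2_norm (lebesgue_on \<Omega>) (?G u) + \<bar>c\<bar> * L2_norm (lebesgue_on \<Omega>) (?G v)" .
  have "H1_norm \<Omega> (\<lambda>x. u x + c * v x) \<le> sqrt ((?n u + \<bar>c\<bar> * ?n v)\<^sup>2 + (L2_norm (lebesgue_on \<Omega>) (?G u) + \<bar>c\<bar> * L2_norm (lebesgue_on \<Omega>) (?G v))\<^sup>2)"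
    unfolding H1_norm_def
    by (intro real_sqrt_le_mono add_mono power_mono 1 2 L2_norm_nonneg)
  also have "\<dots> \<le> sqrt ((?n u)\<^sup>2 + (L2_norm (lebesgue_on \<Omega>) (?G u))\<^sup>2) + sqrt ((\<bar>c\<bar> * ?n v)\<^sup>2 + (\<bar>c\<bar> * L2_norm (lebesgue_on \<Omega>) (?G v))\<^sup>2)"
    by (rule real_sqrt_sum_squares_triangle_ineq)
  also have "sqrt ((\<bar>c\<bar> * ?n v)\<^sup>2 + (\<bar>c\<bar> * L2_norm (lebesgue_on \<Omega>) (?G v))\<^sup>2) = \<bar>c\<bar> * H1_norm \<Omega> v"
    unfolding H1_norm_def power_mult_distrib distrib_left[symmetric] real_sqrt_mult by simp
  finally show "H1_norm \<Omega> (\<lambda>x. u x + c * v x) \<le> H1_norm \<Omega> u + \<bar>c\<bar> * H1_norm \<Omega> v"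
    by (simp add: H1_norm_def)
qed

lemma H1_norm_power2: "(H1_norm \<Omega> u)\<^sup>2 = (L2_norm (lebesgue_on \<Omega>) u)\<^sup>2 + energy_form \<Omega> u u"
  by (simp add: H1_norm_def energy_form_def L2_inner_self)

lemma L2_norm_le_H1_norm: "L2_norm (lebesgue_on \<Omega>) u \<le> H1_norm \<Omega> u"
  unfolding H1_norm_def by (rule real_sqrt_sum_squares_ge1)

lemma L2_norm_gradient_le_H1_norm: "L2_norm (lebesgue_on \<Omega>) (weak_gradient \<Omega> u) \<le> H1_norm \<Omega> u"
  unfolding H1_norm_def by (rule real_sqrt_sum_squares_ge2)

lemma energy_form_commute: "energy_form \<Omega> u v = energy_form \<Omega> v u"
  by (simp add: energy_form_def L2_inner_commute)

lemma energy_form_add_mult_left: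
  assumes u: "u \<in> H1_space \<Omega>" and v: "v \<in> H1_space \<Omega>" and w: "w \<in> H1_space \<Omega>"
  shows "energy_form \<Omega> (\<lambda>x. u x + c * v x) w = energy_form \<Omega> u w + c * energy_form \<Omega> v w"
proof -
  let ?G = "weak_gradient \<Omega>"
  have "energy_form \<Omega> (\<lambda>x. u x + c * v x) w = L2_inner (lebesgue_on \<Omega>) (\<lambda>x. ?G u x + c *\<^sub>R ?G v x) (?G w)"
    unfolding energy_form_def L2_inner_def
  proof (rule integral_cong_AE)
    show "AE x in lebesgue_on \<Omega>. ?G (\<lambda>x. u x + c * v x) x \<bullet> ?G w x = (?G u x + c *\<^sub>R ?G v x) \<bullet> ?G w x"
      using H1_space_add_mult(2)[OF u v, of c] by eventually_elim simp
    show "(\<lambda>x. ?G (\<lambda>x. u x + c * v x) x \<bullet> ?G w x) \<in> borel_measurable (lebesgue_on \<Omega>)"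
      by (rule borel_measurable_integrable[OF L2_integrable_inner[OF
              H1_spaceD(2)[OF H1_space_add_mult(1)[OF u v]] H1_spaceD(2)[OF w]]])
    show "(\<lambda>x. (?G u x + c *\<^sub>R ?G v x) \<bullet> ?G w x) \<in> borel_measurable (lebesgue_on \<Omega>)"
      by (rule borel_measurable_integrable[OF L2_integrable_inner[OF
              L2_space_add_scaleR[OF H1_spaceD(2)[OF u] H1_spaceD(2)[OF v]] H1_spaceD(2)[OF w]]])
  qed
  also have "\<dots> = energy_form \<Omega> u w + c * energy_form \<Omega> v w"
    unfolding energy_form_def
    by (rule L2_inner_add_scaleR_left[OF H1_spaceD(2)[OF u] H1_spaceD(2)[OF v] H1_spaceD(2)[OF w]])
  finally show ?thesis .
qed

lemma energy_form_bound:
  assumes u: "u \<in> H1_space \<Omega>" and v: "v \<in> H1_space \<Omega>"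
  shows "\<bar>energy_form \<Omega> u v\<bar> \<le> H1_norm \<Omega> u * H1_norm \<Omega> v"
proof -
  have "\<bar>energy_form \<Omega> u v\<bar> \<le> L2_norm (lebesgue_on \<Omega>) (weak_gradient \<Omega> u) * L2_norm (lebesgue_on \<Omega>) (weak_gradient \<Omega> v)"
    unfolding energy_form_def by (rule L2_Cauchy_Schwarz[OF H1_spaceD(2)[OF u] H1_spaceD(2)[OF v]])
  also have "\<dots> \<le> H1_norm \<Omega> u * H1_norm \<Omega> v"
    by (intro mult_mono L2_norm_gradient_le_H1_norm L2_norm_nonneg H1.N_nonneg[OF u])
  finally show ?thesis .
qed

text \<open>Serves integrability in time of \<open>energy_form (w t) v\<close>: the right-hand side
  involves only squares, which are accessible through norms.\<close>

lemma energy_form_polarization: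
  assumes u: "u \<in> H1_space \<Omega>" and v: "v \<in> H1_space \<Omega>"
  shows "energy_form \<Omega> u v =
    (energy_form \<Omega> (\<lambda>x. u x + 1 * v x) (\<lambda>x. u x + 1 * v x) - energy_form \<Omega> u u - energy_form \<Omega> v v) / 2"
proof -
  note uv = H1_space_add_mult(1)[OF u v, of 1]
  have "energy_form \<Omega> (\<lambda>x. u x + 1 * v x) (\<lambda>x. u x + 1 * v x) =
      energy_form \<Omega> u (\<lambda>x. u x + 1 * v x) + energy_form \<Omega> v (\<lambda>x. u x + 1 * v x)"
    using energy_form_add_mult_left[OF u v uv, of 1] by (simp only: mult_1)
  also have "energy_form \<Omega> u (\<lambda>x. u x + 1 * v x) = energy_form \<Omega> u u + energy_form \<Omega> u v"
    using energy_form_add_mult_left[OF u v u, of 1]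
    by (simp only: energy_form_commute[of u "\<lambda>x. u x + v x"] energy_form_commute[of u v] mult_1)
  also have "energy_form \<Omega> v (\<lambda>x. u x + 1 * v x) = energy_form \<Omega> u v + energy_form \<Omega> v v"
    using energy_form_add_mult_left[OF u v v, of 1]
    by (simp only: energy_form_commute[of v "\<lambda>x. u x + v x"] mult_1)
  finally show ?thesis by simp
qed

end

text \<open>Both measures restrict the same Hausdorff measure. The trace operator is specified on
  the whole frontier, and its properties are carried here to \<open>\<Gamma>\<^sub>1\<close> and
  \<open>\<Gamma>\<^sub>2\<close>.\<close>

lemma surface_measure_subset:
  fixes f :: "'a::euclidean_space \<Rightarrow> real"
  assumes AF: "A \<subseteq> F" and A: "A \<in> sets (hausdorff_measure (DIM('a) - 1))"
    and F: "F \<in> sets (hausdorff_measure (DIM('a) - 1))"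
  shows "(AE x in surface_measure F. P x) \<Longrightarrow> AE x in surface_measure A. P x"
    and "f \<in> L2_space (surface_measure F) \<Longrightarrow> f \<in> L2_space (surface_measure A)"
    and "f \<in> L2_space (surface_measure F) \<Longrightarrow> L2_norm (surface_measure A) f \<le> L2_norm (surface_measure F) f"
proof -
  let ?H = "hausdorff_measure (DIM('a) - 1) :: 'a measure"
  have A': "A \<inter> space ?H \<in> sets ?H" and F': "F \<inter> space ?H \<in> sets ?H"
    using A F by (simp_all add: space_hausdorff_measure)
  show "AE x in surface_measure A. P x" if "AE x in surface_measure F. P x"
  proof -
    have "AE x in ?H. x \<in> F \<longrightarrow> P x"
      using that unfolding surface_measure_def AE_restrict_space_iff[OF F'] .
    then have "AE x in ?H. x \<in> A \<longrightarrow> P x" by eventually_elim (use AF in blast)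
    then show ?thesis unfolding surface_measure_def AE_restrict_space_iff[OF A'] .
  qed
  assume f: "f \<in> L2_space (surface_measure F)"
  have m: "f \<in> borel_measurable (surface_measure A)"
    using L2_spaceD(1)[OF f] unfolding surface_measure_def by (rule measurable_restrict_mono[OF _ AF])
  have IF: "integrable ?H (\<lambda>x. indicator F x *\<^sub>R (norm (f x))\<^sup>2)"
    using L2_spaceD(2)[OF f] unfolding surface_measure_def by (subst (asm) integrable_restrict_space[OF F'])
  have eq: "indicator A x *\<^sub>R (norm (f x))\<^sup>2 = indicator A x *\<^sub>R (indicator F x *\<^sub>R (norm (f x))\<^sup>2)" for x
    using AF by (auto simp: indicator_def)
  have IA: "integrable ?H (\<lambda>x. indicator A x *\<^sub>R (norm (f x))\<^sup>2)"
    unfolding eq by (rule integrable_mult_indicator[OF A IF])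
  then have "integrable (surface_measure A) (\<lambda>x. (norm (f x))\<^sup>2)"
    unfolding surface_measure_def by (subst integrable_restrict_space[OF A'])
  with m show "f \<in> L2_space (surface_measure A)" by (simp add: L2_space_def)
  show "L2_norm (surface_measure A) f \<le> L2_norm (surface_measure F) f"
    unfolding L2_norm_def surface_measure_def integral_restrict_space[OF A'] integral_restrict_space[OF F']
    by (intro real_sqrt_le_mono integral_mono IA IF) (use AF in \<open>auto simp: indicator_def\<close>)
qed

text \<open>The same simple functions approximate with respect to the weaker seminorm.\<close>

lemma bochner_L2_mono:
  assumes X: "seminormed_functions X N" and Y: "seminormed_functions Y N'"
    and XY: "X \<subseteq> Y" and le: "\<And>u. u \<in> X \<Longrightarrow> N' u \<le> N u"
    and u: "u \<in> bochner_L2 T X N"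
  shows "u \<in> bochner_L2 T Y N'"
proof -
  interpret X: seminormed_functions X N by (rule X)
  interpret Y: seminormed_functions Y N' by (rule Y)
  let ?M = "time_measure T"
  obtain s where s: "\<forall>k. simple_function ?M (s k) \<and> (\<forall>t\<in>space ?M. s k t \<in> X)"
    and lim: "AE t in ?M. (\<lambda>k. N (\<lambda>x. s k t x - u t x)) \<longlonglongrightarrow> 0"
    using X.bochner_L2D(2)[OF u] unfolding strongly_measurable_def by blast
  have mem: "AE t in ?M. u t \<in> Y"
    using X.bochner_L2D(1)[OF u] by eventually_elim (use XY in blast)
  have lim': "AE t in ?M. (\<lambda>k. N' (\<lambda>x. s k t x - u t x)) \<longlonglongrightarrow> 0"
    using lim X.bochner_L2D(1)[OF u] AE_space[of ?M]
  proof eventually_elim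
    case (elim t)
    have d: "(\<lambda>x. s k t x - u t x) \<in> X" for k using s elim by (blast intro: X.diff_mem)
    show ?case
    proof (rule tendsto_sandwich[OF _ _ tendsto_const elim(1)])
      show "\<forall>\<^sub>F k in sequentially. 0 \<le> N' (\<lambda>x. s k t x - u t x)"
        using Y.N_nonneg[OF subsetD[OF XY d]] by simp
      show "\<forall>\<^sub>F k in sequentially. N' (\<lambda>x. s k t x - u t x) \<le> N (\<lambda>x. s k t x - u t x)"
        using le[OF d] by simp
    qed
  qed
  have sm: "strongly_measurable ?M Y N' u"
    unfolding strongly_measurable_def
    by (rule exI[of _ s]) (use s lim' XY in blast)
  show ?thesis
  proof (rule Y.bochner_L2I[OF sm mem X.bochner_L2D(3)[OF u]])
    show "AE t in ?M. (N' (u t))\<^sup>2 \<le> (N (u t))\<^sup>2"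
      using X.bochner_L2D(1)[OF u] mem by eventually_elim (intro power_mono le Y.N_nonneg)
  qed
qed


section \<open>The mixed heat problem\<close>

locale mixed_heat_problem = bounded_open_set \<Omega> for \<Omega> :: "'a::euclidean_space set" +
  fixes \<Gamma>\<^sub>1 \<Gamma>\<^sub>2 :: "'a set" and \<gamma> :: "('a \<Rightarrow> real) \<Rightarrow> ('a \<Rightarrow> real)" and T lam :: real
  assumes boundary: "\<Gamma>\<^sub>1 \<union> \<Gamma>\<^sub>2 = frontier \<Omega>"
    and \<Gamma>1_sets: "\<Gamma>\<^sub>1 \<in> sets (hausdorff_measure (DIM('a) - 1))"
    and \<Gamma>2_sets: "\<Gamma>\<^sub>2 \<in> sets (hausdorff_measure (DIM('a) - 1))"
    and trace: "is_trace_operator \<Omega> \<gamma>"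
    and T_pos: "0 < T" and lam_pos: "0 < lam"
    and coercive: "\<And>v. v \<in> V0_space \<Omega> \<Gamma>\<^sub>1 \<gamma> \<Longrightarrow> lam * (H1_norm \<Omega> v)\<^sup>2 \<le> energy_form \<Omega> v v"
begin

abbreviation "V\<^sub>0 \<equiv> V0_space \<Omega> \<Gamma>\<^sub>1 \<gamma>"
abbreviation "NV \<equiv> H1_norm \<Omega>"
abbreviation "H \<equiv> lebesgue_on \<Omega>"
abbreviation "Q \<equiv> surface_measure \<Gamma>\<^sub>2"

lemma frontier_sets: "frontier \<Omega> \<in> sets (hausdorff_measure (DIM('a) - 1))"
  using \<Gamma>1_sets \<Gamma>2_sets unfolding boundary[symmetric] by blast

lemma \<Gamma>_subset: "\<Gamma>\<^sub>1 \<subseteq> frontier \<Omega>" "\<Gamma>\<^sub>2 \<subseteq> frontier \<Omega>"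
  using boundary by auto

lemma trace_add_mult_frontier:
  assumes u: "u \<in> H1_space \<Omega>" and v: "v \<in> H1_space \<Omega>"
  shows "AE x in surface_measure (frontier \<Omega>). \<gamma> (\<lambda>y. u y + c * v y) x = \<gamma> u x + c * \<gamma> v x"
proof -
  have cv: "(\<lambda>y. c * v y) \<in> H1_space \<Omega>" using H1.add_mult_mem[OF H1.zero_mem v, of c] by simp
  have "AE x in surface_measure (frontier \<Omega>). \<gamma> (\<lambda>y. u y + c * v y) x = \<gamma> u x + \<gamma> (\<lambda>y. c * v y) x"
    using trace unfolding is_trace_operator_def by (elim conjE) (drule bspec[OF _ u], drule bspec[OF _ cv])
  moreover have "AE x in surface_measure (frontier \<Omega>). \<gamma> (\<lambda>y. c * v y) x = c * \<gamma> v x"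
    using trace v unfolding is_trace_operator_def by blast
  ultimately show ?thesis by eventually_elim simp
qed

lemmas trace_add_mult = surface_measure_subset(1)[OF \<Gamma>_subset(2) \<Gamma>2_sets frontier_sets trace_add_mult_frontier]

lemma trace_L2:
  assumes "v \<in> H1_space \<Omega>"
  shows "\<gamma> v \<in> L2_space Q"
proof -
  have "\<gamma> v \<in> L2_space (surface_measure (frontier \<Omega>))"
    using trace assms unfolding is_trace_operator_def by blast
  then show ?thesis by (rule surface_measure_subset(2)[OF \<Gamma>_subset(2) \<Gamma>2_sets frontier_sets])
qed

text \<open>If \<open>NV\<close> vanishes identically then \<open>trace_norm\<close> is the supremum of the empty set, about which
  nothing is known; hence the case distinction.\<close>

definition trace_const :: real where
  "trace_const = (if \<forall>v\<in>H1_space \<Omega>. NV v = 0 then 0 else trace_norm \<Omega> \<Gamma>\<^sub>2 \<gamma>)"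

text \<open>The constant \<open>C\<close> of the trace operator makes the quotients bounded above,
  without which their supremum would carry no information. Where \<open>NV v = 0\<close> the
  quotient says nothing, and \<open>C\<close> itself shows that the trace is null.\<close>

lemma trace_bound:
  shows "0 \<le> trace_const" and "v \<in> H1_space \<Omega> \<Longrightarrow> L2_norm Q (\<gamma> v) \<le> trace_const * NV v"
proof -
  obtain C where C: "\<forall>v\<in>H1_space \<Omega>. L2_norm (surface_measure (frontier \<Omega>)) (\<gamma> v) \<le> C * NV v"
    using trace unfolding is_trace_operator_def by blast
  have C': "L2_norm Q (\<gamma> v) \<le> C * NV v" if v: "v \<in> H1_space \<Omega>" for v
  proof -
    have "\<gamma> v \<in> L2_space (surface_measure (frontier \<Omega>))"
      using trace v unfolding is_trace_operator_def by blast
    from surface_measure_subset(3)[OF \<Gamma>_subset(2) \<Gamma>2_sets frontier_sets this] C v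
    show ?thesis by (blast intro: order_trans)
  qed
  have le: "L2_norm Q (\<gamma> v) / NV v \<le> trace_norm \<Omega> \<Gamma>\<^sub>2 \<gamma>" if v: "v \<in> H1_space \<Omega>" "NV v \<noteq> 0" for v
    unfolding trace_norm_def
  proof (rule cSUP_upper)
    show "v \<in> {v \<in> H1_space \<Omega>. NV v \<noteq> 0}" using v by simp
    show "bdd_above ((\<lambda>v. L2_norm Q (\<gamma> v) / NV v) ` {v \<in> H1_space \<Omega>. NV v \<noteq> 0})"
    proof (rule bdd_aboveI2)
      fix v assume "v \<in> {v \<in> H1_space \<Omega>. NV v \<noteq> 0}"
      then have v: "v \<in> H1_space \<Omega>" "NV v > 0" using H1.N_nonneg[of v] by auto
      show "L2_norm Q (\<gamma> v) / NV v \<le> C" using C'[OF v(1)] v(2) by (simp add: pos_divide_le_eq)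
    qed
  qed
  show "0 \<le> trace_const"
  proof (cases "\<forall>v\<in>H1_space \<Omega>. NV v = 0")
    case False
    then obtain v where v: "v \<in> H1_space \<Omega>" "NV v \<noteq> 0" by blast
    have "0 \<le> L2_norm Q (\<gamma> v) / NV v" using H1.N_nonneg[OF v(1)] by (simp add: L2_norm_nonneg)
    also have "\<dots> \<le> trace_norm \<Omega> \<Gamma>\<^sub>2 \<gamma>" by (rule le[OF v])
    finally show ?thesis using False unfolding trace_const_def by (simp only: if_False)
  qed (simp add: trace_const_def)
  assume v: "v \<in> H1_space \<Omega>"
  show "L2_norm Q (\<gamma> v) \<le> trace_const * NV v"
  proof (cases "NV v = 0")
    case True
    then show ?thesis using C'[OF v] by simp
  next
    case False
    then have "trace_const = trace_norm \<Omega> \<Gamma>\<^sub>2 \<gamma>" using v by (auto simp: trace_const_def)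
    moreover have "0 < NV v" using False H1.N_nonneg[OF v] by simp
    ultimately show ?thesis using le[OF v False] by (simp add: pos_divide_le_eq)
  qed
qed

lemma V0_subset: "V\<^sub>0 \<subseteq> H1_space \<Omega>"
  by (auto simp: V0_space_def)

lemmas V0_H1 = subsetD[OF V0_subset]

sublocale V0: seminormed_functions V\<^sub>0 NV
proof
  have AE1: "AE x in surface_measure \<Gamma>\<^sub>1. \<gamma> (\<lambda>y. u y + c * v y) x = \<gamma> u x + c * \<gamma> v x"
    if "u \<in> H1_space \<Omega>" "v \<in> H1_space \<Omega>" for u v c
    by (rule surface_measure_subset(1)[OF \<Gamma>_subset(1) \<Gamma>1_sets frontier_sets trace_add_mult_frontier[OF that]])
  show "(\<lambda>x. 0) \<in> V\<^sub>0"
  proof -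
    \<comment> \<open>The trace of the zero function is known only through linearity:
      \<open>0 = 0 + (-1) * 0\<close> gives a difference of equal terms.\<close>
    have "AE x in surface_measure \<Gamma>\<^sub>1. \<gamma> (\<lambda>y. 0) x = 0"
      using AE1[OF H1.zero_mem H1.zero_mem, of "-1"] by simp
    then show ?thesis using H1.zero_mem by (simp add: V0_space_def)
  qed
  show "NV (\<lambda>x. 0) = 0" by (rule H1.N_zero)
  show "0 \<le> NV u" if "u \<in> V\<^sub>0" for u by (rule H1.N_nonneg[OF V0_H1[OF that]])
  fix u v c assume u: "u \<in> V\<^sub>0" and v: "v \<in> V\<^sub>0"
  have "AE x in surface_measure \<Gamma>\<^sub>1. \<gamma> u x = 0" "AE x in surface_measure \<Gamma>\<^sub>1. \<gamma> v x = 0"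
    using u v by (simp_all add: V0_space_def)
  then have "AE x in surface_measure \<Gamma>\<^sub>1. \<gamma> (\<lambda>y. u y + c * v y) x = 0"
    using AE1[OF V0_H1[OF u] V0_H1[OF v], of c] by eventually_elim simp
  then show "(\<lambda>x. u x + c * v x) \<in> V\<^sub>0"
    using H1.add_mult_mem[OF V0_H1[OF u] V0_H1[OF v]] by (simp add: V0_space_def)
  show "NV (\<lambda>x. u x + c * v x) \<le> NV u + \<bar>c\<bar> * NV v"
    by (rule H1.N_add_mult_le[OF V0_H1[OF u] V0_H1[OF v]])
qed

section \<open>Traces and energy of functions of time\<close>

abbreviation "\<V> \<equiv> bochner_L2 T V\<^sub>0 NV"

lemma V0_L2: "V\<^sub>0 \<subseteq> L2_space H"
  using V0_H1 H1_spaceD(1) by blast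

lemma bochner_V0_L2L2: "w \<in> \<V> \<Longrightarrow> w \<in> L2L2_space T H"
  by (rule bochner_L2_mono[OF V0.seminormed_functions_axioms seminormed_functions_L2 V0_L2 L2_norm_le_H1_norm])

lemma inner_trace_add_mult:
  assumes f: "f \<in> L2_space Q" and u: "u \<in> H1_space \<Omega>" and v: "v \<in> H1_space \<Omega>"
  shows "L2_inner Q f (\<gamma> (\<lambda>x. u x + c * v x)) = L2_inner Q f (\<gamma> u) + c * L2_inner Q f (\<gamma> v)"
proof -
  have "L2_inner Q f (\<gamma> (\<lambda>x. u x + c * v x)) = (\<integral>x. f x \<bullet> \<gamma> u x + c * (f x \<bullet> \<gamma> v x) \<partial>Q)"
    unfolding L2_inner_def
  proof (rule integral_cong_AE)
    show "AE x in Q. f x \<bullet> \<gamma> (\<lambda>x. u x + c * v x) x = f x \<bullet> \<gamma> u x + c * (f x \<bullet> \<gamma> v x)"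
      using trace_add_mult[OF u v, of c] by eventually_elim (simp add: algebra_simps)
    show "(\<lambda>x. f x \<bullet> \<gamma> (\<lambda>x. u x + c * v x) x) \<in> borel_measurable Q"
      by (rule borel_measurable_integrable[OF L2_integrable_inner[OF f trace_L2[OF H1.add_mult_mem[OF u v]]]])
    show "(\<lambda>x. f x \<bullet> \<gamma> u x + c * (f x \<bullet> \<gamma> v x)) \<in> borel_measurable Q"
      using L2_integrable_inner[OF f trace_L2[OF u]] L2_integrable_inner[OF f trace_L2[OF v]]
      by (intro borel_measurable_integrable[where M=Q]) simp
  qed
  also have "\<dots> = L2_inner Q f (\<gamma> u) + c * L2_inner Q f (\<gamma> v)"
    unfolding L2_inner_def
    using L2_integrable_inner[OF f trace_L2[OF u]] L2_integrable_inner[OF f trace_L2[OF v]] by simp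
  finally show ?thesis .
qed

text \<open>A simple function followed by \<open>\<gamma>\<close> is again simple, and boundedness
  of the trace carries the approximation in \<open>NV\<close> over to \<open>L2\<close> of the
  boundary part.\<close>

lemma trace_bochner:
  assumes w: "w \<in> \<V>"
  shows "(\<lambda>t. \<gamma> (w t)) \<in> L2L2_space T Q"
    and "L2L2_norm T Q (\<lambda>t. \<gamma> (w t)) \<le> trace_const * bochner_norm T NV w"
proof -
  let ?M = "time_measure T"
  have mem: "AE t in ?M. \<gamma> (w t) \<in> L2_space Q"
    using V0.bochner_L2D(1)[OF w] by eventually_elim (rule trace_L2[OF V0_H1])
  obtain s where s: "\<forall>k. simple_function ?M (s k) \<and> (\<forall>t\<in>space ?M. s k t \<in> V\<^sub>0)"
    and lim: "AE t in ?M. (\<lambda>k. NV (\<lambda>x. s k t x - w t x)) \<longlonglongrightarrow> 0"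
    using V0.bochner_L2D(2)[OF w] unfolding strongly_measurable_def by blast
  have sf: "simple_function ?M (\<lambda>t. \<gamma> (s k t))" for k
    using simple_function_compose1[of ?M "s k" \<gamma>] s by blast
  have sL2: "\<gamma> (s k t) \<in> L2_space Q" if "t \<in> space ?M" for k t
    using s that by (blast intro: trace_L2 V0_H1)
  have lim': "AE t in ?M. (\<lambda>k. L2_norm Q (\<lambda>x. \<gamma> (s k t) x - \<gamma> (w t) x)) \<longlonglongrightarrow> 0"
    using lim V0.bochner_L2D(1)[OF w] AE_space[of ?M]
  proof eventually_elim
    case (elim t)
    have st: "s k t \<in> V\<^sub>0" for k using s elim(3) by blast
    have "L2_norm Q (\<lambda>x. \<gamma> (s k t) x - \<gamma> (w t) x) \<le> trace_const * NV (\<lambda>x. s k t x - w t x)" for k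
    proof -
      note d = V0_H1[OF V0.diff_mem[OF st elim(2)]]
      have "AE x in Q. \<gamma> (s k t) x - \<gamma> (w t) x = \<gamma> (\<lambda>x. s k t x - w t x) x"
        using trace_add_mult[OF V0_H1[OF st[of k]] V0_H1[OF elim(2)], where c="-1"] by eventually_elim simp
      then have "L2_norm Q (\<lambda>x. \<gamma> (s k t) x - \<gamma> (w t) x) = L2_norm Q (\<gamma> (\<lambda>x. s k t x - w t x))"
        by (rule L2_norm_cong_AE[OF _ L2_spaceD(1)[OF L2.diff_mem[OF trace_L2[OF V0_H1[OF st]]
                trace_L2[OF V0_H1[OF elim(2)]]]] L2_spaceD(1)[OF trace_L2[OF d]]])
      then show ?thesis using trace_bound(2)[OF d] by simp
    qed
    then show ?case
      by (intro tendsto_sandwich[OF always_eventually[OF allI[OF L2_norm_nonneg]] always_eventually[OF allI] tendsto_const])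
        (use tendsto_mult_left[OF elim(1), of trace_const] in auto)
  qed
  have sm: "strongly_measurable ?M (L2_space Q) (L2_norm Q) (\<lambda>t. \<gamma> (w t))"
    unfolding strongly_measurable_def
    by (rule exI[of _ "\<lambda>k t. \<gamma> (s k t)"]) (use sf sL2 lim' in blast)
  have le: "AE t in ?M. (L2_norm Q (\<gamma> (w t)))\<^sup>2 \<le> trace_const\<^sup>2 * (NV (w t))\<^sup>2"
    using V0.bochner_L2D(1)[OF w]
  proof eventually_elim
    case (elim t)
    have "(L2_norm Q (\<gamma> (w t)))\<^sup>2 \<le> (trace_const * NV (w t))\<^sup>2"
      by (intro power_mono trace_bound(2)[OF V0_H1[OF elim]] L2_norm_nonneg)
    then show ?case by (simp add: power_mult_distrib)
  qed
  have I: "integrable ?M (\<lambda>t. trace_const\<^sup>2 * (NV (w t))\<^sup>2)" using V0.bochner_L2D(3)[OF w] by simp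
  show L2: "(\<lambda>t. \<gamma> (w t)) \<in> L2L2_space T Q" by (rule L2.bochner_L2I[OF sm mem I le])
  have "(L2L2_norm T Q (\<lambda>t. \<gamma> (w t)))\<^sup>2 \<le> (\<integral>t. trace_const\<^sup>2 * (NV (w t))\<^sup>2 \<partial>?M)"
    unfolding L2L2_norm_power2 by (rule integral_mono_AE[OF L2.bochner_L2D(3)[OF L2] I le])
  also have "\<dots> = (trace_const * bochner_norm T NV w)\<^sup>2"
    by (simp add: bochner_norm_eq L2_norm_power2 power_mult_distrib)
  finally show "L2L2_norm T Q (\<lambda>t. \<gamma> (w t)) \<le> trace_const * bochner_norm T NV w"
    by (rule power2_le_imp_le) (simp add: bochner_norm_eq L2_norm_nonneg trace_bound(1))
qed

text \<open>The energy is the difference of two squared norms, each integrable in time. The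
  gradients are chosen separately for each \<open>t\<close>, so joint measurability of the gradient
  could not be relied on.\<close>

lemma energy_integrable:
  assumes w: "w \<in> \<V>"
  shows "integrable (time_measure T) (\<lambda>t. energy_form \<Omega> (w t) (w t))"
proof -
  have "integrable (time_measure T) (\<lambda>t. (NV (w t))\<^sup>2 - (L2_norm H (w t))\<^sup>2)"
    by (intro Bochner_Integration.integrable_diff V0.bochner_L2D(3)[OF w] L2.bochner_L2D(3)[OF bochner_V0_L2L2[OF w]])
  then show ?thesis by (simp add: H1_norm_power2)
qed

lemma energy_form_integrable:
  assumes w: "w \<in> \<V>" and v: "v \<in> V\<^sub>0"
  shows "integrable (time_measure T) (\<lambda>t. energy_form \<Omega> (w t) v)"
proof -
  note c = V0.bochner_L2_const[OF v, of T]
  let ?f = "\<lambda>t. (energy_form \<Omega> (\<lambda>x. w t x + 1 * v x) (\<lambda>x. w t x + 1 * v x)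
      - energy_form \<Omega> (w t) (w t) - energy_form \<Omega> v v) / 2"
  have I: "integrable (time_measure T) ?f"
    using energy_integrable[OF w] energy_integrable[OF c] energy_integrable[OF V0.bochner_L2_add_mult[OF w c, of 1]]
    by simp
  show ?thesis
  proof (rule time_integral_cong_AE(1)[OF I])
    show "AE t in time_measure T. ?f t = energy_form \<Omega> (w t) v"
      using V0.bochner_L2D(1)[OF w]
      by eventually_elim (rule energy_form_polarization[OF V0_H1 V0_H1[OF v], symmetric])
  qed
qed

lemma trace_inner_integrable:
  assumes f: "f \<in> L2L2_space T Q" and v: "v \<in> V\<^sub>0"
  shows "integrable (time_measure T) (\<lambda>t. L2_inner Q (f t) (\<gamma> v))"
  by (rule L2L2_inner_integrable[OF f L2.bochner_L2_const[OF trace_L2[OF V0_H1[OF v]]]])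

text \<open>What the equation leaves for the time derivative of a difference of two states with the
  same \<open>g\<close> and flux difference \<open>f\<close>.\<close>

definition heat_form :: "(real \<Rightarrow> 'a \<Rightarrow> real) \<Rightarrow> (real \<Rightarrow> 'a \<Rightarrow> real) \<Rightarrow> real \<Rightarrow> ('a \<Rightarrow> real) \<Rightarrow> real" where
  "heat_form w f t v = - (energy_form \<Omega> (w t) v + L2_inner Q (f t) (\<gamma> v))"

lemma heat_form_integrable:
  assumes "w \<in> \<V>" "f \<in> L2L2_space T Q" "v \<in> V\<^sub>0"
  shows "integrable (time_measure T) (\<lambda>t. heat_form w f t v)"
  using energy_form_integrable[OF assms(1,3)] trace_inner_integrable[OF assms(2,3)]
  by (simp add: heat_form_def)

lemma form_family_heat:
  assumes w: "w \<in> \<V>" and f: "f \<in> L2L2_space T Q"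
  shows "form_family V\<^sub>0 NV T (heat_form w f)
    (\<lambda>t. NV (w t) + trace_const * L2_norm Q (f t))"
proof
  let ?M = "time_measure T"
  show "(\<lambda>t. heat_form w f t v) \<in> borel_measurable ?M" if v: "v \<in> V\<^sub>0" for v
    by (rule borel_measurable_integrable[OF heat_form_integrable[OF w f v]])
  show "AE t in ?M. \<forall>u\<in>V\<^sub>0. \<forall>v\<in>V\<^sub>0. \<forall>c.
      heat_form w f t (\<lambda>x. u x + c * v x) = heat_form w f t u + c * heat_form w f t v"
    using V0.bochner_L2D(1)[OF w] L2.bochner_L2D(1)[OF f]
  proof eventually_elim
    case (elim t)
    show ?case
    proof (intro ballI allI)
      fix u v c assume u: "u \<in> V\<^sub>0" and v: "v \<in> V\<^sub>0"
      have "energy_form \<Omega> (w t) (\<lambda>x. u x + c * v x) = energy_form \<Omega> (w t) u + c * energy_form \<Omega> (w t) v"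
        using energy_form_add_mult_left[OF V0_H1[OF u] V0_H1[OF v] V0_H1[OF elim(1)], of c]
        by (simp only: energy_form_commute[of "w t"])
      then show "heat_form w f t (\<lambda>x. u x + c * v x) = heat_form w f t u + c * heat_form w f t v"
        by (simp add: heat_form_def inner_trace_add_mult[OF elim(2) V0_H1[OF u] V0_H1[OF v]] algebra_simps)
    qed
  qed
  show "AE t in ?M. \<forall>v\<in>V\<^sub>0. \<bar>heat_form w f t v\<bar>
      \<le> (NV (w t) + trace_const * L2_norm Q (f t)) * NV v"
    using V0.bochner_L2D(1)[OF w] L2.bochner_L2D(1)[OF f]
  proof eventually_elim
    case (elim t)
    show ?case
    proof
      fix v assume v: "v \<in> V\<^sub>0"
      have 1: "\<bar>energy_form \<Omega> (w t) v\<bar> \<le> NV (w t) * NV v"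
        by (rule energy_form_bound[OF V0_H1[OF elim(1)] V0_H1[OF v]])
      have "\<bar>L2_inner Q (f t) (\<gamma> v)\<bar> \<le> L2_norm Q (f t) * L2_norm Q (\<gamma> v)"
        by (rule L2_Cauchy_Schwarz[OF elim(2) trace_L2[OF V0_H1[OF v]]])
      also have "\<dots> \<le> L2_norm Q (f t) * (trace_const * NV v)"
        by (intro mult_left_mono trace_bound(2) V0_H1[OF v] L2_norm_nonneg)
      finally show "\<bar>heat_form w f t v\<bar>
          \<le> (NV (w t) + trace_const * L2_norm Q (f t)) * NV v"
        using 1 by (simp add: heat_form_def algebra_simps)
    qed
  qed
  show "(\<lambda>t. NV (w t) + trace_const * L2_norm Q (f t)) \<in> L2_space ?M"
    by (rule L2.add_mult_mem[OF V0.bochner_L2D(5)[OF w] L2.bochner_L2D(5)[OF f]])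
qed

end


context mixed_heat_problem
begin

text \<open>Differences of states with the same \<open>g\<close>. The time derivative is eliminated by means of the
  equation, so that the dual space of \<open>V\<^sub>0\<close> plays no role.\<close>

definition zero_data_solution :: "(real \<Rightarrow> 'a \<Rightarrow> real) \<Rightarrow> (real \<Rightarrow> 'a \<Rightarrow> real) \<Rightarrow> bool" where
  "zero_data_solution w f \<longleftrightarrow> w \<in> \<V> \<and> f \<in> L2L2_space T Q \<and> has_initial_value \<Omega> T w (\<lambda>x. 0) \<and>
     (\<forall>\<phi>. test_function {0<..<T} \<phi> \<longrightarrow> (\<forall>v\<in>V\<^sub>0.
        (\<integral>t. heat_form w f t v * \<phi> t \<partial>time_measure T) =
        - (\<integral>t. L2_inner H (w t) v * deriv \<phi> t \<partial>time_measure T)))"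

lemma zero_data_solutionD:
  assumes "zero_data_solution w f"
  shows "w \<in> \<V>" "f \<in> L2L2_space T Q" "has_initial_value \<Omega> T w (\<lambda>x. 0)"
    "\<And>\<phi> v. test_function {0<..<T} \<phi> \<Longrightarrow> v \<in> V\<^sub>0 \<Longrightarrow>
      (\<integral>t. heat_form w f t v * \<phi> t \<partial>time_measure T) =
      - (\<integral>t. L2_inner H (w t) v * deriv \<phi> t \<partial>time_measure T)"
  using assms unfolding zero_data_solution_def by auto

lemma time_continuous_measurable:
  fixes \<phi> :: "real \<Rightarrow> real"
  shows "continuous_on UNIV \<phi> \<Longrightarrow> \<phi> \<in> borel_measurable (time_measure T)"
  by (rule continuous_imp_measurable_on_sets_lebesgue[OF continuous_on_subset]) auto

lemma integrable_mult_test_time: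
  assumes "integrable (time_measure T) u" "test_function {0<..<T} \<phi>"
  shows "integrable (time_measure T) (\<lambda>t. u t * \<phi> t)" "integrable (time_measure T) (\<lambda>t. u t * deriv \<phi> t)"
proof -
  obtain C where "\<And>t. \<bar>\<phi> t\<bar> \<le> C" using test_function_bounded[OF assms(2)] by blast
  then show "integrable (time_measure T) (\<lambda>t. u t * \<phi> t)"
    by (rule integrable_mult_bounded[OF assms(1) time_continuous_measurable[OF test_function_continuous[OF assms(2)]]])
  obtain C where "\<And>t. \<bar>deriv \<phi> t\<bar> \<le> C" using test_function_deriv(3)[OF assms(2)] by blast
  then show "integrable (time_measure T) (\<lambda>t. u t * deriv \<phi> t)"
    by (rule integrable_mult_bounded[OF assms(1) time_continuous_measurable[OF test_function_deriv(2)[OF assms(2)]]])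
qed

lemma inner_integrable:
  assumes "u \<in> L2L2_space T H" "v \<in> L2_space H"
  shows "integrable (time_measure T) (\<lambda>t. L2_inner H (u t) v)"
  by (rule L2L2_inner_integrable[OF assms(1) L2.bochner_L2_const[OF assms(2)]])

text \<open>Nonnegativity of the paired time derivative reads
  \<open>\<integral> a(w, w) \<le> - (f, \<gamma> w)\<close>. Coercivity bounds the left side from
  below, Cauchy-Schwarz and the trace constant bound the right side from above.\<close>

lemma zero_data_solution_energy:
  assumes "zero_data_solution w f"
  shows "lam * (bochner_norm T NV w)\<^sup>2 \<le> trace_const * L2L2_norm T Q f * bochner_norm T NV w"
proof -
  let ?M = "time_measure T"
  note z = zero_data_solutionD[OF assms]
  obtain W where W: "\<forall>t\<in>{0..T}. W t \<in> L2_space H"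
    and W_cont: "\<forall>t\<in>{0..T}. ((\<lambda>s. L2_norm H (\<lambda>x. W s x - W t x)) \<longlongrightarrow> 0) (at t within {0..T})"
    and Ww: "AE t in ?M. AE x in H. W t x = w t x" and W_0: "AE x in H. W 0 x = 0"
    using z(3) unfolding has_initial_value_def ae_eq_def by (elim exE conjE) (rule that)
  note W = W[rule_format] and W_cont = W_cont[rule_format]
  \<comment> \<open>For the continuous representative the weak derivative has an exact primitive at
    every \<open>t\<close>, with no exceptional set depending on \<open>v\<close>.\<close>
  have W_B: "L2_inner H (W t) v = primitive T (\<lambda>s. heat_form w f s v) t" if v: "v \<in> V\<^sub>0" and t: "t \<in> {0..T}" for v t
  proof -
    have vL2: "v \<in> L2_space H" using V0_L2 v by blast
    have p: "continuous_on {0..T} (\<lambda>t. L2_inner H (W t) v)"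
      unfolding continuous_on_def
    proof
      fix t assume t: "t \<in> {0..T}"
      have "((\<lambda>s. L2_inner H (W s) v - L2_inner H (W t) v) \<longlongrightarrow> 0) (at t within {0..T})"
      proof (rule Lim_null_comparison)
        have "norm (L2_inner H (W s) v - L2_inner H (W t) v) \<le> L2_norm H (\<lambda>x. W s x - W t x) * L2_norm H v"
          if s: "s \<in> {0..T}" for s
        proof -
          have "L2_inner H (W s) v - L2_inner H (W t) v = L2_inner H (\<lambda>x. W s x - W t x) v"
            using L2_inner_add_scaleR_left[OF W[OF s] W[OF t] vL2, of "-1"] by simp
          then show ?thesis using L2_Cauchy_Schwarz[OF L2.diff_mem[OF W[OF s] W[OF t]] vL2] by simp
        qed
        then show "\<forall>\<^sub>F s in at t within {0..T}. norm (L2_inner H (W s) v - L2_inner H (W t) v)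
            \<le> L2_norm H (\<lambda>x. W s x - W t x) * L2_norm H v"
          unfolding eventually_at_topological by blast
        show "((\<lambda>s. L2_norm H (\<lambda>x. W s x - W t x) * L2_norm H v) \<longlongrightarrow> 0) (at t within {0..T})"
          using tendsto_mult_right[OF W_cont[OF t], of "L2_norm H v"] by simp
      qed
      then show "((\<lambda>t. L2_inner H (W t) v) \<longlongrightarrow> L2_inner H (W t) v) (at t within {0..T})"
        by (rule LIM_zero_cancel)
    qed
    have p0: "L2_inner H (W 0) v = 0"
    proof -
      have W0: "W 0 \<in> L2_space H" using W[of 0] T_pos by simp
      have "\<bar>L2_inner H (W 0) v\<bar> \<le> L2_norm H (W 0) * L2_norm H v" by (rule L2_Cauchy_Schwarz[OF W0 vL2])
      also have "L2_norm H (W 0) = 0" by (rule L2_norm_eq_0[OF W_0 L2_spaceD(1)[OF W0]])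
      finally show ?thesis by simp
    qed
    have weak: "(\<integral>t. heat_form w f t v * \<phi> t \<partial>?M) = - (\<integral>t. L2_inner H (W t) v * deriv \<phi> t \<partial>?M)"
      if \<phi>: "test_function {0<..<T} \<phi>" for \<phi>
    proof -
      have "(\<integral>t. L2_inner H (w t) v * deriv \<phi> t \<partial>?M) = (\<integral>t. L2_inner H (W t) v * deriv \<phi> t \<partial>?M)"
      proof (rule time_integral_cong_AE(2))
        show "integrable ?M (\<lambda>t. L2_inner H (W t) v * deriv \<phi> t)"
          by (rule integrable_mult_test_time(2)[OF time_integral_eq_integral(1)[OF p] \<phi>])
        show "AE t in ?M. L2_inner H (W t) v * deriv \<phi> t = L2_inner H (w t) v * deriv \<phi> t"
          using Ww V0.bochner_L2D(1)[OF z(1)] AE_space[of ?M]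
        proof eventually_elim
          case (elim t)
          have Wt: "W t \<in> L2_space H" using W elim(3) by simp
          have wt: "w t \<in> L2_space H" using V0_L2 elim(2) by blast
          have "L2_inner H (w t) v = L2_inner H (W t) v"
            unfolding L2_inner_def
          proof (rule integral_cong_AE)
            show "AE x in H. w t x \<bullet> v x = W t x \<bullet> v x" using elim(1) by eventually_elim simp
          qed (rule borel_measurable_integrable[OF L2_integrable_inner[OF wt vL2]]
              borel_measurable_integrable[OF L2_integrable_inner[OF Wt vL2]])+
          then show ?case by simp
        qed
      qed
      then show ?thesis using z(4)[OF \<phi> v] by simp
    qed
    show ?thesis by (rule continuous_weak_derivative_primitive[OF T_pos heat_form_integrable[OF z(1,2) v] p p0 weak t])
  qed
  have "0 \<le> (\<integral>t. heat_form w f t (w t) \<partial>?M)"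
    by (rule form_family.energy_nonneg[OF form_family_heat[OF z(1,2)] T_pos V0_L2 W W_cont W_0 z(1) Ww W_B])
  also have "\<dots> = - (\<integral>t. energy_form \<Omega> (w t) (w t) \<partial>?M) - L2L2_inner T Q f (\<lambda>t. \<gamma> (w t))"
    unfolding heat_form_def L2L2_inner_def
    using energy_integrable[OF z(1)] L2L2_inner_integrable[OF z(2) trace_bochner(1)[OF z(1)]] by simp
  finally have 1: "(\<integral>t. energy_form \<Omega> (w t) (w t) \<partial>?M) \<le> - L2L2_inner T Q f (\<lambda>t. \<gamma> (w t))" by simp
  have "lam * (bochner_norm T NV w)\<^sup>2 = (\<integral>t. lam * (NV (w t))\<^sup>2 \<partial>?M)"
    by (simp add: bochner_norm_eq L2_norm_power2)
  also have "\<dots> \<le> (\<integral>t. energy_form \<Omega> (w t) (w t) \<partial>?M)"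
  proof (rule integral_mono_AE)
    show "integrable ?M (\<lambda>t. lam * (NV (w t))\<^sup>2)" using V0.bochner_L2D(3)[OF z(1)] by simp
    show "AE t in ?M. lam * (NV (w t))\<^sup>2 \<le> energy_form \<Omega> (w t) (w t)"
      using V0.bochner_L2D(1)[OF z(1)] by eventually_elim (rule coercive)
  qed (rule energy_integrable[OF z(1)])
  also note 1
  also have "- L2L2_inner T Q f (\<lambda>t. \<gamma> (w t)) \<le> L2L2_norm T Q f * L2L2_norm T Q (\<lambda>t. \<gamma> (w t))"
    using L2L2_Cauchy_Schwarz[OF z(2) trace_bochner(1)[OF z(1)]] by simp
  also have "\<dots> \<le> L2L2_norm T Q f * (trace_const * bochner_norm T NV w)"
    by (rule mult_left_mono[OF trace_bochner(2)[OF z(1)] L2L2_norm_nonneg])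
  finally show ?thesis by (simp add: algebra_simps)
qed

lemma has_initial_value_add_mult:
  assumes u: "has_initial_value \<Omega> T u u\<^sub>0" and v: "has_initial_value \<Omega> T v v\<^sub>0"
  shows "has_initial_value \<Omega> T (\<lambda>t x. u t x + c * v t x) (\<lambda>x. u\<^sub>0 x + c * v\<^sub>0 x)"
proof -
  obtain U where U: "\<forall>t\<in>{0..T}. U t \<in> L2_space H"
    and U_cont: "\<forall>t\<in>{0..T}. ((\<lambda>s. L2_norm H (\<lambda>x. U s x - U t x)) \<longlongrightarrow> 0) (at t within {0..T})"
    and Uu: "AE t in time_measure T. AE x in H. U t x = u t x" and U_0: "AE x in H. U 0 x = u\<^sub>0 x"
    using u unfolding has_initial_value_def ae_eq_def by (elim exE conjE) (rule that)
  note U = U[rule_format] and U_cont = U_cont[rule_format]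
  obtain V where V: "\<forall>t\<in>{0..T}. V t \<in> L2_space H"
    and V_cont: "\<forall>t\<in>{0..T}. ((\<lambda>s. L2_norm H (\<lambda>x. V s x - V t x)) \<longlongrightarrow> 0) (at t within {0..T})"
    and Vv: "AE t in time_measure T. AE x in H. V t x = v t x" and V_0: "AE x in H. V 0 x = v\<^sub>0 x"
    using v unfolding has_initial_value_def ae_eq_def by (elim exE conjE) (rule that)
  note V = V[rule_format] and V_cont = V_cont[rule_format]
  show ?thesis
    unfolding has_initial_value_def ae_eq_def
  proof (rule exI[of _ "\<lambda>t x. U t x + c * V t x"], intro conjI ballI)
    fix t assume t: "t \<in> {0..T}"
    show "(\<lambda>x. U t x + c * V t x) \<in> L2_space H" by (rule L2.add_mult_mem[OF U[OF t] V[OF t]])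
    show "((\<lambda>s. L2_norm H (\<lambda>x. (U s x + c * V s x) - (U t x + c * V t x))) \<longlongrightarrow> 0) (at t within {0..T})"
    proof (rule Lim_null_comparison)
      have "norm (L2_norm H (\<lambda>x. (U s x + c * V s x) - (U t x + c * V t x))) \<le>
          L2_norm H (\<lambda>x. U s x - U t x) + \<bar>c\<bar> * L2_norm H (\<lambda>x. V s x - V t x)" if s: "s \<in> {0..T}" for s
      proof -
        have "(\<lambda>x. (U s x + c * V s x) - (U t x + c * V t x)) = (\<lambda>x. (U s x - U t x) + c * (V s x - V t x))"
          by (simp add: algebra_simps)
        then show ?thesis
          using L2.N_add_mult_le[OF L2.diff_mem[OF U[OF s] U[OF t]] L2.diff_mem[OF V[OF s] V[OF t]], of c]
          by (simp add: L2_norm_nonneg)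
      qed
      then show "\<forall>\<^sub>F s in at t within {0..T}. norm (L2_norm H (\<lambda>x. (U s x + c * V s x) - (U t x + c * V t x)))
          \<le> L2_norm H (\<lambda>x. U s x - U t x) + \<bar>c\<bar> * L2_norm H (\<lambda>x. V s x - V t x)"
        unfolding eventually_at_topological by blast
      show "((\<lambda>s. L2_norm H (\<lambda>x. U s x - U t x) + \<bar>c\<bar> * L2_norm H (\<lambda>x. V s x - V t x)) \<longlongrightarrow> 0) (at t within {0..T})"
        using tendsto_add[OF U_cont[OF t] tendsto_mult_left[OF V_cont[OF t], of "\<bar>c\<bar>"]] by simp
    qed
  next
    show "AE t in time_measure T. AE x in H. U t x + c * V t x = u t x + c * v t x"
      using Uu Vv
    proof eventually_elim
      case (elim t)
      then show ?case by eventually_elim simp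
    qed
    show "AE x in H. U 0 x + c * V 0 x = u\<^sub>0 x + c * v\<^sub>0 x"
      using U_0 V_0 by eventually_elim simp
  qed
qed

lemma zero_data_solution_add_mult:
  assumes "zero_data_solution w f" "zero_data_solution w' f'"
  shows "zero_data_solution (\<lambda>t x. w t x + c * w' t x) (\<lambda>t x. f t x + c * f' t x)"
  unfolding zero_data_solution_def
proof (intro conjI allI impI ballI)
  let ?M = "time_measure T"
  note z = zero_data_solutionD[OF assms(1)] and z' = zero_data_solutionD[OF assms(2)]
  show ww: "(\<lambda>t x. w t x + c * w' t x) \<in> \<V>" by (rule V0.bochner_L2_add_mult[OF z(1) z'(1)])
  show ff: "(\<lambda>t x. f t x + c * f' t x) \<in> L2L2_space T Q" by (rule L2.bochner_L2_add_mult[OF z(2) z'(2)])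
  show "has_initial_value \<Omega> T (\<lambda>t x. w t x + c * w' t x) (\<lambda>x. 0)"
    using has_initial_value_add_mult[OF z(3) z'(3), of c] by simp
  fix \<phi> v assume \<phi>: "test_function {0<..<T} \<phi>" and v: "v \<in> V\<^sub>0"
  have vL2: "v \<in> L2_space H" using V0_L2 v by blast
  have I: "integrable ?M (\<lambda>t. heat_form u g t v * \<phi> t)" if "u \<in> \<V>" "g \<in> L2L2_space T Q" for u g
    by (rule integrable_mult_test_time(1)[OF heat_form_integrable[OF that v] \<phi>])
  have J: "integrable ?M (\<lambda>t. L2_inner H (u t) v * deriv \<phi> t)" if "u \<in> \<V>" for u
    by (rule integrable_mult_test_time(2)[OF inner_integrable[OF bochner_V0_L2L2[OF that] vL2] \<phi>])
  have "(\<integral>t. heat_form (\<lambda>t x. w t x + c * w' t x) (\<lambda>t x. f t x + c * f' t x) t v * \<phi> t \<partial>?M) =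
      (\<integral>t. heat_form w f t v * \<phi> t + c * (heat_form w' f' t v * \<phi> t) \<partial>?M)"
  proof (rule time_integral_cong_AE(2))
    show "AE t in ?M. heat_form w f t v * \<phi> t + c * (heat_form w' f' t v * \<phi> t) =
        heat_form (\<lambda>t x. w t x + c * w' t x) (\<lambda>t x. f t x + c * f' t x) t v * \<phi> t"
      using V0.bochner_L2D(1)[OF z(1)] V0.bochner_L2D(1)[OF z'(1)] L2.bochner_L2D(1)[OF z(2)] L2.bochner_L2D(1)[OF z'(2)]
    proof eventually_elim
      case (elim t)
      have "energy_form \<Omega> (\<lambda>x. w t x + c * w' t x) v = energy_form \<Omega> (w t) v + c * energy_form \<Omega> (w' t) v"
        by (rule energy_form_add_mult_left[OF V0_H1[OF elim(1)] V0_H1[OF elim(2)] V0_H1[OF v]])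
      moreover have "L2_inner Q (\<lambda>x. f t x + c * f' t x) (\<gamma> v) = L2_inner Q (f t) (\<gamma> v) + c * L2_inner Q (f' t) (\<gamma> v)"
        using L2_inner_add_scaleR_left[OF elim(3,4) trace_L2[OF V0_H1[OF v]], of c] by simp
      ultimately show ?case by (simp add: heat_form_def algebra_simps)
    qed
  qed (use I[OF z(1,2)] I[OF z'(1,2)] in simp)
  also have "\<dots> = (\<integral>t. heat_form w f t v * \<phi> t \<partial>?M) + c * (\<integral>t. heat_form w' f' t v * \<phi> t \<partial>?M)"
    using I[OF z(1,2)] I[OF z'(1,2)] by simp
  also have "\<dots> = - ((\<integral>t. L2_inner H (w t) v * deriv \<phi> t \<partial>?M) + c * (\<integral>t. L2_inner H (w' t) v * deriv \<phi> t \<partial>?M))"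
    using z(4)[OF \<phi> v] z'(4)[OF \<phi> v] by simp
  also have "(\<integral>t. L2_inner H (w t) v * deriv \<phi> t \<partial>?M) + c * (\<integral>t. L2_inner H (w' t) v * deriv \<phi> t \<partial>?M) =
      (\<integral>t. L2_inner H (w t) v * deriv \<phi> t + c * (L2_inner H (w' t) v * deriv \<phi> t) \<partial>?M)"
    using J[OF z(1)] J[OF z'(1)] by simp
  also have "\<dots> = (\<integral>t. L2_inner H (\<lambda>x. w t x + c * w' t x) v * deriv \<phi> t \<partial>?M)"
  proof (rule time_integral_cong_AE(2)[symmetric])
    show "AE t in ?M. L2_inner H (w t) v * deriv \<phi> t + c * (L2_inner H (w' t) v * deriv \<phi> t) =
        L2_inner H (\<lambda>x. w t x + c * w' t x) v * deriv \<phi> t"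
      using V0.bochner_L2D(1)[OF z(1)] V0.bochner_L2D(1)[OF z'(1)]
    proof eventually_elim
      case (elim t)
      have "w t \<in> L2_space H" "w' t \<in> L2_space H" using elim V0_L2 by blast+
      from L2_inner_add_scaleR_left[OF this vL2, of c] show ?case by (simp add: algebra_simps)
    qed
  qed (use J[OF z(1)] J[OF z'(1)] in simp)
  finally show "(\<integral>t. heat_form (\<lambda>t x. w t x + c * w' t x) (\<lambda>t x. f t x + c * f' t x) t v * \<phi> t \<partial>?M) =
      - (\<integral>t. L2_inner H (\<lambda>x. w t x + c * w' t x) v * deriv \<phi> t \<partial>?M)" .
qed

text \<open>\<open>g\<close> and the lifting \<open>v\<^sub>b\<close> cancel in the difference. The
  equation is solved for the time derivative of each state before subtracting, so everything is
  expressed by integrable terms.\<close>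

lemma heat_solution_diff:
  assumes v\<^sub>b: "v\<^sub>b \<in> H1_space \<Omega>" and g: "g \<in> L2L2_space T H"
    and q: "q \<in> L2L2_space T Q" "q' \<in> L2L2_space T Q"
    and u: "is_heat_solution \<Omega> \<Gamma>\<^sub>1 \<Gamma>\<^sub>2 T \<gamma> v\<^sub>b g q u" and w: "is_heat_solution \<Omega> \<Gamma>\<^sub>1 \<Gamma>\<^sub>2 T \<gamma> v\<^sub>b g q' w"
  shows "zero_data_solution (\<lambda>t x. u t x - w t x) (\<lambda>t x. q t x - q' t x)"
  unfolding zero_data_solution_def
proof (intro conjI allI impI ballI)
  let ?M = "time_measure T"
  define U where "U = (\<lambda>t x. u t x - v\<^sub>b x)"
  define W where "W = (\<lambda>t x. w t x - v\<^sub>b x)"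
  have U: "U \<in> \<V>" and W: "W \<in> \<V>"
    using u w unfolding is_heat_solution_def Let_def U_def W_def by auto
  have uw: "(\<lambda>t x. u t x - w t x) = (\<lambda>t x. U t x - W t x)" by (simp add: U_def W_def)
  show mem: "(\<lambda>t x. u t x - w t x) \<in> \<V>" unfolding uw by (rule V0.bochner_L2_diff[OF U W])
  show "(\<lambda>t x. q t x - q' t x) \<in> L2L2_space T Q" by (rule L2.bochner_L2_diff[OF q])
  have "has_initial_value \<Omega> T u v\<^sub>b" "has_initial_value \<Omega> T w v\<^sub>b"
    using u w unfolding is_heat_solution_def Let_def by auto
  from has_initial_value_add_mult[OF this, of "-1"]
  show "has_initial_value \<Omega> T (\<lambda>t x. u t x - w t x) (\<lambda>x. 0)" by simp
  fix \<phi> v assume \<phi>: "test_function {0<..<T} \<phi>" and v: "v \<in> V\<^sub>0"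
  have vL2: "v \<in> L2_space H" using V0_L2 v by blast
  have vbL2: "v\<^sub>b \<in> L2_space H" by (rule H1_spaceD(1)[OF v\<^sub>b])
  \<comment> \<open>The time derivative applied to \<open>v\<close>, read off from the equation. The
    state is split as \<open>y + v\<^sub>b\<close> with \<open>y\<close> in \<open>\<V>\<close>,
    because integrability of the energy form in time is available there.\<close>
  define r where "r = (\<lambda>p y t. L2_inner H (g t) v - L2_inner Q (p t) (\<gamma> v) - (energy_form \<Omega> (y t) v + energy_form \<Omega> v\<^sub>b v))"
  have r_int: "integrable ?M (r p y)" if "p \<in> L2L2_space T Q" "y \<in> \<V>" for p y
    unfolding r_def
    using inner_integrable[OF g vL2] trace_inner_integrable[OF that(1) v] energy_form_integrable[OF that(2) v]
      finite_measure.integrable_const[OF finite_time_measure]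
    by (intro Bochner_Integration.integrable_diff Bochner_Integration.integrable_add)
  have state_L2: "(\<lambda>t x. y t x + 1 * v\<^sub>b x) \<in> L2L2_space T H" if "y \<in> \<V>" for y
    by (rule L2.bochner_L2_add_mult[OF bochner_V0_L2L2[OF that] L2.bochner_L2_const[OF vbL2]])
  have weak: "(\<integral>t. r p (\<lambda>t x. y t x - v\<^sub>b x) t * \<phi> t \<partial>?M) = - (\<integral>t. L2_inner H (y t) v * deriv \<phi> t \<partial>?M)"
    if p: "p \<in> L2L2_space T Q" and y: "is_heat_solution \<Omega> \<Gamma>\<^sub>1 \<Gamma>\<^sub>2 T \<gamma> v\<^sub>b g p y" for p y
  proof -
    have Y: "(\<lambda>t x. y t x - v\<^sub>b x) \<in> \<V>" using y unfolding is_heat_solution_def Let_def by blast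
    obtain y' where y': "is_weak_time_derivative \<Omega> T V\<^sub>0 y y'"
      and eq: "AE t in ?M. \<forall>v\<in>V\<^sub>0. y' t v + energy_form \<Omega> (y t) v = L2_inner H (g t) v - L2_inner Q (p t) (\<gamma> v)"
      using y unfolding is_heat_solution_def Let_def by blast
    have ae: "AE t in ?M. r p (\<lambda>t x. y t x - v\<^sub>b x) t * \<phi> t = y' t v * \<phi> t"
      using eq V0.bochner_L2D(1)[OF Y]
    proof eventually_elim
      case (elim t)
      have "energy_form \<Omega> (y t) v = energy_form \<Omega> (\<lambda>x. y t x - v\<^sub>b x) v + energy_form \<Omega> v\<^sub>b v"
        using energy_form_add_mult_left[OF V0_H1[OF elim(2)] v\<^sub>b V0_H1[OF v], of 1] by simp
      moreover have "y' t v + energy_form \<Omega> (y t) v = L2_inner H (g t) v - L2_inner Q (p t) (\<gamma> v)"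
        using elim(1) v by blast
      ultimately have "y' t v = r p (\<lambda>t x. y t x - v\<^sub>b x) t" unfolding r_def by simp
      then show ?case by simp
    qed
    have "(\<integral>t. r p (\<lambda>t x. y t x - v\<^sub>b x) t * \<phi> t \<partial>?M) = (\<integral>t. y' t v * \<phi> t \<partial>?M)"
      by (rule time_integral_cong_AE(2)[OF integrable_mult_test_time(1)[OF r_int[OF p Y] \<phi>] ae, symmetric])
    also have "\<dots> = - (\<integral>t. L2_inner H (y t) v * deriv \<phi> t \<partial>?M)"
      using y' \<phi> v unfolding is_weak_time_derivative_def by blast
    finally show ?thesis .
  qed
  have uL2: "u \<in> L2L2_space T H" and wL2: "w \<in> L2L2_space T H"
    using state_L2[OF U] state_L2[OF W] by (simp_all add: U_def W_def)
  note J = integrable_mult_test_time(2)[OF inner_integrable[OF _ vL2] \<phi>]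
  have "(\<integral>t. heat_form (\<lambda>t x. u t x - w t x) (\<lambda>t x. q t x - q' t x) t v * \<phi> t \<partial>?M) =
      (\<integral>t. r q U t * \<phi> t - r q' W t * \<phi> t \<partial>?M)"
  proof (rule time_integral_cong_AE(2))
    show "integrable ?M (\<lambda>t. r q U t * \<phi> t - r q' W t * \<phi> t)"
      by (intro Bochner_Integration.integrable_diff integrable_mult_test_time(1) r_int q U W \<phi>)
    show "AE t in ?M. r q U t * \<phi> t - r q' W t * \<phi> t =
        heat_form (\<lambda>t x. u t x - w t x) (\<lambda>t x. q t x - q' t x) t v * \<phi> t"
      using V0.bochner_L2D(1)[OF U] V0.bochner_L2D(1)[OF W] L2.bochner_L2D(1)[OF q(1)] L2.bochner_L2D(1)[OF q(2)]
    proof eventually_elim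
      case (elim t)
      have e1: "energy_form \<Omega> (\<lambda>x. u t x - w t x) v = energy_form \<Omega> (U t) v - energy_form \<Omega> (W t) v"
        using energy_form_add_mult_left[OF V0_H1[OF elim(1)] V0_H1[OF elim(2)] V0_H1[OF v], of "-1"]
        by (simp add: U_def W_def)
      have e2: "L2_inner Q (\<lambda>x. q t x - q' t x) (\<gamma> v) = L2_inner Q (q t) (\<gamma> v) - L2_inner Q (q' t) (\<gamma> v)"
        using L2_inner_add_scaleR_left[OF elim(3,4) trace_L2[OF V0_H1[OF v]], of "-1"] by simp
      show ?case unfolding heat_form_def e1 e2 by (simp add: r_def algebra_simps)
    qed
  qed
  also have "\<dots> = (\<integral>t. r q U t * \<phi> t \<partial>?M) - (\<integral>t. r q' W t * \<phi> t \<partial>?M)"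
    by (intro Bochner_Integration.integral_diff integrable_mult_test_time(1) r_int q U W \<phi>)
  also have "\<dots> = - ((\<integral>t. L2_inner H (u t) v * deriv \<phi> t \<partial>?M) - (\<integral>t. L2_inner H (w t) v * deriv \<phi> t \<partial>?M))"
    using weak[OF q(1) u] weak[OF q(2) w] by (simp add: U_def W_def)
  also have "(\<integral>t. L2_inner H (u t) v * deriv \<phi> t \<partial>?M) - (\<integral>t. L2_inner H (w t) v * deriv \<phi> t \<partial>?M) =
      (\<integral>t. L2_inner H (u t) v * deriv \<phi> t - L2_inner H (w t) v * deriv \<phi> t \<partial>?M)"
    using J[OF uL2] J[OF wL2] by simp
  also have "\<dots> = (\<integral>t. L2_inner H (\<lambda>x. u t x - w t x) v * deriv \<phi> t \<partial>?M)"
  proof (rule time_integral_cong_AE(2)[symmetric])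
    show "AE t in ?M. L2_inner H (u t) v * deriv \<phi> t - L2_inner H (w t) v * deriv \<phi> t =
        L2_inner H (\<lambda>x. u t x - w t x) v * deriv \<phi> t"
      using L2.bochner_L2D(1)[OF uL2] L2.bochner_L2D(1)[OF wL2]
    proof eventually_elim
      case (elim t)
      from L2_inner_add_scaleR_left[OF elim vL2, of "-1"]
      have e: "L2_inner H (\<lambda>x. u t x - w t x) v = L2_inner H (u t) v - L2_inner H (w t) v" by simp
      show ?case unfolding e by (simp add: algebra_simps)
    qed
  qed (use J[OF uL2] J[OF wL2] in simp)
  finally show "(\<integral>t. heat_form (\<lambda>t x. u t x - w t x) (\<lambda>t x. q t x - q' t x) t v * \<phi> t \<partial>?M) =
      - (\<integral>t. L2_inner H (\<lambda>x. u t x - w t x) v * deriv \<phi> t \<partial>?M)" .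
qed

section \<open>Stability of the state with respect to the flux\<close>

lemma L2L2_norm_le_V0_norm:
  assumes w: "w \<in> \<V>"
  shows "L2L2_norm T H w \<le> bochner_norm T NV w"
proof (rule power2_le_imp_le)
  have "AE t in time_measure T. (L2_norm H (w t))\<^sup>2 \<le> (NV (w t))\<^sup>2"
    by (intro AE_I2 power_mono L2_norm_le_H1_norm L2_norm_nonneg)
  then have "(\<integral>t. (L2_norm H (w t))\<^sup>2 \<partial>time_measure T) \<le> (\<integral>t. (NV (w t))\<^sup>2 \<partial>time_measure T)"
    by (rule integral_mono_AE[OF L2.bochner_L2D(3)[OF bochner_V0_L2L2[OF w]] V0.bochner_L2D(3)[OF w]])
  then show "(L2L2_norm T H w)\<^sup>2 \<le> (bochner_norm T NV w)\<^sup>2"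
    by (simp add: L2L2_norm_power2 bochner_norm_eq[of T NV] L2_norm_power2)
qed (simp add: bochner_norm_eq L2_norm_nonneg)

text \<open>One factor of the \<open>V0\<close> norm cancels in the energy estimate. That norm
  dominates the \<open>L2\<close> norm with constant 1, so no embedding constant enters besides
  \<open>lam\<close>.\<close>

lemma zero_data_solution_bound:
  assumes "zero_data_solution w f"
  shows "lam * L2L2_norm T H w \<le> trace_const * L2L2_norm T Q f"
proof -
  define n where "n = bochner_norm T NV w"
  have n: "0 \<le> n" by (simp add: n_def bochner_norm_eq L2_norm_nonneg)
  have "lam * n \<le> trace_const * L2L2_norm T Q f"
  proof (cases "n = 0")
    case True
    then show ?thesis using trace_bound(1) L2L2_norm_nonneg[of T Q f] by simp
  next
    case False
    have "(lam * n) * n \<le> (trace_const * L2L2_norm T Q f) * n"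
      using zero_data_solution_energy[OF assms] unfolding n_def by (simp add: power2_eq_square mult.assoc)
    then show ?thesis using n False by (simp add: mult_le_cancel_right)
  qed
  moreover have "lam * L2L2_norm T H w \<le> lam * n"
    using L2L2_norm_le_V0_norm[OF zero_data_solutionD(1)[OF assms]] lam_pos by (simp add: n_def)
  ultimately show ?thesis by linarith
qed

end


section \<open>Comparison of the two optimal fluxes\<close>

context mixed_heat_problem
begin

lemma heat_state_solution:
  assumes "heat_well_posed \<Omega> \<Gamma>\<^sub>1 \<Gamma>\<^sub>2 T \<gamma> v\<^sub>b" "g \<in> L2L2_space T H" "q \<in> L2L2_space T Q"
  shows "is_heat_solution \<Omega> \<Gamma>\<^sub>1 \<Gamma>\<^sub>2 T \<gamma> v\<^sub>b g q (heat_state \<Omega> \<Gamma>\<^sub>1 \<Gamma>\<^sub>2 T \<gamma> v\<^sub>b g q)"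
proof -
  have "\<exists>u. is_heat_solution \<Omega> \<Gamma>\<^sub>1 \<Gamma>\<^sub>2 T \<gamma> v\<^sub>b g q u"
    using assms unfolding heat_well_posed_def by blast
  then show ?thesis unfolding heat_state_def by (rule someI_ex)
qed

lemma heat_solution_mem:
  assumes "is_heat_solution \<Omega> \<Gamma>\<^sub>1 \<Gamma>\<^sub>2 T \<gamma> v\<^sub>b g q u" and v\<^sub>b: "v\<^sub>b \<in> H1_space \<Omega>"
  shows "(\<lambda>t x. u t x - v\<^sub>b x) \<in> \<V>" "u \<in> L2L2_space T H"
proof -
  show 1: "(\<lambda>t x. u t x - v\<^sub>b x) \<in> \<V>"
    using assms(1) unfolding is_heat_solution_def Let_def by blast
  show "u \<in> L2L2_space T H"
    using L2.bochner_L2_add_mult[OF bochner_V0_L2L2[OF 1] L2.bochner_L2_const[OF H1_spaceD(1)[OF v\<^sub>b]], of 1]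
    by simp
qed

text \<open>Compensates for the choice in \<open>heat_state\<close>: two functions that ought to be
  the same state differ by such a \<open>d\<close>, invisible to the cost.\<close>

lemma zero_data_solution_null:
  assumes "zero_data_solution d (\<lambda>t x. 0)"
  shows "L2L2_norm T H d = 0"
proof -
  have "L2L2_norm T Q (\<lambda>t x. 0) = 0" by (simp add: bochner_norm_def L2.N_zero)
  then have "lam * L2L2_norm T H d \<le> 0" using zero_data_solution_bound[OF assms] by simp
  then show ?thesis using lam_pos L2L2_norm_nonneg[of T H d] by (simp add: mult_le_0_iff)
qed

text \<open>Here \<open>w\<close> is the derivative of the state in direction \<open>f\<close>.\<close>

lemma minimizer_stationary:
  assumes wp: "heat_well_posed \<Omega> \<Gamma>\<^sub>1 \<Gamma>\<^sub>2 T \<gamma> v\<^sub>b" and v\<^sub>b: "v\<^sub>b \<in> H1_space \<Omega>"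
    and z\<^sub>d: "z\<^sub>d \<in> L2L2_space T H" and g: "g \<in> L2L2_space T H" and q: "q \<in> L2L2_space T Q"
    and M: "0 < M"
    and min: "\<And>p. p \<in> L2L2_space T Q \<Longrightarrow>
      J_1 \<Omega> \<Gamma>\<^sub>1 \<Gamma>\<^sub>2 T \<gamma> v\<^sub>b z\<^sub>d M M\<^sub>1 g q \<le> J_1 \<Omega> \<Gamma>\<^sub>1 \<Gamma>\<^sub>2 T \<gamma> v\<^sub>b z\<^sub>d M M\<^sub>1 g p"
    and w: "zero_data_solution w f"
  shows "L2L2_inner T H (\<lambda>t x. heat_state \<Omega> \<Gamma>\<^sub>1 \<Gamma>\<^sub>2 T \<gamma> v\<^sub>b g q t x - z\<^sub>d t x) w + M * L2L2_inner T Q q f = 0"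
proof -
  define S where "S = heat_state \<Omega> \<Gamma>\<^sub>1 \<Gamma>\<^sub>2 T \<gamma> v\<^sub>b g"
  note f = zero_data_solutionD(2)[OF w]
  have sol: "is_heat_solution \<Omega> \<Gamma>\<^sub>1 \<Gamma>\<^sub>2 T \<gamma> v\<^sub>b g p (S p)" if "p \<in> L2L2_space T Q" for p
    unfolding S_def by (rule heat_state_solution[OF wp g that])
  define y where "y = (\<lambda>t x. S q t x - z\<^sub>d t x)"
  have y: "y \<in> L2L2_space T H"
    unfolding y_def by (rule L2.bochner_L2_diff[OF heat_solution_mem(2)[OF sol[OF q] v\<^sub>b] z\<^sub>d])
  have wL2: "w \<in> L2L2_space T H" by (rule bochner_V0_L2L2[OF zero_data_solutionD(1)[OF w]])
  define k where "k = L2L2_inner T H y w + M * L2L2_inner T Q q f"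
  define r where "r = sqrt ((L2L2_norm T H w)\<^sup>2 + M * (L2L2_norm T Q f)\<^sup>2)"
  have r2: "r\<^sup>2 = (L2L2_norm T H w)\<^sup>2 + M * (L2L2_norm T Q f)\<^sup>2"
    unfolding r_def using M by simp
  \<comment> \<open>Moving from \<open>q\<close> to \<open>q + c f\<close> changes the cost by
    \<open>c k + c^2 r^2 / 2\<close>. Minimality makes twice this a nonnegative quadratic in
    \<open>c\<close> without constant term, which forces \<open>k = 0\<close>.\<close>
  have "\<bar>k\<bar> \<le> 0 * r"
  proof (rule abs_le_mult_if_quadratic_nonneg)
    show "0 \<le> r" unfolding r_def using M by simp
    fix c :: real
    define p where "p = (\<lambda>t x. q t x + c * f t x)"
    have p: "p \<in> L2L2_space T Q" unfolding p_def by (rule L2.bochner_L2_add_mult[OF q f])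
    \<comment> \<open>The deviation of the chosen state for \<open>p\<close> from the affine
      prediction. It solves the problem with zero flux, so it has norm 0 and its cross term vanishes
      by Cauchy-Schwarz.\<close>
    define d where "d = (\<lambda>t x. (S p t x - S q t x) + (- c) * w t x)"
    have "zero_data_solution d (\<lambda>t x. (p t x - q t x) + (- c) * f t x)"
      unfolding d_def
      by (rule zero_data_solution_add_mult[OF heat_solution_diff[OF v\<^sub>b g p q sol[OF p] sol[OF q]] w])
    moreover have "(\<lambda>t x. (p t x - q t x) + (- c) * f t x) = (\<lambda>t x. 0)" by (simp add: p_def)
    ultimately have d: "zero_data_solution d (\<lambda>t x. 0)" by simp
    have dL2: "d \<in> L2L2_space T H" by (rule bochner_V0_L2L2[OF zero_data_solutionD(1)[OF d]])
    define e where "e = (\<lambda>t x. y t x + c * w t x)"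
    have e: "e \<in> L2L2_space T H" unfolding e_def by (rule L2.bochner_L2_add_mult[OF y wL2])
    have "(\<lambda>t x. S p t x - z\<^sub>d t x) = (\<lambda>t x. e t x + 1 * d t x)"
      by (simp add: d_def e_def y_def)
    then have "(L2L2_norm T H (\<lambda>t x. S p t x - z\<^sub>d t x))\<^sup>2 = (L2L2_norm T H e)\<^sup>2 + 2 * L2L2_inner T H e d"
      using L2L2_norm_add_mult_power2[OF e dL2, of 1] zero_data_solution_null[OF d] by simp
    also have "L2L2_inner T H e d = 0"
      using L2L2_Cauchy_Schwarz[OF e dL2] zero_data_solution_null[OF d] by simp
    also have "(L2L2_norm T H e)\<^sup>2 = (L2L2_norm T H y)\<^sup>2 + 2 * c * L2L2_inner T H y w + c\<^sup>2 * (L2L2_norm T H w)\<^sup>2"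
      unfolding e_def by (rule L2L2_norm_add_mult_power2[OF y wL2])
    finally have 1: "(L2L2_norm T H (\<lambda>t x. S p t x - z\<^sub>d t x))\<^sup>2 =
        (L2L2_norm T H y)\<^sup>2 + 2 * c * L2L2_inner T H y w + c\<^sup>2 * (L2L2_norm T H w)\<^sup>2" by simp
    have 2: "(L2L2_norm T Q p)\<^sup>2 = (L2L2_norm T Q q)\<^sup>2 + 2 * c * L2L2_inner T Q q f + c\<^sup>2 * (L2L2_norm T Q f)\<^sup>2"
      unfolding p_def by (rule L2L2_norm_add_mult_power2[OF q f])
    have "1/2 * (L2L2_norm T H y)\<^sup>2 + M/2 * (L2L2_norm T Q q)\<^sup>2 \<le>
        1/2 * (L2L2_norm T H (\<lambda>t x. S p t x - z\<^sub>d t x))\<^sup>2 + M/2 * (L2L2_norm T Q p)\<^sup>2"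
      using min[OF p] unfolding J_1_def S_def[symmetric] y_def[symmetric] by simp
    then show "0 \<le> 0\<^sup>2 + 2 * c * k + c\<^sup>2 * r\<^sup>2"
      unfolding 1 2 r2 k_def by (simp add: field_simps)
  qed simp
  then show ?thesis by (simp add: k_def y_def S_def)
qed

theorem minimizer_distance:
  assumes wp: "heat_well_posed \<Omega> \<Gamma>\<^sub>1 \<Gamma>\<^sub>2 T \<gamma> v\<^sub>b" and v\<^sub>b: "v\<^sub>b \<in> H1_space \<Omega>"
    and z\<^sub>d: "z\<^sub>d \<in> L2L2_space T H" and M: "0 < M"
    and g: "g \<in> L2L2_space T H" "g' \<in> L2L2_space T H"
    and q: "q \<in> L2L2_space T Q" "q' \<in> L2L2_space T Q"
    and min: "\<And>p. p \<in> L2L2_space T Q \<Longrightarrow>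
      J_1 \<Omega> \<Gamma>\<^sub>1 \<Gamma>\<^sub>2 T \<gamma> v\<^sub>b z\<^sub>d M M\<^sub>1 g q \<le> J_1 \<Omega> \<Gamma>\<^sub>1 \<Gamma>\<^sub>2 T \<gamma> v\<^sub>b z\<^sub>d M M\<^sub>1 g p"
    and min': "\<And>p. p \<in> L2L2_space T Q \<Longrightarrow>
      J_1 \<Omega> \<Gamma>\<^sub>1 \<Gamma>\<^sub>2 T \<gamma> v\<^sub>b z\<^sub>d M M\<^sub>1 g' q' \<le> J_1 \<Omega> \<Gamma>\<^sub>1 \<Gamma>\<^sub>2 T \<gamma> v\<^sub>b z\<^sub>d M M\<^sub>1 g' p"
  shows "L2L2_norm T Q (\<lambda>t x. q t x - q' t x) \<le> trace_norm \<Omega> \<Gamma>\<^sub>2 \<gamma> / (lam * M) *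
    L2L2_norm T H (\<lambda>t x. heat_state \<Omega> \<Gamma>\<^sub>1 \<Gamma>\<^sub>2 T \<gamma> v\<^sub>b g' q' t x - heat_state \<Omega> \<Gamma>\<^sub>1 \<Gamma>\<^sub>2 T \<gamma> v\<^sub>b g q t x)"
proof -
  define u where "u = heat_state \<Omega> \<Gamma>\<^sub>1 \<Gamma>\<^sub>2 T \<gamma> v\<^sub>b g q"
  define u' where "u' = heat_state \<Omega> \<Gamma>\<^sub>1 \<Gamma>\<^sub>2 T \<gamma> v\<^sub>b g' q'"
  define f where "f = (\<lambda>t x. q t x - q' t x)"
  \<comment> \<open>An auxiliary state that pairs the source \<open>g\<close> with the other flux
    \<open>q'\<close>, so that \<open>u - v\<close> is a difference of states with one and the same
    source.\<close>
  define v where "v = heat_state \<Omega> \<Gamma>\<^sub>1 \<Gamma>\<^sub>2 T \<gamma> v\<^sub>b g q'"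
  define w where "w = (\<lambda>t x. u t x - v t x)"
  define \<delta> where "\<delta> = (\<lambda>t x. u' t x - u t x)"
  have su: "is_heat_solution \<Omega> \<Gamma>\<^sub>1 \<Gamma>\<^sub>2 T \<gamma> v\<^sub>b g q u" and su': "is_heat_solution \<Omega> \<Gamma>\<^sub>1 \<Gamma>\<^sub>2 T \<gamma> v\<^sub>b g' q' u'"
    and sv: "is_heat_solution \<Omega> \<Gamma>\<^sub>1 \<Gamma>\<^sub>2 T \<gamma> v\<^sub>b g q' v"
    unfolding u_def u'_def v_def by (rule heat_state_solution[OF wp], fact+)+
  have w: "zero_data_solution w f"
    unfolding w_def f_def by (rule heat_solution_diff[OF v\<^sub>b g(1) q su sv])
  note f = zero_data_solutionD(2)[OF w]
  have wL2: "w \<in> L2L2_space T H" by (rule bochner_V0_L2L2[OF zero_data_solutionD(1)[OF w]])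
  note uL2 = heat_solution_mem(2)[OF su v\<^sub>b] and u'L2 = heat_solution_mem(2)[OF su' v\<^sub>b]
  note \<delta>L2 = L2.bochner_L2_diff[OF u'L2 uL2, folded \<delta>_def]
  have "L2L2_inner T H (\<lambda>t x. u t x - z\<^sub>d t x) w + M * L2L2_inner T Q q f = 0"
    unfolding u_def by (rule minimizer_stationary[OF wp v\<^sub>b z\<^sub>d g(1) q(1) M min w])
  \<comment> \<open>The same \<open>w\<close> is admissible at \<open>g'\<close>, since the problem
    it solves involves \<open>f\<close> alone.\<close>
  moreover have "L2L2_inner T H (\<lambda>t x. u' t x - z\<^sub>d t x) w + M * L2L2_inner T Q q' f = 0"
    unfolding u'_def by (rule minimizer_stationary[OF wp v\<^sub>b z\<^sub>d g(2) q(2) M min' w])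
  ultimately have "M * (L2L2_inner T Q q f - L2L2_inner T Q q' f) = L2L2_inner T H \<delta> w"
    unfolding \<delta>_def L2L2_inner_diff_left[OF uL2 z\<^sub>d wL2] L2L2_inner_diff_left[OF u'L2 z\<^sub>d wL2]
      L2L2_inner_diff_left[OF u'L2 uL2 wL2] by (simp add: right_diff_distrib)
  moreover have "L2L2_inner T Q q f - L2L2_inner T Q q' f = L2L2_inner T Q f f"
    using L2L2_inner_diff_left[OF q f] unfolding f_def by simp
  moreover have "L2L2_inner T Q f f = (L2L2_norm T Q f)\<^sup>2"
    by (simp add: L2L2_inner_def L2_inner_self L2L2_norm_power2)
  ultimately have "M * (L2L2_norm T Q f)\<^sup>2 = L2L2_inner T H \<delta> w" by simp
  also have "\<dots> \<le> L2L2_norm T H \<delta> * L2L2_norm T H w"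
    using L2L2_Cauchy_Schwarz[OF \<delta>L2 wL2] by simp
  finally have "lam * (M * (L2L2_norm T Q f)\<^sup>2) \<le> lam * (L2L2_norm T H \<delta> * L2L2_norm T H w)"
    using lam_pos by (intro mult_left_mono) auto
  also have "\<dots> = L2L2_norm T H \<delta> * (lam * L2L2_norm T H w)" by simp
  also have "\<dots> \<le> L2L2_norm T H \<delta> * (trace_const * L2L2_norm T Q f)"
    by (rule mult_left_mono[OF zero_data_solution_bound[OF w] L2L2_norm_nonneg])
  finally have le: "(lam * M * L2L2_norm T Q f) * L2L2_norm T Q f \<le>
      (trace_const * L2L2_norm T H \<delta>) * L2L2_norm T Q f"
    by (simp add: power2_eq_square algebra_simps)
  have "lam * M * L2L2_norm T Q f \<le> trace_const * L2L2_norm T H \<delta>"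
  proof (cases "L2L2_norm T Q f = 0")
    case True
    then show ?thesis using trace_bound(1) L2L2_norm_nonneg[of T H \<delta>] by simp
  next
    case False
    then have "0 < L2L2_norm T Q f" using L2L2_norm_nonneg[of T Q f] by simp
    with le show ?thesis by (simp only: mult_le_cancel_right_pos)
  qed
  also have "trace_const * L2L2_norm T H \<delta> = trace_norm \<Omega> \<Gamma>\<^sub>2 \<gamma> * L2L2_norm T H \<delta>"
  proof (cases "\<forall>v\<in>H1_space \<Omega>. NV v = 0")
    \<comment> \<open>The degenerate case in which \<open>trace_const\<close> is set to 0: all
      elements of \<open>\<V>\<close> are null, in particular the difference of the states, so both
      products are 0.\<close>
    case True
    have \<delta>: "\<delta> \<in> \<V>"
      using V0.bochner_L2_diff[OF heat_solution_mem(1)[OF su' v\<^sub>b] heat_solution_mem(1)[OF su v\<^sub>b]]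
      unfolding \<delta>_def by simp
    have "AE t in time_measure T. (NV (\<delta> t))\<^sup>2 = 0"
      using V0.bochner_L2D(1)[OF \<delta>] by eventually_elim (use True V0_H1 in auto)
    then have "(\<integral>t. (NV (\<delta> t))\<^sup>2 \<partial>time_measure T) = 0" by (rule integral_eq_zero_AE)
    then have "bochner_norm T NV \<delta> = 0" by (simp add: bochner_norm_def)
    then have "L2L2_norm T H \<delta> = 0"
      using L2L2_norm_le_V0_norm[OF \<delta>] L2L2_norm_nonneg[of T H \<delta>] by simp
    then show ?thesis by simp
  qed (simp only: trace_const_def if_False)
  finally have "L2L2_norm T Q f \<le> trace_norm \<Omega> \<Gamma>\<^sub>2 \<gamma> / (lam * M) * L2L2_norm T H \<delta>"
    using lam_pos M by (simp add: pos_le_divide_eq mult.commute)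
  then show ?thesis unfolding f_def \<delta>_def u_def u'_def .
qed

end

theorem theorem4p2:
  fixes \<Omega> \<Gamma>\<^sub>1 \<Gamma>\<^sub>2 :: "'a::euclidean_space set"
    and \<gamma> :: "('a \<Rightarrow> real) \<Rightarrow> ('a \<Rightarrow> real)"
    and b v\<^sub>b :: "'a \<Rightarrow> real"
    and z\<^sub>d gg qq :: "real \<Rightarrow> 'a \<Rightarrow> real"
    and qbar :: "(real \<Rightarrow> 'a \<Rightarrow> real) \<Rightarrow> (real \<Rightarrow> 'a \<Rightarrow> real)"
    and T M M\<^sub>1 lam\<^sub>0 :: real
  assumes "bounded_regular_domain \<Omega>"
    and "\<Gamma>\<^sub>1 \<union> \<Gamma>\<^sub>2 = frontier \<Omega>" and "\<Gamma>\<^sub>1 \<inter> \<Gamma>\<^sub>2 = {}"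
    and "\<Gamma>\<^sub>1 \<in> sets (hausdorff_measure (DIM('a) - 1))" and "emeasure (hausdorff_measure (DIM('a) - 1)) \<Gamma>\<^sub>1 > 0"
    and "\<Gamma>\<^sub>2 \<in> sets (hausdorff_measure (DIM('a) - 1))" and "emeasure (hausdorff_measure (DIM('a) - 1)) \<Gamma>\<^sub>2 > 0"
    and "T > 0" and "M > 0" and "M\<^sub>1 > 0"
    and "is_trace_operator \<Omega> \<gamma>"
    and "lam\<^sub>0 > 0" and "\<forall>v \<in> V0_space \<Omega> \<Gamma>\<^sub>1 \<gamma>. energy_form \<Omega> v v \<ge> lam\<^sub>0 * (H1_norm \<Omega> v)\<^sup>2"
    and "z\<^sub>d \<in> L2L2_space T (lebesgue_on \<Omega>)"
    and "b \<in> H_half_space \<Gamma>\<^sub>1"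
    and "v\<^sub>b \<in> H1_space \<Omega>" and "AE x in surface_measure \<Gamma>\<^sub>1. \<gamma> v\<^sub>b x = b x"
    and "heat_well_posed \<Omega> \<Gamma>\<^sub>1 \<Gamma>\<^sub>2 T \<gamma> v\<^sub>b"
    and "is_unique_minimizer
           (L2L2_space T (lebesgue_on \<Omega>) \<times> L2L2_space T (surface_measure \<Gamma>\<^sub>2))
           (\<lambda>(g, q) (g', q'). ae_eq T (lebesgue_on \<Omega>) g g' \<and> ae_eq T (surface_measure \<Gamma>\<^sub>2) q q')
           (J_plus \<Omega> \<Gamma>\<^sub>1 \<Gamma>\<^sub>2 T \<gamma> v\<^sub>b z\<^sub>d M M\<^sub>1) (gg, qq)"
    and "\<forall>g \<in> L2L2_space T (lebesgue_on \<Omega>).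
           is_unique_minimizer (L2L2_space T (surface_measure \<Gamma>\<^sub>2)) (ae_eq T (surface_measure \<Gamma>\<^sub>2))
             (J_1 \<Omega> \<Gamma>\<^sub>1 \<Gamma>\<^sub>2 T \<gamma> v\<^sub>b z\<^sub>d M M\<^sub>1 g) (qbar g)"
  shows "\<forall>g \<in> L2L2_space T (lebesgue_on \<Omega>).
           L2L2_norm T (surface_measure \<Gamma>\<^sub>2) (\<lambda>t x. qbar g t x - qq t x) \<le>
           trace_norm \<Omega> \<Gamma>\<^sub>2 \<gamma> / (lam\<^sub>0 * M) *
           L2L2_norm T (lebesgue_on \<Omega>)
             (\<lambda>t x. heat_state \<Omega> \<Gamma>\<^sub>1 \<Gamma>\<^sub>2 T \<gamma> v\<^sub>b gg qq t x - heat_state \<Omega> \<Gamma>\<^sub>1 \<Gamma>\<^sub>2 T \<gamma> v\<^sub>b g (qbar g) t x)"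
proof
  fix g assume g: "g \<in> L2L2_space T (lebesgue_on \<Omega>)"
  interpret mixed_heat_problem \<Omega> \<Gamma>\<^sub>1 \<Gamma>\<^sub>2 \<gamma> T lam\<^sub>0
    by unfold_locales (use assms(1-4,6,8,11-13) in \<open>simp_all add: bounded_regular_domain_def\<close>)
  have J: "J_plus \<Omega> \<Gamma>\<^sub>1 \<Gamma>\<^sub>2 T \<gamma> v\<^sub>b z\<^sub>d M M\<^sub>1 (h, q) = J_1 \<Omega> \<Gamma>\<^sub>1 \<Gamma>\<^sub>2 T \<gamma> v\<^sub>b z\<^sub>d M M\<^sub>1 h q" for h q
    by (simp add: J_plus_def J_1_def)
  have gq: "gg \<in> L2L2_space T H" "qq \<in> L2L2_space T Q"
    and min_plus: "\<And>p. p \<in> L2L2_space T H \<times> L2L2_space T Q \<Longrightarrow>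
      J_plus \<Omega> \<Gamma>\<^sub>1 \<Gamma>\<^sub>2 T \<gamma> v\<^sub>b z\<^sub>d M M\<^sub>1 (gg, qq) \<le> J_plus \<Omega> \<Gamma>\<^sub>1 \<Gamma>\<^sub>2 T \<gamma> v\<^sub>b z\<^sub>d M M\<^sub>1 p"
    using assms(19) unfolding is_unique_minimizer_def by auto
  have qbar: "qbar g \<in> L2L2_space T Q"
    and min_1: "\<And>p. p \<in> L2L2_space T Q \<Longrightarrow>
      J_1 \<Omega> \<Gamma>\<^sub>1 \<Gamma>\<^sub>2 T \<gamma> v\<^sub>b z\<^sub>d M M\<^sub>1 g (qbar g) \<le> J_1 \<Omega> \<Gamma>\<^sub>1 \<Gamma>\<^sub>2 T \<gamma> v\<^sub>b z\<^sub>d M M\<^sub>1 g p"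
    using bspec[OF assms(20) g] unfolding is_unique_minimizer_def by auto
  \<comment> \<open>Competitors \<open>(gg, p)\<close> show that the pair's second component
    minimizes the cost for the fixed source \<open>gg\<close>, which makes the comparison symmetric
    in the two fluxes.\<close>
  have min_gg: "J_1 \<Omega> \<Gamma>\<^sub>1 \<Gamma>\<^sub>2 T \<gamma> v\<^sub>b z\<^sub>d M M\<^sub>1 gg qq \<le> J_1 \<Omega> \<Gamma>\<^sub>1 \<Gamma>\<^sub>2 T \<gamma> v\<^sub>b z\<^sub>d M M\<^sub>1 gg p"
    if "p \<in> L2L2_space T Q" for p
    using min_plus[of "(gg, p)"] that gq by (simp add: J)
  show "L2L2_norm T Q (\<lambda>t x. qbar g t x - qq t x) \<le> trace_norm \<Omega> \<Gamma>\<^sub>2 \<gamma> / (lam\<^sub>0 * M) *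
      L2L2_norm T H (\<lambda>t x. heat_state \<Omega> \<Gamma>\<^sub>1 \<Gamma>\<^sub>2 T \<gamma> v\<^sub>b gg qq t x - heat_state \<Omega> \<Gamma>\<^sub>1 \<Gamma>\<^sub>2 T \<gamma> v\<^sub>b g (qbar g) t x)"
    by (rule minimizer_distance[OF assms(18,16,14,9) g gq(1) qbar gq(2) min_1 min_gg])
qed

end
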